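(* Let $d\ge 1$ and, for every $h\in(0,1)$, let $B=B^{(h)}:(h\mathbb{Z})^d\to\mathbb{R}^d$ and $V=V^{(h)}:(h\mathbb{Z})^d\to\mathbb{R}$ be given, bounded uniformly in $h$, i.e. there is $M<\infty$ with $|B^{(h)}(n)|\le M$ and $|V^{(h)}(n)|\le M$ for all $h\in(0,1)$ and all $n\in(h\mathbb{Z})^d$. Let $P_h$ be the associated discrete magnetic Schrödinger operator. Then there exist $\alpha\in(0,1)$, $c_0>0$, $h_0\in(0,1)$ and $C>1$ (independent of $h$ and $u$) such that for all $h\in(0,h_0)$ and all $u:(h\mathbb{Z})^d\to\mathbb{R}$ with $P_hu=0$ in $B_4$ we have $$\|u\|_{L^2(B_1)}\le C\left(\|u\|_{L^2(B_{1/2})}^{\alpha}\|u\|_{L^2(B_2)}^{1-\alpha}+e^{-c_0h^{-1}}\|u\|_{L^2(B_2)}\right).$$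
   Context: For $h>0$ and $f:(h\mathbb{Z})^d\to\mathbb{R}$, with $e_j$ the $j$-th unit vector, set $D^h_{\pm,j}f(n):=\pm(f(n\pm he_j)-f(n))$ and $\Delta_df(n):=\sum_{j=1}^dD^h_{-,j}D^h_{+,j}f(n)=\sum_{j=1}^d\big(f(n+he_j)+f(n-he_j)-2f(n)\big)$ (the non-normalized discrete Laplacian). The discrete magnetic Schrödinger operator is $$P_hf(n):=h^{-2}\Delta_df(n)+h^{-1}\sum_{j=1}^dB_j(n)D^h_{+,j}f(n)+V(n)f(n),\qquad B=(B_1,\dots,B_d).$$ For $r>0$, $B_r:=B_r(0)\cap(h\mathbb{Z})^d$, where $B_r(0)$ is the Euclidean ball in $\mathbb{R}^d$ of radius $r$ centred at $0$ (the set $B_r$ is not to be confused with the components $B_j$ of the field $B$). All $L^2$ norms are $L^2$ norms on the lattice: $\|u\|_{L^2(B_r)}^2=\sum_{n\in B_r}|u(n)|^2$. *)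

theory Defs
  imports "HOL-Analysis.Analysis"
begin

text \<open>A function on the lattice is a total function on \<open>real ^ 'd\<close>
  of which only the values at lattice points are ever used.\<close>

definition lattice :: "real \<Rightarrow> (real ^ 'd) set" where
  "lattice h = {n. \<forall>j. \<exists>k::int. n $ j = h * of_int k}"

definition lattice_ball :: "real \<Rightarrow> real \<Rightarrow> (real ^ 'd) set" where
  "lattice_ball h r = ball 0 r \<inter> lattice h"

definition fwd_diff :: "real \<Rightarrow> 'd \<Rightarrow> (real ^ 'd \<Rightarrow> real) \<Rightarrow> real ^ 'd \<Rightarrow> real" where
  "fwd_diff h j f n = f (n + h *\<^sub>R axis j 1) - f n"

definition bwd_diff :: "real \<Rightarrow> 'd \<Rightarrow> (real ^ 'd \<Rightarrow> real) \<Rightarrow> real ^ 'd \<Rightarrow> real" where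
  "bwd_diff h j f n = - (f (n - h *\<^sub>R axis j 1) - f n)"

definition disc_laplacian :: "real \<Rightarrow> (real ^ 'd \<Rightarrow> real) \<Rightarrow> real ^ 'd \<Rightarrow> real" where
  "disc_laplacian h f n = (\<Sum>j\<in>UNIV. bwd_diff h j (fwd_diff h j f) n)"

definition magnetic_schroedinger ::
    "real \<Rightarrow> (real ^ 'd \<Rightarrow> real ^ 'd) \<Rightarrow> (real ^ 'd \<Rightarrow> real) \<Rightarrow> (real ^ 'd \<Rightarrow> real) \<Rightarrow> real ^ 'd \<Rightarrow> real" where
  "magnetic_schroedinger h B V f n =
     inverse (h\<^sup>2) * disc_laplacian h f n
     + inverse h * (\<Sum>j\<in>UNIV. B n $ j * fwd_diff h j f n)
     + V n * f n"

lemma disc_laplacian_eq: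
  "disc_laplacian h f n =
     (\<Sum>j\<in>UNIV. f (n + h *\<^sub>R axis j 1) + f (n - h *\<^sub>R axis j 1) - 2 * f n)"
  by (simp add: disc_laplacian_def fwd_diff_def bwd_diff_def algebra_simps)

text \<open>Finiteness matters because \<^const>\<open>L2_set\<close> is \<open>0\<close> on infinite sets.\<close>

lemma finite_lattice_ball:
  assumes "h > 0"
  shows "finite (lattice_ball h r :: (real ^ 'd) set)"
proof -
  let ?K = "{- \<lceil>r / h\<rceil>..\<lceil>r / h\<rceil>}"
  let ?F = "Pi\<^sub>E (UNIV :: 'd set) (\<lambda>_. ?K)"
  have "lattice_ball h r \<subseteq> (\<lambda>k. \<chi> j. h * of_int (k j)) ` ?F"
  proof
    fix n :: "real ^ 'd"
    assume n: "n \<in> lattice_ball h r"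
    then obtain k :: "'d \<Rightarrow> int" where k: "\<And>j. n $ j = h * of_int (k j)"
      unfolding lattice_ball_def lattice_def by simp metis
    have "k j \<in> ?K" for j
    proof -
      have "\<bar>n $ j\<bar> < r"
        using n component_le_norm_cart[of n j] by (simp add: lattice_ball_def)
      then have "\<bar>of_int (k j)\<bar> < r / h"
        using assms by (simp add: k abs_mult field_simps)
      then show ?thesis
        by simp linarith
    qed
    moreover have "n = (\<chi> j. h * of_int (k j))"
      by (simp add: vec_eq_iff k)
    ultimately show "n \<in> (\<lambda>k. \<chi> j. h * of_int (k j)) ` ?F"
      by blast
  qed
  moreover have "finite ?F"
    by (intro finite_PiE) auto
  ultimately show ?thesis
    by (meson finite_imageI finite_subset)
qed

end

theory Submission imports Defs begin

text \<open>The proof is a Carleman estimate. With \<open>\<psi> = \<tau> \<phi>\<close>, let \<open>L\<close> be the conjugate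
  \<open>e\<^sup>\<psi> \<Delta> e\<^sup>-\<^sup>\<psi>\<close> of the discrete Laplacian and \<open>L'\<close> its adjoint, which is the conjugate by \<open>-\<psi>\<close>. For every real
  \<open>g\<close>, \<open>\<parallel>Lf\<parallel>\<^sup>2 \<ge> \<parallel>Lf\<parallel>\<^sup>2 - \<parallel>L'f - 2gf\<parallel>\<^sup>2\<close>. The difference \<open>\<parallel>Lf\<parallel>\<^sup>2 - \<parallel>L'f\<parallel>\<^sup>2\<close> is a sum over the
  plaquettes of the lattice of \<open>sinh\<close> of a mixed second difference of \<open>\<psi>\<close> times a quadratic form in the four
  corner values of \<open>f\<close>; for \<open>\<tau>h\<close> and \<open>1/\<tau>\<close> small it is, to leading order,
  \<open>8 (\<tau> Hess \<phi>(\<nabla>f, \<nabla>f) + \<tau>\<^sup>3 Hess \<phi>(\<nabla>\<phi>, \<nabla>\<phi>) f\<^sup>2)\<close>. Taking \<open>g\<close> to be a negative multiple of \<open>\<tau>\<close> adds a multiple of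
  \<open>\<tau> |\<nabla>f|\<^sup>2 - \<tau>\<^sup>3 |\<nabla>\<phi>|\<^sup>2 f\<^sup>2\<close>, which compensates the tangential concavity of the radially decreasing weight
  \<open>\<phi> = |x|\<^sup>4/2 - a|x|\<^sup>2\<close> on a thin annulus. Applied to a truncated solution, with the commutator terms controlled by
  the Caccioppoli inequality, this propagates smallness from the ball of radius \<open>r\<close> to that of radius \<open>1.1 r\<close>;
  the constraint \<open>\<tau> \<le> \<delta>/h\<close> in the choice of \<open>\<tau>\<close> produces the term \<open>e\<^sup>-\<^sup>c\<^sup>/\<^sup>h\<close>. Eight such steps lead from
  radius \<open>1/2\<close> to radius \<open>1\<close>.\<close>

section \<open>Discrete commutator identities\<close>

text \<open>The commutator form alone is not positive. The Hessian of the weight is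
  \<open>2 (|x|^2 - a) Id + 4 x x^T\<close>, so its tangential eigenvalue is negative exactly where
  the weight decreases radially, and decrease is what lets information travel outwards. The shift by
  \<open>g\<close> pays for the missing gradient term out of the surplus in the zero-order term.
  There is room for this as long as \<open>a\<close> is less than twice the smallest
  \<open>|x|^2\<close> on the annulus; since \<open>a\<close> also has to exceed the largest
  \<open>|x|^2\<close>, that quantity may vary by a factor below 2 only, hence the short steps.
  Discreteness enters through the size of \<open>\<tau> h\<close>: moving to a neighbour changes
  \<psi> by about \<open>\<tau> h\<close> times a derivative of \<phi>, and only when this is small
  do \<open>sinh\<close> and \<open>cosh\<close> have the expansions that reproduce the continuous
  computation. The Laplacian is not normalised, so all terms carry powers of \<open>h\<close>: the
  mass comes with \<open>\<tau>^3 h^4\<close>, the gradient with \<open>\<tau> h^2\<close>, and the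
  cutoff errors, after Caccioppoli, with \<open>h^4\<close>. This last power cancels and the
  constants do not depend on \<open>h\<close>.\<close>

definition conj_laplacian ::
    "('i::finite \<Rightarrow> 'a::ab_group_add) \<Rightarrow> ('a \<Rightarrow> real) \<Rightarrow> ('a \<Rightarrow> real) \<Rightarrow> 'a \<Rightarrow> real" where
  "conj_laplacian e \<psi> f n =
     (\<Sum>j\<in>UNIV. exp (\<psi> n - \<psi> (n + e j)) * f (n + e j) + exp (\<psi> n - \<psi> (n - e j)) * f (n - e j) - 2 * f n)"

text \<open>The hypotheses put the support of \<open>F\<close> inside both \<open>A\<close> and its
  translate by \<open>v\<close>, so each side is the sum over the whole support.\<close>

lemma sum_shift:
  fixes F :: "'a::ab_group_add \<Rightarrow> real"
  assumes "finite A" "\<And>n. F n \<noteq> 0 \<Longrightarrow> n \<in> A" "\<And>n. F n \<noteq> 0 \<Longrightarrow> n - v \<in> A"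
  shows "(\<Sum>n\<in>A. F (n + v)) = (\<Sum>n\<in>A. F n)"
proof -
  have "(\<Sum>n\<in>A. F (n + v)) = (\<Sum>n\<in>{n. F (n + v) \<noteq> 0}. F (n + v))"
    using assms(3) by (intro sum.mono_neutral_right assms(1)) (auto dest: assms(3))
  also have "\<dots> = (\<Sum>n\<in>{n. F n \<noteq> 0}. F n)"
    by (rule sum.reindex_bij_witness[of _ "\<lambda>n. n - v" "\<lambda>n. n + v"]) auto
  also have "\<dots> = (\<Sum>n\<in>A. F n)"
    using assms(2) by (intro sum.mono_neutral_left assms(1)) auto
  finally show ?thesis .
qed

text \<open>Squaring a second-order operator couples points two steps apart; with two steps of
  padding every such sum over \<open>A\<close> may be translated as if it ran over the whole group.
  The steps \<open>e j\<close> live in an arbitrary abelian group, which keeps the identities purely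
  algebraic. The pattern \<open>n - e j + e k\<close> is the fifth one with \<open>j\<close> and
  \<open>k\<close> exchanged.\<close>

locale padded_support =
  fixes e :: "'i::finite \<Rightarrow> 'a::ab_group_add" and A :: "'a set" and f :: "'a \<Rightarrow> real"
  assumes finite_A: "finite A"
    and padding: "f n \<noteq> 0 \<Longrightarrow> n \<in> A" "f n \<noteq> 0 \<Longrightarrow> n + e j \<in> A" "f n \<noteq> 0 \<Longrightarrow> n - e j \<in> A"
      "f n \<noteq> 0 \<Longrightarrow> n + e j + e k \<in> A" "f n \<noteq> 0 \<Longrightarrow> n + e j - e k \<in> A"
      "f n \<noteq> 0 \<Longrightarrow> n - e j - e k \<in> A"
begin

text \<open>The coefficient on an edge changes sign when the endpoints are exchanged, so this is the
  quadratic form of an antisymmetric operator.\<close>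

lemma sum_sinh_antisymmetric:
  "(\<Sum>n\<in>A. sinh (\<psi> (n + e j) - \<psi> n) * f (n + e j) * f n
      + sinh (\<psi> (n - e j) - \<psi> n) * f (n - e j) * f n) = 0"
proof -
  let ?F = "\<lambda>n. sinh (\<psi> (n - e j) - \<psi> n) * f (n - e j) * f n"
  have "(\<Sum>n\<in>A. ?F n) = (\<Sum>n\<in>A. ?F (n + e j))"
    by (rule sum_shift[symmetric]) (auto intro: finite_A padding)
  moreover have "?F (n + e j) = - (sinh (\<psi> (n + e j) - \<psi> n) * f (n + e j) * f n)" for n
    using sinh_minus[of "\<psi> (n + e j) - \<psi> n"] by (simp add: algebra_simps)
  ultimately show ?thesis
    by (simp add: sum.distrib sum_negf)
qed

text \<open>Each of the four products on the left is a diagonal of one of the four plaquettes meeting at \<open>n\<close>; translating them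
  to a common plaquette makes the first-order terms in the arguments of \<open>sinh\<close> cancel. The identity also holds for \<open>j = k\<close>,
  where the plaquette degenerates to a segment of length two.\<close>

lemma sum_plaquette:
  "(\<Sum>n\<in>A. sinh (\<psi> (n + e j) + \<psi> (n + e k) - 2 * \<psi> n) * f (n + e j) * f (n + e k)
      + sinh (\<psi> (n - e j) + \<psi> (n - e k) - 2 * \<psi> n) * f (n - e j) * f (n - e k)
      + sinh (\<psi> (n + e j) + \<psi> (n - e k) - 2 * \<psi> n) * f (n + e j) * f (n - e k)
      + sinh (\<psi> (n - e j) + \<psi> (n + e k) - 2 * \<psi> n) * f (n - e j) * f (n + e k))
   = (\<Sum>n\<in>A. - 2 * (sinh (\<psi> n + \<psi> (n + e j + e k) - \<psi> (n + e j) - \<psi> (n + e k)) *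
        (cosh (\<psi> (n + e j + e k) - \<psi> n) * f (n + e j) * f (n + e k)
         - cosh (\<psi> (n + e j) - \<psi> (n + e k)) * f n * f (n + e j + e k))))"
  (is "(\<Sum>n\<in>A. ?F1 n + ?F2 n + ?F3 n + ?F4 n) = sum ?R A")
proof -
  have s2: "(\<Sum>n\<in>A. ?F2 n) = (\<Sum>n\<in>A. ?F2 (n + (e j + e k)))"
  proof (rule sum_shift[symmetric])
    fix n assume "?F2 n \<noteq> 0"
    then have "f (n - e j) \<noteq> 0" by auto
    then show "n \<in> A" "n - (e j + e k) \<in> A"
      using padding(2)[of "n - e j" j] padding(3)[of "n - e j" k]
      by (simp_all add: diff_diff_eq)
  qed (rule finite_A)
  have s3: "(\<Sum>n\<in>A. ?F3 n) = (\<Sum>n\<in>A. ?F3 (n + e k))"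
  proof (rule sum_shift[symmetric])
    fix n assume "?F3 n \<noteq> 0"
    then have "f (n - e k) \<noteq> 0" by auto
    then show "n \<in> A" "n - e k \<in> A"
      using padding(2)[of "n - e k" k] padding(1)[of "n - e k"] by simp_all
  qed (rule finite_A)
  have s4: "(\<Sum>n\<in>A. ?F4 n) = (\<Sum>n\<in>A. ?F4 (n + e j))"
  proof (rule sum_shift[symmetric])
    fix n assume "?F4 n \<noteq> 0"
    then have "f (n - e j) \<noteq> 0" by auto
    then show "n \<in> A" "n - e j \<in> A"
      using padding(2)[of "n - e j" j] padding(1)[of "n - e j"] by simp_all
  qed (rule finite_A)
  have "?F1 n + ?F2 (n + (e j + e k)) + ?F3 (n + e k) + ?F4 (n + e j) = ?R n" for n
  proof -
    define m E1 E2 where "m = \<psi> n + \<psi> (n + e j + e k) - \<psi> (n + e j) - \<psi> (n + e k)"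
      and "E1 = \<psi> (n + e j + e k) - \<psi> n" and "E2 = \<psi> (n + e j) - \<psi> (n + e k)"
    have idx: "n + (e j + e k) - e j = n + e k" "n + (e j + e k) - e k = n + e j"
      "n + (e j + e k) = n + e j + e k" "n + e k + e j = n + e j + e k"
      "n + e j - e j = n" "n + e k - e k = n"
      "n + e j + e k - e j = n + e k" "n + e j + e k - e k = n + e j"
      by (simp_all add: algebra_simps)
    have args: "\<psi> (n + e j) + \<psi> (n + e k) - 2 * \<psi> n = E1 - m"
      "\<psi> (n + e k) + \<psi> (n + e j) - 2 * \<psi> (n + e j + e k) = - E1 - m"
      "\<psi> (n + e j + e k) + \<psi> n - 2 * \<psi> (n + e k) = m + E2"
      "\<psi> n + \<psi> (n + e j + e k) - 2 * \<psi> (n + e j) = m - E2"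
      by (simp_all add: m_def E1_def E2_def)
    have "?F1 n + ?F2 (n + (e j + e k)) + ?F3 (n + e k) + ?F4 (n + e j)
      = sinh (E1 - m) * f (n + e j) * f (n + e k) + sinh (- E1 - m) * f (n + e k) * f (n + e j)
        + sinh (m + E2) * f (n + e j + e k) * f n + sinh (m - E2) * f n * f (n + e j + e k)"
      by (simp only: idx args)
    also have "\<dots> = ?R n"
      unfolding m_def[symmetric] E1_def[symmetric] E2_def[symmetric]
      by (simp add: sinh_add sinh_diff algebra_simps)
    finally show ?thesis .
  qed
  then show ?thesis
    unfolding sum.distrib s2 s3 s4 by (simp add: sum.distrib[symmetric])
qed

text \<open>The difference of squares factors into \<open>L - L'\<close>, which contains only
  \<open>sinh\<close>, times \<open>L + L'\<close>, which contains only \<open>cosh\<close> and the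
  diagonal. Symmetrised in \<open>j\<close> and \<open>k\<close>, the product is merged by the
  addition theorem for \<open>sinh\<close> into the four diagonal products of
  \<open>sum_plaquette\<close>.\<close>

lemma commutator_identity:
  "(\<Sum>n\<in>A. (conj_laplacian e \<psi> f n)\<^sup>2 - (conj_laplacian e (\<lambda>x. - \<psi> x) f n)\<^sup>2)
   = 4 * (\<Sum>n\<in>A. \<Sum>j\<in>UNIV. \<Sum>k\<in>UNIV.
        sinh (\<psi> n + \<psi> (n + e j + e k) - \<psi> (n + e j) - \<psi> (n + e k)) *
        (cosh (\<psi> (n + e j + e k) - \<psi> n) * f (n + e j) * f (n + e k)
         - cosh (\<psi> (n + e j) - \<psi> (n + e k)) * f n * f (n + e j + e k)))"
  (is "?lhs = 4 * (\<Sum>n\<in>A. \<Sum>j\<in>UNIV. \<Sum>k\<in>UNIV. ?R j k n)")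
proof -
  define s where "s j n = sinh (\<psi> (n + e j) - \<psi> n) * f (n + e j) + sinh (\<psi> (n - e j) - \<psi> n) * f (n - e j)" for j n
  define c where "c j n = cosh (\<psi> (n + e j) - \<psi> n) * f (n + e j) + cosh (\<psi> (n - e j) - \<psi> n) * f (n - e j)" for j n
  have minus: "conj_laplacian e \<psi> f n - conj_laplacian e (\<lambda>x. - \<psi> x) f n = - 2 * (\<Sum>j\<in>UNIV. s j n)" for n
    unfolding conj_laplacian_def sum_subtractf[symmetric] sum_distrib_left
    by (intro sum.cong refl) (simp add: s_def sinh_field_def field_simps)
  have plus: "conj_laplacian e \<psi> f n + conj_laplacian e (\<lambda>x. - \<psi> x) f n = 2 * (\<Sum>j\<in>UNIV. c j n) - 4 * real CARD('i) * f n" for n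
  proof -
    have "conj_laplacian e \<psi> f n + conj_laplacian e (\<lambda>x. - \<psi> x) f n = (\<Sum>j\<in>UNIV. 2 * c j n - 4 * f n)"
      unfolding conj_laplacian_def sum.distrib[symmetric] 
      by (intro sum.cong refl) (simp add: c_def cosh_field_def field_simps)
    then show ?thesis
      by (simp add: sum_subtractf sum_distrib_left)
  qed
  have sq: "(conj_laplacian e \<psi> f n)\<^sup>2 - (conj_laplacian e (\<lambda>x. - \<psi> x) f n)\<^sup>2
      = - 2 * (\<Sum>j\<in>UNIV. \<Sum>k\<in>UNIV. s j n * c k n + s k n * c j n)
        + 8 * real CARD('i) * (\<Sum>j\<in>UNIV. s j n * f n)" for n
  proof -
    have "(\<Sum>j\<in>UNIV. \<Sum>k\<in>UNIV. s j n * c k n + s k n * c j n) = 2 * ((\<Sum>j\<in>UNIV. s j n) * (\<Sum>k\<in>UNIV. c k n))"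
      by (simp add: sum.distrib sum_distrib_left[symmetric] sum_distrib_right[symmetric] sum_product[symmetric]
          algebra_simps)
    moreover have "(conj_laplacian e \<psi> f n)\<^sup>2 - (conj_laplacian e (\<lambda>x. - \<psi> x) f n)\<^sup>2
      = (conj_laplacian e \<psi> f n - conj_laplacian e (\<lambda>x. - \<psi> x) f n) * (conj_laplacian e \<psi> f n + conj_laplacian e (\<lambda>x. - \<psi> x) f n)"
      by (simp add: power2_eq_square algebra_simps)
    ultimately show ?thesis
      unfolding minus plus sum_distrib_right[symmetric] by (simp add: algebra_simps)
  qed
  \<comment> \<open>The diagonal part \<open>- 2 f\<close> of both operators meets only the
    antisymmetric part, so it disappears after summation.\<close>
  have z: "(\<Sum>n\<in>A. \<Sum>j\<in>UNIV. s j n * f n) = 0"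
    unfolding s_def by (subst sum.swap) (simp add: distrib_right sum_sinh_antisymmetric)
  have pl: "(\<Sum>n\<in>A. s j n * c k n + s k n * c j n) = (\<Sum>n\<in>A. - 2 * ?R j k n)" for j k
  proof -
    have "s j n * c k n + s k n * c j n =
       sinh ((\<psi> (n + e j) - \<psi> n) + (\<psi> (n + e k) - \<psi> n)) * f (n + e j) * f (n + e k)
      + sinh ((\<psi> (n - e j) - \<psi> n) + (\<psi> (n - e k) - \<psi> n)) * f (n - e j) * f (n - e k)
      + sinh ((\<psi> (n + e j) - \<psi> n) + (\<psi> (n - e k) - \<psi> n)) * f (n + e j) * f (n - e k)
      + sinh ((\<psi> (n - e j) - \<psi> n) + (\<psi> (n + e k) - \<psi> n)) * f (n - e j) * f (n + e k)" for n
      unfolding s_def c_def sinh_add by (simp add: algebra_simps)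
    then show ?thesis
      using sum_plaquette[of \<psi> j k] by (simp add: algebra_simps)
  qed
  have "?lhs = - 2 * (\<Sum>n\<in>A. \<Sum>j\<in>UNIV. \<Sum>k\<in>UNIV. s j n * c k n + s k n * c j n)"
    unfolding sq sum.distrib sum_distrib_left[symmetric] z by simp
  also have "\<dots> = - 2 * (\<Sum>j\<in>UNIV. \<Sum>k\<in>UNIV. \<Sum>n\<in>A. s j n * c k n + s k n * c j n)"
    by (subst sum.swap, subst (2) sum.swap) simp
  also have "\<dots> = 4 * (\<Sum>j\<in>UNIV. \<Sum>k\<in>UNIV. \<Sum>n\<in>A. ?R j k n)"
    unfolding pl sum_distrib_left[symmetric] by simp
  also have "\<dots> = 4 * (\<Sum>n\<in>A. \<Sum>j\<in>UNIV. \<Sum>k\<in>UNIV. ?R j k n)"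
    by (subst (2) sum.swap, subst sum.swap) simp
  finally show ?thesis .
qed

text \<open>This pairing is what the shift by \<open>g\<close> produces. Its \<open>sinh\<close>
  part is antisymmetric and drops out; in the \<open>cosh\<close> part, twice the product of
  neighbouring values is the sum of their squares minus the square of their difference, which leaves
  a negative Dirichlet energy and a zero-order term.\<close>

lemma sum_difference_form:
  "(\<Sum>n\<in>A. f n * conj_laplacian e (\<lambda>x. - \<psi> x) f n)
   = (\<Sum>n\<in>A. \<Sum>j\<in>UNIV. (cosh (\<psi> (n + e j) - \<psi> n) + cosh (\<psi> (n - e j) - \<psi> n) - 2) * (f n)\<^sup>2
        - cosh (\<psi> (n + e j) - \<psi> n) * (f (n + e j) - f n)\<^sup>2)"
proof -
  have "(\<Sum>n\<in>A. f n * (exp (\<psi> (n + e j) - \<psi> n) * f (n + e j) + exp (\<psi> (n - e j) - \<psi> n) * f (n - e j) - 2 * f n))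
    = (\<Sum>n\<in>A. (cosh (\<psi> (n + e j) - \<psi> n) + cosh (\<psi> (n - e j) - \<psi> n) - 2) * (f n)\<^sup>2
        - cosh (\<psi> (n + e j) - \<psi> n) * (f (n + e j) - f n)\<^sup>2)" for j
  proof -
    let ?G = "\<lambda>n. cosh (\<psi> (n - e j) - \<psi> n) * f (n - e j) * f n"
    let ?C = "\<lambda>n. cosh (\<psi> (n - e j) - \<psi> n) * (f n)\<^sup>2"
    have G: "(\<Sum>n\<in>A. ?G n) = (\<Sum>n\<in>A. ?G (n + e j))"
      by (rule sum_shift[symmetric]) (auto intro: finite_A padding)
    have C: "(\<Sum>n\<in>A. ?C n) = (\<Sum>n\<in>A. ?C (n + e j))"
      by (rule sum_shift[symmetric]) (auto intro: finite_A padding)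
    have sym: "cosh (\<psi> n - \<psi> (n + e j)) = cosh (\<psi> (n + e j) - \<psi> n)" for n
      using cosh_minus[of "\<psi> (n + e j) - \<psi> n"] by simp
    have "(\<Sum>n\<in>A. f n * (exp (\<psi> (n + e j) - \<psi> n) * f (n + e j) + exp (\<psi> (n - e j) - \<psi> n) * f (n - e j) - 2 * f n))
      = (\<Sum>n\<in>A. (sinh (\<psi> (n + e j) - \<psi> n) * f (n + e j) * f n + sinh (\<psi> (n - e j) - \<psi> n) * f (n - e j) * f n)
          + cosh (\<psi> (n + e j) - \<psi> n) * f (n + e j) * f n + ?G n - 2 * (f n)\<^sup>2)"
      unfolding cosh_plus_sinh[symmetric]
      by (intro sum.cong refl) (simp add: power2_eq_square algebra_simps)
    also have "\<dots> = (\<Sum>n\<in>A. 2 * (cosh (\<psi> (n + e j) - \<psi> n) * f (n + e j) * f n) - 2 * (f n)\<^sup>2)"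
      unfolding sum.distrib sum_subtractf sum_sinh_antisymmetric[unfolded sum.distrib] G
      by (simp add: sym sum.distrib[symmetric] sum_distrib_left algebra_simps)
    also have "\<dots> = (\<Sum>n\<in>A. cosh (\<psi> (n + e j) - \<psi> n) * (f n)\<^sup>2 + ?C (n + e j) - 2 * (f n)\<^sup>2
        - cosh (\<psi> (n + e j) - \<psi> n) * (f (n + e j) - f n)\<^sup>2)"
      by (intro sum.cong refl) (simp add: sym power2_eq_square algebra_simps)
    also have "\<dots> = (\<Sum>n\<in>A. (cosh (\<psi> (n + e j) - \<psi> n) + cosh (\<psi> (n - e j) - \<psi> n) - 2) * (f n)\<^sup>2
        - cosh (\<psi> (n + e j) - \<psi> n) * (f (n + e j) - f n)\<^sup>2)"
      using C by (simp add: sum.distrib sum_subtractf algebra_simps sum_distrib_left[symmetric])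
    finally show ?thesis .
  qed
  then show ?thesis
    unfolding conj_laplacian_def sum_distrib_left
    by (subst (1 2) sum.swap) (simp add: algebra_simps)
qed

end

section \<open>Expansion of the hyperbolic coefficients and of one plaquette\<close>

lemma sinh_taylor_bound:
  fixes x :: real assumes "\<bar>x\<bar> \<le> 1" shows "\<bar>sinh x - x\<bar> \<le> \<bar>x\<bar> ^ 3"
proof -
  have *: "\<exists>r. \<bar>r\<bar> \<le> 3 \<and> exp z = 1 + z + z\<^sup>2 / 2 + r / 6 * z ^ 3" if "\<bar>z\<bar> \<le> 1" for z :: real
  proof -
    obtain t where t: "\<bar>t\<bar> \<le> \<bar>z\<bar>" "exp z = (\<Sum>m<3. (z ^ m) / fact m) + (exp t / fact 3) * z ^ 3"
      using Maclaurin_exp_le by blast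
    have "exp t \<le> exp 1"
      using t that by simp
    with exp_le have "exp t \<le> 3"
      by linarith
    then show ?thesis
      using t(2)
      by (intro exI[of _ "exp t"]) (simp add: eval_nat_numeral field_simps)
  qed
  obtain r s where "\<bar>r\<bar> \<le> 3" "\<bar>s\<bar> \<le> 3" "exp x = 1 + x + x\<^sup>2 / 2 + r / 6 * x ^ 3"
    "exp (- x) = 1 + - x + (- x)\<^sup>2 / 2 + s / 6 * (- x) ^ 3"
    using *[of x] *[of "- x"] assms by auto
  then have "sinh x - x = (r + s) / 12 * x ^ 3" "\<bar>(r + s) / 12\<bar> \<le> 1"
    by (simp_all add: sinh_field_def field_simps)
  then show ?thesis
    by (metis abs_ge_zero abs_mult mult_left_le_one_le power_abs zero_le_power)
qed

lemma cosh_taylor_bound: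
  fixes x :: real assumes "\<bar>x\<bar> \<le> 1" shows "\<bar>cosh x - 1 - x\<^sup>2 / 2\<bar> \<le> x ^ 4"
proof -
  have *: "\<exists>r. \<bar>r\<bar> \<le> 3 \<and> exp z = 1 + z + z\<^sup>2 / 2 + z ^ 3 / 6 + r / 24 * z ^ 4" if "\<bar>z\<bar> \<le> 1" for z :: real
  proof -
    obtain t where t: "\<bar>t\<bar> \<le> \<bar>z\<bar>" "exp z = (\<Sum>m<4. (z ^ m) / fact m) + (exp t / fact 4) * z ^ 4"
      using Maclaurin_exp_le by blast
    have "exp t \<le> exp 1"
      using t that by simp
    with exp_le have "exp t \<le> 3"
      by linarith
    then show ?thesis
      using t(2)
      by (intro exI[of _ "exp t"]) (simp add: eval_nat_numeral field_simps)
  qed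
  obtain r s where "\<bar>r\<bar> \<le> 3" "\<bar>s\<bar> \<le> 3" "exp x = 1 + x + x\<^sup>2 / 2 + x ^ 3 / 6 + r / 24 * x ^ 4"
    "exp (- x) = 1 + - x + (- x)\<^sup>2 / 2 + (- x) ^ 3 / 6 + s / 24 * (- x) ^ 4"
    using *[of x] *[of "- x"] assms by auto
  then have "cosh x - 1 - x\<^sup>2 / 2 = (r + s) / 48 * x ^ 4" "\<bar>(r + s) / 48\<bar> \<le> 1"
    by (simp_all add: cosh_field_def field_simps)
  moreover from this(2) have "\<bar>(r + s) / 48\<bar> * x ^ 4 \<le> 1 * x ^ 4"
    by (rule mult_right_mono) simp
  ultimately show ?thesis
    by (metis abs_mult mult_1 abs_power_minus power_even_abs even_numeral power_abs)
qed

lemma cosh_minus_one_le_square: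
  fixes x :: real assumes "\<bar>x\<bar> \<le> 1/2" shows "cosh x - 1 \<le> x\<^sup>2"
proof -
  have "x ^ 4 \<le> x\<^sup>2 / 4"
    using assms mult_right_mono[of "x\<^sup>2" "(1/2)\<^sup>2" "x\<^sup>2"] power_mono[of "\<bar>x\<bar>" "1/2" 2]
    by (simp add: power2_eq_square power4_eq_xxxx field_simps)
  then show ?thesis
    using cosh_taylor_bound[of x] assms by linarith
qed

lemma abs_mult_le_half_squares:
  fixes u v :: real shows "\<bar>u\<bar> * \<bar>v\<bar> \<le> u\<^sup>2 / 2 + v\<^sup>2 / 2"
  using sum_squares_bound[of "\<bar>u\<bar>" "\<bar>v\<bar>"] by simp

text \<open>In the applications \<open>E\<close> is a difference of \<open>\<tau> \<phi>\<close>
  along an edge or a plaquette diagonal, \<open>D\<close> is \<open>\<tau> h\<close>, and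
  \<open>q\<close> is the matching combination of at most two derivatives, whence
  \<open>2 * K\<close>. Because \<open>h \<le> D\<close>, the error \<open>K * D * h\<close> in
  \<open>E\<close> is of second order in \<open>D\<close>, and multiplied by \<open>E\<close> itself
  it is of third order.\<close>

lemma cosh_expansion:
  fixes E q D h K :: real
  assumes K: "1 \<le> K" and D: "0 < D" "10 * K * D \<le> 1" and h: "0 < h" "h \<le> D"
    and q: "\<bar>q\<bar> \<le> 2 * K" and E: "\<bar>E - D * q\<bar> \<le> K * D * h"
  shows "\<bar>E\<bar> \<le> 3 * K * D" and "cosh E - 1 \<le> 9 * K\<^sup>2 * D\<^sup>2" and "0 \<le> cosh E - 1"
    and "\<bar>cosh E - 1 - D\<^sup>2 * q\<^sup>2 / 2\<bar> \<le> 11 * K ^ 3 * D ^ 3"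
proof -
  have KD: "K * D \<le> 1/10" "0 < K * D" "D \<le> 1/10"
    using K D mult_right_mono[of 1 K D] by (simp, simp, linarith)
  have "\<bar>D * q\<bar> \<le> D * (2 * K)"
    unfolding abs_mult using q D by (intro mult_mono) auto
  moreover have "K * D * h \<le> K * D * 1"
    using KD h by (intro mult_left_mono) auto
  ultimately have E1: "\<bar>E\<bar> \<le> 3 * K * D"
    using E by (simp add: algebra_simps)
  then show "\<bar>E\<bar> \<le> 3 * K * D" .
  have E2: "\<bar>E\<bar> \<le> 1/2" using E1 KD by simp
  have Esq: "E\<^sup>2 \<le> 9 * K\<^sup>2 * D\<^sup>2"
    using power_mono[OF E1, of 2] by (simp add: power_mult_distrib)
  then show "cosh E - 1 \<le> 9 * K\<^sup>2 * D\<^sup>2"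
    using cosh_minus_one_le_square[OF E2] by linarith
  show "0 \<le> cosh E - 1" using cosh_real_ge_1[of E] by simp
  have "E ^ 4 \<le> (3 * K * D) ^ 4"
    using power_mono[OF E1, of 4] by simp
  also have "\<dots> = 81 * (K * D) * (K ^ 3 * D ^ 3)"
    by (simp add: power_mult_distrib eval_nat_numeral)
  also have "\<dots> \<le> 81 * (1/10) * (K ^ 3 * D ^ 3)"
    using KD K D by (intro mult_right_mono mult_left_mono) auto
  finally have E4: "E ^ 4 \<le> 81/10 * (K ^ 3 * D ^ 3)" by simp
  have "\<bar>E + D * q\<bar> \<le> 5 * K * D"
    using E1 \<open>\<bar>D * q\<bar> \<le> D * (2 * K)\<close> by (simp add: algebra_simps)
  then have "\<bar>E - D * q\<bar> * \<bar>E + D * q\<bar> \<le> (K * D * h) * (5 * K * D)"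
    using E KD h by (intro mult_mono) auto
  also have "\<dots> \<le> (K * D * D) * (5 * K * D)"
    using h K D by (intro mult_mono) auto
  also have "\<dots> = 5 * (K\<^sup>2 * D ^ 3)"
    by (simp add: eval_nat_numeral)
  also have "\<dots> \<le> 5 * (K ^ 3 * D ^ 3)"
    using K D by (intro mult_left_mono mult_right_mono power_increasing) auto
  finally have "\<bar>E\<^sup>2 - D\<^sup>2 * q\<^sup>2\<bar> \<le> 5 * (K ^ 3 * D ^ 3)"
    by (simp add: abs_mult[symmetric] power2_eq_square algebra_simps)
  moreover have "\<bar>cosh E - 1 - E\<^sup>2 / 2\<bar> \<le> E ^ 4"
    using cosh_taylor_bound[of E] E2 by simp
  ultimately have "\<bar>cosh E - 1 - D\<^sup>2 * q\<^sup>2 / 2\<bar> \<le> 81/10 * (K ^ 3 * D ^ 3) + 5/2 * (K ^ 3 * D ^ 3)"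
    using E4 by linarith
  moreover have "0 \<le> K ^ 3 * D ^ 3" using K D by simp
  ultimately show "\<bar>cosh E - 1 - D\<^sup>2 * q\<^sup>2 / 2\<bar> \<le> 11 * K ^ 3 * D ^ 3"
    by linarith
qed

text \<open>Here \<open>m\<close> is a mixed second difference of \<open>\<tau> \<phi>\<close>. It
  is smaller than the first differences by a factor \<open>h\<close>, so replacing
  \<open>sinh m\<close> by the Hessian term costs only a relative error of order
  \<open>h\<close>.\<close>

lemma sinh_expansion:
  fixes m K \<tau> h H :: real
  assumes K: "1 \<le> K" and \<tau>: "1 \<le> \<tau>" and h: "0 < h" and D: "10 * K * (\<tau> * h) \<le> 1"
    and H: "\<bar>H\<bar> \<le> K" and m: "\<bar>m - \<tau> * h\<^sup>2 * H\<bar> \<le> K * \<tau> * h ^ 3"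
  shows "\<bar>sinh m - \<tau> * h\<^sup>2 * H\<bar> \<le> 2 * K * (\<tau> * h\<^sup>2) * h"
    and "\<bar>sinh m\<bar> \<le> 3 * K * (\<tau> * h\<^sup>2)"
proof -
  define Q where "Q = \<tau> * h\<^sup>2"
  have "0 \<le> \<tau> * h" using \<tau> h by simp
  then have D1: "\<tau> * h \<le> 1/10" using K D mult_right_mono[of 1 K "\<tau> * h"] by linarith
  have h1: "h \<le> \<tau> * h" using \<tau> h by simp
  have Q: "0 < Q" "Q = \<tau> * h * h" using \<tau> h by (auto simp: Q_def power2_eq_square)
  have KQ: "0 \<le> K * Q" using K Q by simp
  have m': "\<bar>m - Q * H\<bar> \<le> K * Q * h"
    using m by (simp add: Q_def eval_nat_numeral algebra_simps)
  have QH: "\<bar>Q * H\<bar> \<le> K * Q"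
    using H Q(1) by (simp add: abs_mult)
  have Kh: "K * Q * h \<le> K * Q * (1/10)"
    using h1 D1 by (intro mult_left_mono KQ) auto
  have m2: "\<bar>m\<bar> \<le> 11/10 * (K * Q)"
    using m' QH Kh by linarith
  \<comment> \<open>The smallness of \<open>\<tau> h\<close> makes \<open>m\<close> itself of order
    \<open>h\<close>; this supplies the extra factor \<open>h\<close> in the bound of the cubic
    remainder.\<close>
  have KQh: "K * Q \<le> h / 10"
    using mult_right_mono[OF D, of h] h by (simp add: Q(2) algebra_simps)
  have m3: "\<bar>m\<bar> \<le> 1" using m2 KQh h1 D1 by linarith
  have "\<bar>m\<bar> ^ 3 = \<bar>m\<bar> * \<bar>m\<bar> * \<bar>m\<bar>" by (simp add: eval_nat_numeral)
  also have "\<dots> \<le> (11/10 * (K * Q)) * (11/10 * (h/10)) * 1"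
    using m2 m3 KQ KQh h mult_nonneg_nonneg[OF KQ less_imp_le[OF h]]
    by (intro mult_mono) (auto simp: mult.assoc)
  also have "\<dots> = 121/1000 * (K * Q * h)"
    by simp
  also have "\<dots> \<le> K * Q * h"
    using mult_nonneg_nonneg[OF KQ less_imp_le[OF h]] by linarith
  finally have "\<bar>sinh m - m\<bar> \<le> K * Q * h"
    using sinh_taylor_bound[OF m3] by linarith
  then have s: "\<bar>sinh m - Q * H\<bar> \<le> 2 * K * Q * h" using m' by linarith
  then show "\<bar>sinh m - \<tau> * h\<^sup>2 * H\<bar> \<le> 2 * K * (\<tau> * h\<^sup>2) * h" by (simp add: Q_def)
  show "\<bar>sinh m\<bar> \<le> 3 * K * (\<tau> * h\<^sup>2)"
    using s QH Kh KQ unfolding Q_def[symmetric] by linarith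
qed

text \<open>The plaquette has corner values \<open>y\<close>, \<open>y + a\<close>, \<open>y + b\<close>, \<open>y + a + c\<close> of \<open>f\<close>; \<open>H\<close> and \<open>p, q\<close> stand for a second
  derivative and two first derivatives of the weight at the base corner, and \<open>H10\<close>, \<open>H01\<close>, \<open>H11\<close> for the values of \<open>H\<close>
  at the other corners.\<close>

lemma plaquette_estimate:
  fixes K \<tau> h m H H10 H01 H11 E1 E2 p q y a b c :: real
  defines "D \<equiv> \<tau> * h" and "Q \<equiv> \<tau> * h\<^sup>2"
  defines "X \<equiv> (y + a) * (y + b)" and "Y \<equiv> y * (y + a + c)"
  assumes K: "1 \<le> K" and \<tau>: "1 \<le> \<tau>" and h: "0 < h" and D: "10 * K * D \<le> 1"
    and H: "\<bar>H\<bar> \<le> K" and m: "\<bar>m - \<tau> * h\<^sup>2 * H\<bar> \<le> K * \<tau> * h ^ 3"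
    and p: "\<bar>p\<bar> \<le> K" and q: "\<bar>q\<bar> \<le> K"
    and E1: "\<bar>E1 - D * (p + q)\<bar> \<le> K * D * h" and E2: "\<bar>E2 - D * (p - q)\<bar> \<le> K * D * h"
    and H11: "\<bar>H11 - H\<bar> \<le> K * h" and H2: "\<bar>H10 + H01 - H11 - H\<bar> \<le> K * h\<^sup>2"
  shows "\<bar>4 * sinh m * (cosh E1 * X - cosh E2 * Y) - 2 * Q * ((H + H11) * X - (H10 + H01) * Y)
      - 8 * Q * D\<^sup>2 * H * p * q * y\<^sup>2\<bar> \<le> 500 * K ^ 4 * (D + 1 / \<tau>) * Q * (D\<^sup>2 * y\<^sup>2 + a\<^sup>2 + b\<^sup>2 + c\<^sup>2)"
proof -
  define S where "S = D\<^sup>2 * y\<^sup>2 + a\<^sup>2 + b\<^sup>2 + c\<^sup>2"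
  have D0: "0 < D" and Q0: "0 < Q" using \<tau> h by (auto simp: D_def Q_def)
  have S0: "0 \<le> S" by (simp add: S_def)
  \<comment> \<open>A spare factor \<open>h\<close> is worth \<open>D / \<tau>\<close>: in front of
    \<open>y * b\<close> the \<open>D\<close> goes with \<open>y\<close>, since only
    \<open>D * y\<close> is controlled by \<open>S\<close>, and \<open>1 / \<tau>\<close> remains as
    the small factor.\<close>
  have hD: "h = D / \<tau>" "h \<le> D" using \<tau> h by (auto simp: D_def field_simps)
  have D1: "D \<le> 1/10" using K D D0 mult_right_mono[of 1 K D] by linarith
  have it: "0 < 1 / \<tau>" "1 / \<tau> \<le> 1" using \<tau> by auto
  have h\<tau>: "h \<le> 1 / \<tau>" using hD D1 \<tau> by (simp add: field_simps)
  have Dy: "D * \<bar>y\<bar> * \<bar>z\<bar> \<le> D\<^sup>2 * y\<^sup>2 / 2 + z\<^sup>2 / 2" for z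
    using abs_mult_le_half_squares[of "D * y" z] D0 by (simp add: abs_mult power_mult_distrib)
  have XY: "X - Y = y * b + a * b - y * c" by (simp add: X_def Y_def algebra_simps)
  have Xy: "X - y\<^sup>2 = y * a + y * b + a * b" by (simp add: X_def power2_eq_square algebra_simps)
  have Yy: "Y - y\<^sup>2 = y * a + y * c" by (simp add: Y_def power2_eq_square algebra_simps)
  have bXY: "h * \<bar>X - Y\<bar> \<le> 1 / \<tau> * S"
  proof -
    have "\<bar>X - Y\<bar> \<le> \<bar>y\<bar> * \<bar>b\<bar> + \<bar>a\<bar> * \<bar>b\<bar> + \<bar>y\<bar> * \<bar>c\<bar>"
      unfolding XY abs_mult[symmetric] by linarith
    then have "h * \<bar>X - Y\<bar> \<le> h * (\<bar>y\<bar> * \<bar>b\<bar> + \<bar>a\<bar> * \<bar>b\<bar> + \<bar>y\<bar> * \<bar>c\<bar>)"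
      using h by simp
    also have "\<dots> = 1 / \<tau> * (D * \<bar>y\<bar> * \<bar>b\<bar> + D * \<bar>y\<bar> * \<bar>c\<bar>) + h * (\<bar>a\<bar> * \<bar>b\<bar>)"
      unfolding hD(1) by (simp add: algebra_simps add_divide_distrib)
    also have "\<dots> \<le> 1 / \<tau> * (D * \<bar>y\<bar> * \<bar>b\<bar> + D * \<bar>y\<bar> * \<bar>c\<bar>) + 1 / \<tau> * (\<bar>a\<bar> * \<bar>b\<bar>)"
      by (intro add_left_mono mult_right_mono h\<tau>) auto
    also have "\<dots> = 1 / \<tau> * (D * \<bar>y\<bar> * \<bar>b\<bar> + D * \<bar>y\<bar> * \<bar>c\<bar> + \<bar>a\<bar> * \<bar>b\<bar>)"
      by (simp add: algebra_simps add_divide_distrib)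
    also have "\<dots> \<le> 1 / \<tau> * S"
    proof (rule mult_left_mono)
      show "D * \<bar>y\<bar> * \<bar>b\<bar> + D * \<bar>y\<bar> * \<bar>c\<bar> + \<bar>a\<bar> * \<bar>b\<bar> \<le> S"
        using Dy[of b] Dy[of c] abs_mult_le_half_squares[of a b] zero_le_power2[of c] zero_le_power2[of a]
        unfolding S_def by linarith
    qed (use it in simp)
    finally show ?thesis .
  qed
  \<comment> \<open>\<open>Y\<close> contains \<open>y\<close> squared without any difference, so a
    single \<open>h\<close> would leave \<open>D / \<tau>\<close> against the available square of
    \<open>D\<close>. Two factors are required, which is why \<open>H\<close> has to be controlled
    through the combination in \<open>H2\<close>.\<close>
  have bY: "h\<^sup>2 * \<bar>Y\<bar> \<le> 1 / \<tau> * (2 * S)"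
  proof -
    have "\<bar>Y\<bar> \<le> y\<^sup>2 + \<bar>y\<bar> * \<bar>a\<bar> + \<bar>y\<bar> * \<bar>c\<bar>"
      using Yy unfolding abs_mult[symmetric] by (smt (verit) zero_le_power2)
    then have "h\<^sup>2 * \<bar>Y\<bar> \<le> h\<^sup>2 * (y\<^sup>2 + \<bar>y\<bar> * \<bar>a\<bar> + \<bar>y\<bar> * \<bar>c\<bar>)"
      using h by simp
    also have "\<dots> = h * D * y\<^sup>2 / \<tau> + h * (D * \<bar>y\<bar> * \<bar>a\<bar> + D * \<bar>y\<bar> * \<bar>c\<bar>) / \<tau>"
      using hD(1) \<tau> by (simp add: D_def field_simps power2_eq_square)
    also have "\<dots> \<le> D * D * y\<^sup>2 / \<tau> + 1 * (D * \<bar>y\<bar> * \<bar>a\<bar> + D * \<bar>y\<bar> * \<bar>c\<bar>) / \<tau>"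
      using hD D1 D0 \<tau> by (intro add_mono divide_right_mono mult_right_mono) auto
    also have "\<dots> = 1 / \<tau> * (D\<^sup>2 * y\<^sup>2 + D * \<bar>y\<bar> * \<bar>a\<bar> + D * \<bar>y\<bar> * \<bar>c\<bar>)"
      by (simp add: power2_eq_square add_divide_distrib)
    also have "\<dots> \<le> 1 / \<tau> * (2 * S)"
    proof (rule mult_left_mono)
      show "D\<^sup>2 * y\<^sup>2 + D * \<bar>y\<bar> * \<bar>a\<bar> + D * \<bar>y\<bar> * \<bar>c\<bar> \<le> 2 * S"
        using Dy[of a] Dy[of c] zero_le_power2[of a] zero_le_power2[of b] zero_le_power2[of c]
        unfolding S_def by argo
    qed (use it in simp)
    finally show ?thesis .
  qed
  note s = sinh_expansion[OF K \<tau> h D[unfolded D_def] H m, folded Q_def]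
  have pq: "\<bar>p + q\<bar> \<le> 2 * K" "\<bar>p - q\<bar> \<le> 2 * K" using p q by auto
  note c1 = cosh_expansion[OF K D0 D h hD(2) pq(1) E1]
  note c2 = cosh_expansion[OF K D0 D h hD(2) pq(2) E2]
  \<comment> \<open>\<open>T1\<close> linearises \<open>sinh\<close>; \<open>T2\<close> trades the
    base value of \<open>H\<close> for the corner values; \<open>T3\<close> freezes the corner
    products at the square of \<open>y\<close> inside the \<open>cosh\<close> corrections;
    \<open>T4\<close> expands the two \<open>cosh\<close> at that frozen value.\<close>
  define T1 where "T1 = 4 * (sinh m - Q * H) * (X - Y)"
  define T2 where "T2 = 2 * Q * ((H - H11) * (X - Y) + (H10 + H01 - H11 - H) * Y)"
  define T3 where "T3 = 4 * sinh m * ((cosh E1 - 1) * (X - y\<^sup>2) - (cosh E2 - 1) * (Y - y\<^sup>2))"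
  define T4 where "T4 = 4 * y\<^sup>2 * (sinh m * (cosh E1 - cosh E2 - 2 * D\<^sup>2 * p * q) + (sinh m - Q * H) * (2 * D\<^sup>2 * p * q))"
  have split: "4 * sinh m * (cosh E1 * X - cosh E2 * Y) - 2 * Q * ((H + H11) * X - (H10 + H01) * Y)
      - 8 * Q * D\<^sup>2 * H * p * q * y\<^sup>2 = T1 + T2 + T3 + T4"
    unfolding T1_def T2_def T3_def T4_def by (simp add: algebra_simps)
  have "\<bar>T1\<bar> \<le> 4 * (2 * K * Q * h) * \<bar>X - Y\<bar>"
    unfolding T1_def abs_mult using s(1) by (intro mult_mono) auto
  also have "\<dots> = 8 * K * Q * (h * \<bar>X - Y\<bar>)" by simp
  also have "\<dots> \<le> 8 * K * Q * (1 / \<tau> * S)"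
    using K Q0 by (intro mult_left_mono bXY) auto
  finally have T1: "\<bar>T1\<bar> \<le> 8 * (K * (Q * (1 / \<tau> * S)))" by simp
  have "\<bar>(H - H11) * (X - Y) + (H10 + H01 - H11 - H) * Y\<bar> \<le> \<bar>H - H11\<bar> * \<bar>X - Y\<bar> + \<bar>H10 + H01 - H11 - H\<bar> * \<bar>Y\<bar>"
    unfolding abs_mult[symmetric] by (rule abs_triangle_ineq)
  also have "\<dots> \<le> (K * h) * \<bar>X - Y\<bar> + (K * h\<^sup>2) * \<bar>Y\<bar>"
    using H11 H2 by (intro add_mono mult_right_mono) auto
  also have "\<dots> = K * (h * \<bar>X - Y\<bar> + h\<^sup>2 * \<bar>Y\<bar>)" by (simp add: algebra_simps)
  also have "\<dots> \<le> K * (1 / \<tau> * S + 1 / \<tau> * (2 * S))"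
    using K by (intro mult_left_mono add_mono bXY bY) auto
  finally have "\<bar>T2\<bar> \<le> 2 * Q * (K * (1 / \<tau> * S + 1 / \<tau> * (2 * S)))"
    unfolding T2_def abs_mult[of "2 * Q"] using Q0 by (simp only: abs_of_pos mult_le_cancel_left_pos zero_less_mult_iff zero_less_numeral simp_thms)
  then have T2: "\<bar>T2\<bar> \<le> 6 * (K * (Q * (1 / \<tau> * S)))" by (simp add: algebra_simps)
  have "\<bar>(cosh E1 - 1) * (X - y\<^sup>2) - (cosh E2 - 1) * (Y - y\<^sup>2)\<bar>
      \<le> (cosh E1 - 1) * \<bar>X - y\<^sup>2\<bar> + (cosh E2 - 1) * \<bar>Y - y\<^sup>2\<bar>"
  proof -
    have "\<bar>(cosh E1 - 1) * (X - y\<^sup>2)\<bar> = (cosh E1 - 1) * \<bar>X - y\<^sup>2\<bar>" "\<bar>(cosh E2 - 1) * (Y - y\<^sup>2)\<bar> = (cosh E2 - 1) * \<bar>Y - y\<^sup>2\<bar>"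
      using c1(3) c2(3) by (simp_all add: abs_mult)
    then show ?thesis by linarith
  qed
  also have "\<dots> \<le> 9 * K\<^sup>2 * D\<^sup>2 * \<bar>X - y\<^sup>2\<bar> + 9 * K\<^sup>2 * D\<^sup>2 * \<bar>Y - y\<^sup>2\<bar>"
    by (intro add_mono mult_right_mono c1 c2) auto
  also have "\<dots> = 9 * K\<^sup>2 * D * (D * (\<bar>X - y\<^sup>2\<bar> + \<bar>Y - y\<^sup>2\<bar>))"
    by (simp add: power2_eq_square algebra_simps)
  also have "\<dots> \<le> 9 * K\<^sup>2 * D * (2 * S)"
  proof (rule mult_left_mono)
    have "\<bar>X - y\<^sup>2\<bar> + \<bar>Y - y\<^sup>2\<bar> \<le> 2 * (\<bar>y\<bar> * \<bar>a\<bar>) + \<bar>y\<bar> * \<bar>b\<bar> + \<bar>y\<bar> * \<bar>c\<bar> + \<bar>a\<bar> * \<bar>b\<bar>"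
      unfolding Xy Yy abs_mult[symmetric] by linarith
    then have "D * (\<bar>X - y\<^sup>2\<bar> + \<bar>Y - y\<^sup>2\<bar>) \<le> D * (2 * (\<bar>y\<bar> * \<bar>a\<bar>) + \<bar>y\<bar> * \<bar>b\<bar> + \<bar>y\<bar> * \<bar>c\<bar> + \<bar>a\<bar> * \<bar>b\<bar>)"
      using D0 by simp
    also have "\<dots> = 2 * (D * \<bar>y\<bar> * \<bar>a\<bar>) + D * \<bar>y\<bar> * \<bar>b\<bar> + D * \<bar>y\<bar> * \<bar>c\<bar> + D * (\<bar>a\<bar> * \<bar>b\<bar>)"
      by (simp add: algebra_simps)
    also have "\<dots> \<le> 2 * (D * \<bar>y\<bar> * \<bar>a\<bar>) + D * \<bar>y\<bar> * \<bar>b\<bar> + D * \<bar>y\<bar> * \<bar>c\<bar> + 1 * (\<bar>a\<bar> * \<bar>b\<bar>)"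
      using D1 by (intro add_left_mono mult_right_mono) auto
    also have "\<dots> \<le> 2 * S"
      using Dy[of a] Dy[of b] Dy[of c] abs_mult_le_half_squares[of a b] zero_le_power2[of a]
        zero_le_power2[of b] zero_le_power2[of c]
      unfolding S_def by argo
    finally show "D * (\<bar>X - y\<^sup>2\<bar> + \<bar>Y - y\<^sup>2\<bar>) \<le> 2 * S" .
  qed (use D0 in simp)
  finally have "\<bar>T3\<bar> \<le> 4 * (3 * K * Q) * (9 * K\<^sup>2 * D * (2 * S))"
    unfolding T3_def abs_mult using s(2) K Q0 by (intro mult_mono) auto
  also have "\<dots> = 216 * (K ^ 3 * (Q * (D * S)))" by (simp add: eval_nat_numeral)
  finally have T3: "\<bar>T3\<bar> \<le> 216 * (K ^ 3 * (Q * (D * S)))" .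
  have pq2: "\<bar>2 * D\<^sup>2 * p * q\<bar> \<le> 2 * D\<^sup>2 * K * K"
    unfolding abs_mult using p q K by (intro mult_mono) auto
  \<comment> \<open>Polarisation: the two diagonals see \<open>p + q\<close> and
    \<open>p - q\<close>, and half the difference of the squares is \<open>2 * p * q\<close>. This
    is the origin of the Hessian form evaluated at the gradient of the weight.\<close>
  have "cosh E1 - cosh E2 - 2 * D\<^sup>2 * p * q = (cosh E1 - 1 - D\<^sup>2 * (p + q)\<^sup>2 / 2) - (cosh E2 - 1 - D\<^sup>2 * (p - q)\<^sup>2 / 2)"
    by (simp add: power2_eq_square field_simps)
  then have cc: "\<bar>cosh E1 - cosh E2 - 2 * D\<^sup>2 * p * q\<bar> \<le> 22 * K ^ 3 * D ^ 3"
    using c1(4) c2(4) by linarith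
  have "\<bar>sinh m * (cosh E1 - cosh E2 - 2 * D\<^sup>2 * p * q) + (sinh m - Q * H) * (2 * D\<^sup>2 * p * q)\<bar>
     \<le> \<bar>sinh m\<bar> * \<bar>cosh E1 - cosh E2 - 2 * D\<^sup>2 * p * q\<bar> + \<bar>sinh m - Q * H\<bar> * \<bar>2 * D\<^sup>2 * p * q\<bar>"
    unfolding abs_mult[symmetric] by (rule abs_triangle_ineq)
  also have "\<dots> \<le> (3 * K * Q) * (22 * K ^ 3 * D ^ 3) + (2 * K * Q * h) * (2 * D\<^sup>2 * K * K)"
    using s cc pq2 K Q0 h by (intro add_mono mult_mono) auto
  also have "\<dots> \<le> (3 * K * Q) * (22 * K ^ 3 * D ^ 3) + (2 * K * Q * D) * (2 * D\<^sup>2 * K * K)"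
    using hD(2) K Q0 D0 by (intro add_left_mono mult_right_mono mult_left_mono) auto
  also have "\<dots> = 66 * (K ^ 4 * Q * D ^ 3) + 4 * (K ^ 3 * Q * D ^ 3)"
    by (simp add: eval_nat_numeral)
  also have "\<dots> \<le> 66 * (K ^ 4 * Q * D ^ 3) + 4 * (K ^ 4 * Q * D ^ 3)"
    using K Q0 D0 by (intro add_left_mono mult_left_mono mult_right_mono power_increasing) auto
  finally have Z: "\<bar>sinh m * (cosh E1 - cosh E2 - 2 * D\<^sup>2 * p * q) + (sinh m - Q * H) * (2 * D\<^sup>2 * p * q)\<bar>
     \<le> 70 * (K ^ 4 * Q * D ^ 3)"
    by linarith
  have "\<bar>T4\<bar> \<le> 4 * y\<^sup>2 * (70 * (K ^ 4 * Q * D ^ 3))"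
    unfolding T4_def abs_mult[of "4 * y\<^sup>2"] using mult_left_mono[OF Z, of "4 * y\<^sup>2"] by simp
  also have "\<dots> = 280 * (K ^ 4 * (Q * (D * (D\<^sup>2 * y\<^sup>2))))" by (simp add: eval_nat_numeral)
  also have "\<dots> \<le> 280 * (K ^ 4 * (Q * (D * S)))"
    using K Q0 D0 unfolding S_def by (intro mult_left_mono) auto
  finally have T4: "\<bar>T4\<bar> \<le> 280 * (K ^ 4 * (Q * (D * S)))" .
  have "K * (Q * (1 / \<tau> * S)) \<le> K ^ 4 * (Q * (1 / \<tau> * S))"
    using K Q0 it S0 power_increasing[of 1 4 K] by (intro mult_right_mono) auto
  moreover have "K ^ 3 * (Q * (D * S)) \<le> K ^ 4 * (Q * (D * S))"
    using K Q0 D0 S0 by (intro mult_right_mono power_increasing) auto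
  moreover have "0 \<le> K ^ 4 * (Q * (D * S))" "0 \<le> K ^ 4 * (Q * (1 / \<tau> * S))"
    using K Q0 D0 S0 it by auto
  ultimately have "\<bar>T1 + T2 + T3 + T4\<bar> \<le> 500 * (K ^ 4 * (Q * (D * S))) + 500 * (K ^ 4 * (Q * (1 / \<tau> * S)))"
    using T1 T2 T3 T4 by linarith
  also have "\<dots> = 500 * K ^ 4 * (D + 1 / \<tau>) * Q * S"
    by (simp add: algebra_simps add_divide_distrib)
  finally show ?thesis unfolding split S_def .
qed

section \<open>The Carleman lower bound for an abstract weight\<close>

context padded_support begin

lemma sum_gradient_square_shift:
  "(\<Sum>n\<in>A. (f (n + e j + e k) - f (n + e j))\<^sup>2) = (\<Sum>n\<in>A. (f (n + e k) - f n)\<^sup>2)"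
proof -
  let ?F = "\<lambda>n. (f (n + e k) - f n)\<^sup>2"
  have "(\<Sum>n\<in>A. ?F (n + e j)) = (\<Sum>n\<in>A. ?F n)"
  proof (rule sum_shift)
    fix n assume "?F n \<noteq> 0"
    then consider "f (n + e k) \<noteq> 0" | "f n \<noteq> 0" by fastforce
    then have "n \<in> A \<and> n - e j \<in> A"
    proof cases
      case 1
      then show ?thesis
        using padding(3)[of "n + e k" k] padding(6)[of "n + e k" k j] by simp
    next
      case 2
      then show ?thesis
        using padding by simp
    qed
    then show "n \<in> A" "n - e j \<in> A" by auto
  qed (rule finite_A)
  then show ?thesis by simp
qed

text \<open>Expanding the left side gives four products, and translating them to a common plaquette
  puts \<open>H\<close> at its four corners. This is why the plaquette estimate carries corner
  values of \<open>H\<close>: after summation they recombine into a genuine quadratic form of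
  centred differences, with one Hessian per point, whose sign can be read off pointwise.\<close>

lemma sum_hessian_form:
  "(\<Sum>n\<in>A. H n * (f (n + e j) - f (n - e j)) * (f (n + e k) - f (n - e k)))
   = (\<Sum>n\<in>A. (H n + H (n + e j + e k)) * (f (n + e j) * f (n + e k))
        - (H (n + e j) + H (n + e k)) * (f n * f (n + e j + e k)))"
proof -
  let ?F1 = "\<lambda>n. H n * (f (n + e j) * f (n + e k))"
  let ?F2 = "\<lambda>n. H n * (f (n - e j) * f (n - e k))"
  let ?F3 = "\<lambda>n. H n * (f (n + e j) * f (n - e k))"
  let ?F4 = "\<lambda>n. H n * (f (n - e j) * f (n + e k))"
  have s2: "(\<Sum>n\<in>A. ?F2 n) = (\<Sum>n\<in>A. ?F2 (n + (e j + e k)))"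
  proof (rule sum_shift[symmetric])
    fix n assume "?F2 n \<noteq> 0"
    then have "f (n - e j) \<noteq> 0" by auto
    then show "n \<in> A" "n - (e j + e k) \<in> A"
      using padding(2)[of "n - e j" j] padding(3)[of "n - e j" k]
      by (simp_all add: diff_diff_eq)
  qed (rule finite_A)
  have s3: "(\<Sum>n\<in>A. ?F3 n) = (\<Sum>n\<in>A. ?F3 (n + e k))"
  proof (rule sum_shift[symmetric])
    fix n assume "?F3 n \<noteq> 0"
    then have "f (n - e k) \<noteq> 0" by auto
    then show "n \<in> A" "n - e k \<in> A"
      using padding(2)[of "n - e k" k] padding(1)[of "n - e k"] by simp_all
  qed (rule finite_A)
  have s4: "(\<Sum>n\<in>A. ?F4 n) = (\<Sum>n\<in>A. ?F4 (n + e j))"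
  proof (rule sum_shift[symmetric])
    fix n assume "?F4 n \<noteq> 0"
    then have "f (n - e j) \<noteq> 0" by auto
    then show "n \<in> A" "n - e j \<in> A"
      using padding(2)[of "n - e j" j] padding(1)[of "n - e j"] by simp_all
  qed (rule finite_A)
  have idx: "n + (e j + e k) - e j = n + e k" "n + (e j + e k) - e k = n + e j"
      "n + (e j + e k) = n + e j + e k" "n + e k + e j = n + e j + e k"
      "n + e j - e j = n" "n + e k - e k = n"
      "n + e j + e k - e j = n + e k" "n + e j + e k - e k = n + e j" for n
    by (simp_all add: algebra_simps)
  have "(\<Sum>n\<in>A. H n * (f (n + e j) - f (n - e j)) * (f (n + e k) - f (n - e k)))
     = (\<Sum>n\<in>A. ?F1 n) + (\<Sum>n\<in>A. ?F2 n) - (\<Sum>n\<in>A. ?F3 n) - (\<Sum>n\<in>A. ?F4 n)"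
    unfolding sum.distrib[symmetric] sum_subtractf[symmetric]
    by (intro sum.cong refl) (simp add: algebra_simps)
  also have "\<dots> = (\<Sum>n\<in>A. (H n + H (n + e j + e k)) * (f (n + e j) * f (n + e k))
        - (H (n + e j) + H (n + e k)) * (f n * f (n + e j + e k)))"
    unfolding s2 s3 s4 idx sum.distrib[symmetric] sum_subtractf[symmetric]
    by (intro sum.cong refl) (simp add: algebra_simps)
  finally show ?thesis .
qed

text \<open>A centred difference is a forward plus a backward difference, and both have the same sum
  of squares. The factor 4 has to be paid for by the shift wherever the Hessian is negative.\<close>

lemma sum_centered_difference_square_le:
  "(\<Sum>n\<in>A. (f (n + e j) - f (n - e j))\<^sup>2) \<le> 4 * (\<Sum>n\<in>A. (f (n + e j) - f n)\<^sup>2)"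
proof -
  let ?F = "\<lambda>n. (f n - f (n - e j))\<^sup>2"
  have "(\<Sum>n\<in>A. ?F (n + e j)) = (\<Sum>n\<in>A. ?F n)"
  proof (rule sum_shift)
    fix n assume "?F n \<noteq> 0"
    then consider "f (n - e j) \<noteq> 0" | "f n \<noteq> 0" by fastforce
    then have "n \<in> A \<and> n - e j \<in> A"
      by cases (use padding(1)[of "n - e j"] padding(2)[of "n - e j" j] padding in auto)
    then show "n \<in> A" "n - e j \<in> A" by auto
  qed (rule finite_A)
  moreover have "(f (n + e j) - f (n - e j))\<^sup>2 \<le> 2 * (f (n + e j) - f n)\<^sup>2 + 2 * ?F n" for n
    using zero_le_power2[of "f (n + e j) - 2 * f n + f (n - e j)"]
    by (simp add: power2_eq_square algebra_simps)
  then have "(\<Sum>n\<in>A. (f (n + e j) - f (n - e j))\<^sup>2) \<le> (\<Sum>n\<in>A. 2 * (f (n + e j) - f n)\<^sup>2 + 2 * ?F n)"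
    by (rule sum_mono)
  ultimately show ?thesis
    by (simp add: sum.distrib sum_distrib_left[symmetric])
qed

text \<open>The shift of the overview is \<open>g = - \<gamma> \<tau> h\<^sup>2\<close>. The weight
  enters only through \<open>p\<close> and \<open>H\<close>, its approximate gradient and Hessian,
  with one constant \<open>K\<close> for all consistency errors. Every error is
  \<open>\<tau> * h + 1 / \<tau>\<close> times the same two energies that the main terms contain, so
  it can be absorbed for small \<open>\<tau> * h\<close> and large \<tau> once those are
  positive.\<close>

lemma carleman_lower_bound:
  fixes \<phi> :: "'a \<Rightarrow> real" and p :: "'i \<Rightarrow> 'a \<Rightarrow> real" and H :: "'i \<Rightarrow> 'i \<Rightarrow> 'a \<Rightarrow> real"
    and K \<tau> h \<gamma> :: real
  defines "N \<equiv> \<Sum>n\<in>A. (f n)\<^sup>2" and "G \<equiv> \<Sum>n\<in>A. \<Sum>j\<in>UNIV. (f (n + e j) - f n)\<^sup>2"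
  assumes K: "1 \<le> K" and \<tau>: "1 \<le> \<tau>" and h: "0 < h" and D: "10 * K * (\<tau> * h) \<le> 1" and \<gamma>: "0 \<le> \<gamma>"
    and mixed: "\<And>n j k. n \<in> A \<Longrightarrow> \<bar>\<phi> n + \<phi> (n + e j + e k) - \<phi> (n + e j) - \<phi> (n + e k) - h\<^sup>2 * H j k n\<bar> \<le> K * h ^ 3"
    and diag1: "\<And>n j k. n \<in> A \<Longrightarrow> \<bar>\<phi> (n + e j + e k) - \<phi> n - h * (p j n + p k n)\<bar> \<le> K * h\<^sup>2"
    and diag2: "\<And>n j k. n \<in> A \<Longrightarrow> \<bar>\<phi> (n + e j) - \<phi> (n + e k) - h * (p j n - p k n)\<bar> \<le> K * h\<^sup>2"
    and edge1: "\<And>n j. n \<in> A \<Longrightarrow> \<bar>\<phi> (n + e j) - \<phi> n - h * p j n\<bar> \<le> K * h\<^sup>2"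
    and edge2: "\<And>n j. n \<in> A \<Longrightarrow> \<bar>\<phi> (n - e j) - \<phi> n + h * p j n\<bar> \<le> K * h\<^sup>2"
    and H: "\<And>n j k. n \<in> A \<Longrightarrow> \<bar>H j k n\<bar> \<le> K" and p: "\<And>n j. n \<in> A \<Longrightarrow> \<bar>p j n\<bar> \<le> K"
    and H1: "\<And>n j k. n \<in> A \<Longrightarrow> \<bar>H j k (n + e j + e k) - H j k n\<bar> \<le> K * h"
    and H2: "\<And>n j k. n \<in> A \<Longrightarrow> \<bar>H j k (n + e j) + H j k (n + e k) - H j k (n + e j + e k) - H j k n\<bar> \<le> K * h\<^sup>2"
  shows "(\<Sum>n\<in>A. (conj_laplacian e (\<lambda>x. \<tau> * \<phi> x) f n)\<^sup>2)
    \<ge> \<tau> * h\<^sup>2 * (2 * (\<Sum>n\<in>A. \<Sum>j\<in>UNIV. \<Sum>k\<in>UNIV. H j k n * (f (n + e j) - f (n - e j)) * (f (n + e k) - f (n - e k)))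
            + 4 * \<gamma> * G)
      + \<tau> ^ 3 * h ^ 4 * (\<Sum>n\<in>A. (8 * (\<Sum>j\<in>UNIV. \<Sum>k\<in>UNIV. H j k n * p j n * p k n) - 4 * \<gamma> * (\<Sum>j\<in>UNIV. (p j n)\<^sup>2)) * (f n)\<^sup>2)
      - (1500 * K ^ 4 * (real CARD('i))\<^sup>2 + 88 * \<gamma> * K ^ 3 * real CARD('i) + 4 * \<gamma>\<^sup>2) * (\<tau> * h + 1 / \<tau>)
          * (\<tau> ^ 3 * h ^ 4 * N + \<tau> * h\<^sup>2 * G)"
proof -
  define D where "D = \<tau> * h"
  define Q where "Q = \<tau> * h\<^sup>2"
  define d where "d = real CARD('i)"
  define L where "L = conj_laplacian e (\<lambda>x. \<tau> * \<phi> x) f"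
  define L' where "L' = conj_laplacian e (\<lambda>x. - (\<tau> * \<phi> x)) f"
  define \<epsilon> where "\<epsilon> = D + 1 / \<tau>"
  have D0: "0 < D" and Q0: "0 < Q" using \<tau> h by (auto simp: D_def Q_def)
  have QD: "Q * D\<^sup>2 = \<tau> ^ 3 * h ^ 4" by (simp add: Q_def D_def eval_nat_numeral)
  have d1: "1 \<le> d" by (simp add: d_def Suc_le_eq)
  have N0: "0 \<le> N" and G0: "0 \<le> G" by (auto simp: N_def G_def sum_nonneg)
  have \<epsilon>: "D \<le> \<epsilon>" "1 / \<tau> \<le> \<epsilon>" "0 < \<epsilon>" using D0 \<tau> by (auto simp: \<epsilon>_def add_pos_nonneg)
  have hD: "h \<le> D" using \<tau> h by (simp add: D_def)
  have KD: "10 * K * D \<le> 1" using D by (simp add: D_def)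
  have scale: "\<bar>\<tau> * a - D * b\<bar> \<le> K * D * h" if "\<bar>a - h * b\<bar> \<le> K * h\<^sup>2" for a b
  proof -
    have "\<bar>\<tau> * a - D * b\<bar> = \<tau> * \<bar>a - h * b\<bar>"
      using \<tau> by (simp add: D_def abs_mult[symmetric, of \<tau>] algebra_simps abs_mult_pos' flip: abs_mult)
    also have "\<dots> \<le> \<tau> * (K * h\<^sup>2)" using that \<tau> by (intro mult_left_mono) auto
    finally show ?thesis by (simp add: D_def power2_eq_square algebra_simps)
  qed
  \<comment> \<open>The square of \<open>L' n + 2 * \<gamma> * Q * f n\<close> is nonnegative; it is
    subtracted and expanded.\<close>
  have step1: "(\<Sum>n\<in>A. (L n)\<^sup>2) \<ge> (\<Sum>n\<in>A. (L n)\<^sup>2 - (L' n)\<^sup>2) - 4 * \<gamma> * Q * (\<Sum>n\<in>A. f n * L' n) - 4 * \<gamma>\<^sup>2 * Q\<^sup>2 * N"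
  proof -
    have "(L n)\<^sup>2 \<ge> (L n)\<^sup>2 - (L' n)\<^sup>2 - 4 * \<gamma> * Q * (f n * L' n) - 4 * \<gamma>\<^sup>2 * Q\<^sup>2 * (f n)\<^sup>2" for n
      using zero_le_power2[of "L' n + 2 * \<gamma> * Q * f n"] by (simp add: power2_eq_square algebra_simps)
    then have "(\<Sum>n\<in>A. (L n)\<^sup>2) \<ge> (\<Sum>n\<in>A. (L n)\<^sup>2 - (L' n)\<^sup>2 - 4 * \<gamma> * Q * (f n * L' n) - 4 * \<gamma>\<^sup>2 * Q\<^sup>2 * (f n)\<^sup>2)"
      by (rule sum_mono)
    then show ?thesis by (simp add: sum_subtractf sum_distrib_left N_def)
  qed
  let ?X = "\<lambda>j k n. f (n + e j) * f (n + e k)" and ?Y = "\<lambda>j k n. f n * f (n + e j + e k)"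
  define R where "R j k n = 4 * (sinh (\<tau> * \<phi> n + \<tau> * \<phi> (n + e j + e k) - \<tau> * \<phi> (n + e j) - \<tau> * \<phi> (n + e k)) *
        (cosh (\<tau> * \<phi> (n + e j + e k) - \<tau> * \<phi> n) * f (n + e j) * f (n + e k)
         - cosh (\<tau> * \<phi> (n + e j) - \<tau> * \<phi> (n + e k)) * f n * f (n + e j + e k)))" for j k n
  define S where "S j k n = D\<^sup>2 * (f n)\<^sup>2 + (f (n + e j) - f n)\<^sup>2 + (f (n + e k) - f n)\<^sup>2 + (f (n + e j + e k) - f (n + e j))\<^sup>2" for j k n
  define M where "M j k n = (H j k n + H j k (n + e j + e k)) * ?X j k n - (H j k (n + e j) + H j k (n + e k)) * ?Y j k n" for j k n
  have plaq: "R j k n \<ge> 2 * Q * M j k n + 8 * Q * D\<^sup>2 * (H j k n * p j n * p k n * (f n)\<^sup>2) - 500 * K ^ 4 * \<epsilon> * Q * S j k n"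
    if n: "n \<in> A" for j k n
  proof -
    have m: "\<bar>\<tau> * \<phi> n + \<tau> * \<phi> (n + e j + e k) - \<tau> * \<phi> (n + e j) - \<tau> * \<phi> (n + e k) - \<tau> * h\<^sup>2 * H j k n\<bar> \<le> K * \<tau> * h ^ 3"
    proof -
      have "\<tau> * \<phi> n + \<tau> * \<phi> (n + e j + e k) - \<tau> * \<phi> (n + e j) - \<tau> * \<phi> (n + e k) - \<tau> * h\<^sup>2 * H j k n
         = \<tau> * (\<phi> n + \<phi> (n + e j + e k) - \<phi> (n + e j) - \<phi> (n + e k) - h\<^sup>2 * H j k n)"
        by (simp add: algebra_simps)
      then show ?thesis
        using mult_left_mono[OF mixed[OF n], of \<tau> j k] \<tau> by (simp add: abs_mult mult.assoc mult.left_commute)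
    qed
    have E1: "\<bar>\<tau> * \<phi> (n + e j + e k) - \<tau> * \<phi> n - \<tau> * h * (p j n + p k n)\<bar> \<le> K * (\<tau> * h) * h"
      using scale[OF diag1[OF n, of j k]] by (simp add: D_def right_diff_distrib)
    have E2: "\<bar>\<tau> * \<phi> (n + e j) - \<tau> * \<phi> (n + e k) - \<tau> * h * (p j n - p k n)\<bar> \<le> K * (\<tau> * h) * h"
      using scale[OF diag2[OF n, of j k]] by (simp add: D_def right_diff_distrib)
    show ?thesis
      using plaquette_estimate[OF K \<tau> h D H[OF n] m p[OF n] p[OF n] E1 E2 H1[OF n] H2[OF n],
          of "f n" "f (n + e j) - f n" "f (n + e k) - f n" "f (n + e j + e k) - f (n + e j)"]
      unfolding D_def[symmetric] Q_def[symmetric] \<epsilon>_def[symmetric] R_def M_def S_def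
      by (simp add: abs_le_iff algebra_simps)
  qed
  define P where "P n = (\<Sum>j\<in>UNIV. \<Sum>k\<in>UNIV. H j k n * p j n * p k n)" for n
  define W where "W = (\<Sum>n\<in>A. \<Sum>j\<in>UNIV. \<Sum>k\<in>UNIV. H j k n * (f (n + e j) - f (n - e j)) * (f (n + e k) - f (n - e k)))"
  have comm: "(\<Sum>n\<in>A. (L n)\<^sup>2 - (L' n)\<^sup>2) = (\<Sum>n\<in>A. \<Sum>j\<in>UNIV. \<Sum>k\<in>UNIV. R j k n)"
    unfolding L_def L'_def commutator_identity R_def sum_distrib_left by simp
  have sumM: "(\<Sum>n\<in>A. \<Sum>j\<in>UNIV. \<Sum>k\<in>UNIV. M j k n) = W"
  proof -
    have "(\<Sum>n\<in>A. \<Sum>j\<in>UNIV. \<Sum>k\<in>UNIV. M j k n) = (\<Sum>j\<in>UNIV. \<Sum>k\<in>UNIV. \<Sum>n\<in>A. M j k n)"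
      by (subst sum.swap, subst (2) sum.swap) simp
    also have "\<dots> = (\<Sum>j\<in>UNIV. \<Sum>k\<in>UNIV. \<Sum>n\<in>A. H j k n * (f (n + e j) - f (n - e j)) * (f (n + e k) - f (n - e k)))"
      unfolding M_def sum_hessian_form ..
    also have "\<dots> = W"
      unfolding W_def by (subst (2) sum.swap, subst sum.swap) simp
    finally show ?thesis .
  qed
  define g where "g j = (\<Sum>n\<in>A. (f (n + e j) - f n)\<^sup>2)" for j
  have sumS: "(\<Sum>n\<in>A. \<Sum>j\<in>UNIV. \<Sum>k\<in>UNIV. S j k n) \<le> 3 * d\<^sup>2 * (D\<^sup>2 * N + G)"
  proof -
    have "(\<Sum>n\<in>A. \<Sum>j\<in>UNIV. \<Sum>k\<in>UNIV. S j k n) = (\<Sum>j\<in>UNIV. \<Sum>k\<in>UNIV. \<Sum>n\<in>A. S j k n)"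
      by (subst sum.swap, subst (2) sum.swap) simp
    also have "\<dots> = (\<Sum>j\<in>UNIV. \<Sum>k\<in>UNIV. D\<^sup>2 * N + g j + 2 * g k)"
      unfolding S_def sum.distrib sum_gradient_square_shift N_def g_def by (simp add: sum_distrib_left[symmetric])
    also have "\<dots> = d\<^sup>2 * (D\<^sup>2 * N) + 3 * d * (\<Sum>j\<in>UNIV. g j)"
    proof -
      have "(\<Sum>j\<in>(UNIV::'i set). \<Sum>k\<in>(UNIV::'i set). D\<^sup>2 * N) = d\<^sup>2 * (D\<^sup>2 * N)"
        "(\<Sum>j\<in>UNIV. \<Sum>k\<in>(UNIV::'i set). g j) = d * (\<Sum>j\<in>UNIV. g j)"
        "(\<Sum>j\<in>(UNIV::'i set). \<Sum>k\<in>UNIV. 2 * g k) = d * (2 * (\<Sum>j\<in>UNIV. g j))"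
        by (simp_all add: d_def sum_distrib_left power2_eq_square)
      then show ?thesis
        by (simp only: sum.distrib)
    qed
    also have "(\<Sum>j\<in>UNIV. g j) = G"
      unfolding G_def g_def by (rule sum.swap)
    also have "d\<^sup>2 * (D\<^sup>2 * N) + 3 * d * G \<le> 3 * d\<^sup>2 * (D\<^sup>2 * N) + 3 * d\<^sup>2 * G"
      using d1 N0 G0 by (intro add_mono mult_right_mono) (auto simp: power2_eq_square)
    finally show ?thesis by (simp add: algebra_simps)
  qed
  have step2: "(\<Sum>n\<in>A. (L n)\<^sup>2 - (L' n)\<^sup>2) \<ge> 2 * Q * W + 8 * Q * D\<^sup>2 * (\<Sum>n\<in>A. P n * (f n)\<^sup>2)
      - 1500 * K ^ 4 * d\<^sup>2 * \<epsilon> * Q * (D\<^sup>2 * N + G)"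
  proof -
    have "(\<Sum>n\<in>A. \<Sum>j\<in>UNIV. \<Sum>k\<in>UNIV. R j k n) \<ge> (\<Sum>n\<in>A. \<Sum>j\<in>UNIV. \<Sum>k\<in>UNIV.
      2 * Q * M j k n + 8 * Q * D\<^sup>2 * (H j k n * p j n * p k n * (f n)\<^sup>2) - 500 * K ^ 4 * \<epsilon> * Q * S j k n)"
      by (intro sum_mono plaq)
    also have "(\<Sum>n\<in>A. \<Sum>j\<in>UNIV. \<Sum>k\<in>UNIV.
      2 * Q * M j k n + 8 * Q * D\<^sup>2 * (H j k n * p j n * p k n * (f n)\<^sup>2) - 500 * K ^ 4 * \<epsilon> * Q * S j k n)
      = 2 * Q * W + 8 * Q * D\<^sup>2 * (\<Sum>n\<in>A. P n * (f n)\<^sup>2) - 500 * K ^ 4 * \<epsilon> * Q * (\<Sum>n\<in>A. \<Sum>j\<in>UNIV. \<Sum>k\<in>UNIV. S j k n)"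
      unfolding sum.distrib sum_subtractf sum_distrib_left[symmetric] sumM P_def sum_distrib_right ..
    finally have "(\<Sum>n\<in>A. (L n)\<^sup>2 - (L' n)\<^sup>2) \<ge> 2 * Q * W + 8 * Q * D\<^sup>2 * (\<Sum>n\<in>A. P n * (f n)\<^sup>2)
       - 500 * K ^ 4 * \<epsilon> * Q * (\<Sum>n\<in>A. \<Sum>j\<in>UNIV. \<Sum>k\<in>UNIV. S j k n)"
      unfolding comm .
    moreover have "500 * K ^ 4 * \<epsilon> * Q * (\<Sum>n\<in>A. \<Sum>j\<in>UNIV. \<Sum>k\<in>UNIV. S j k n) \<le> 500 * K ^ 4 * \<epsilon> * Q * (3 * d\<^sup>2 * (D\<^sup>2 * N + G))"
      using K \<epsilon> Q0 by (intro mult_left_mono sumS) auto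
    ultimately show ?thesis by (simp add: algebra_simps)
  qed
  \<comment> \<open>The gain in gradient and its price in the zero-order term. The constant 22 is
    twice the remainder 11 of \<open>cosh_expansion\<close>, for the forward and the backward
    edge.\<close>
  have step3: "- (\<Sum>n\<in>A. f n * L' n) \<ge> G - D\<^sup>2 * (\<Sum>n\<in>A. (\<Sum>j\<in>UNIV. (p j n)\<^sup>2) * (f n)\<^sup>2) - 22 * K ^ 3 * D ^ 3 * d * N"
  proof -
    have "(\<Sum>n\<in>A. f n * L' n) \<le> (\<Sum>n\<in>A. \<Sum>j\<in>UNIV. (D\<^sup>2 * (p j n)\<^sup>2 + 22 * K ^ 3 * D ^ 3) * (f n)\<^sup>2 - 1 * (f (n + e j) - f n)\<^sup>2)"
      unfolding L'_def sum_difference_form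
    proof (intro sum_mono diff_mono mult_right_mono)
      fix n j assume n: "n \<in> A"
      have pj: "\<bar>p j n\<bar> \<le> 2 * K" "\<bar>- p j n\<bar> \<le> 2 * K" using p[OF n, of j] K by auto
      have "\<bar>(\<tau> * \<phi> (n + e j) - \<tau> * \<phi> n) - D * p j n\<bar> \<le> K * D * h"
        using scale[OF edge1[OF n, of j]] by (simp add: right_diff_distrib)
      note a = cosh_expansion(4)[OF K D0 KD h hD pj(1) this]
      have "\<bar>(\<tau> * \<phi> (n - e j) - \<tau> * \<phi> n) - D * - p j n\<bar> \<le> K * D * h"
        using scale[of "\<phi> (n - e j) - \<phi> n" "- p j n"] edge2[OF n, of j] by (simp add: right_diff_distrib)
      note b = cosh_expansion(4)[OF K D0 KD h hD pj(2) this]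
      show "cosh (\<tau> * \<phi> (n + e j) - \<tau> * \<phi> n) + cosh (\<tau> * \<phi> (n - e j) - \<tau> * \<phi> n) - 2 \<le> D\<^sup>2 * (p j n)\<^sup>2 + 22 * K ^ 3 * D ^ 3"
        using a b unfolding power2_minus by linarith
    qed (auto simp: cosh_real_ge_1)
    also have "\<dots> = D\<^sup>2 * (\<Sum>n\<in>A. (\<Sum>j\<in>UNIV. (p j n)\<^sup>2) * (f n)\<^sup>2) + 22 * K ^ 3 * D ^ 3 * d * N - G"
      by (simp add: sum_subtractf sum.distrib distrib_right N_def G_def d_def sum_distrib_left sum_distrib_right algebra_simps)
    finally show ?thesis by simp
  qed
  have gQ: "0 \<le> 4 * \<gamma> * Q" using \<gamma> Q0 by simp
  have e2: "4 * \<gamma> * Q * (22 * K ^ 3 * D ^ 3 * d * N) \<le> 88 * \<gamma> * K ^ 3 * d * \<epsilon> * (Q * D\<^sup>2 * N)"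
  proof -
    have "4 * \<gamma> * Q * (22 * K ^ 3 * D ^ 3 * d * N) = 88 * \<gamma> * K ^ 3 * d * D * (Q * D\<^sup>2 * N)"
      by (simp add: eval_nat_numeral)
    also have "\<dots> \<le> 88 * \<gamma> * K ^ 3 * d * \<epsilon> * (Q * D\<^sup>2 * N)"
      using \<epsilon> \<gamma> K d1 Q0 N0 by (intro mult_right_mono mult_left_mono) auto
    finally show ?thesis .
  qed
  \<comment> \<open>The square of the shift has only the second power of \<tau>, one less than the
    main term, and is therefore an error with factor \<open>1 / \<tau>\<close>.\<close>
  have e3: "4 * \<gamma>\<^sup>2 * Q\<^sup>2 * N \<le> 4 * \<gamma>\<^sup>2 * \<epsilon> * (Q * D\<^sup>2 * N)"
  proof -
    have "4 * \<gamma>\<^sup>2 * Q\<^sup>2 * N = 4 * \<gamma>\<^sup>2 * (1 / \<tau>) * (Q * D\<^sup>2 * N)"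
      using \<tau> by (simp add: Q_def D_def field_simps eval_nat_numeral)
    also have "\<dots> \<le> 4 * \<gamma>\<^sup>2 * \<epsilon> * (Q * D\<^sup>2 * N)"
      using \<epsilon> Q0 N0 by (intro mult_right_mono mult_left_mono) auto
    finally show ?thesis .
  qed
  let ?P2 = "\<Sum>n\<in>A. (\<Sum>j\<in>UNIV. (p j n)\<^sup>2) * (f n)\<^sup>2"
  have "4 * \<gamma> * Q * (G - D\<^sup>2 * ?P2 - 22 * K ^ 3 * D ^ 3 * d * N) \<le> - (4 * \<gamma> * Q * (\<Sum>n\<in>A. f n * L' n))"
    using mult_left_mono[OF step3 gQ] by (simp only: mult_minus_right)
  then have "(\<Sum>n\<in>A. (L n)\<^sup>2) \<ge> 2 * Q * W + 8 * Q * D\<^sup>2 * (\<Sum>n\<in>A. P n * (f n)\<^sup>2)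
      - 1500 * K ^ 4 * d\<^sup>2 * \<epsilon> * Q * (D\<^sup>2 * N + G)
      + 4 * \<gamma> * Q * (G - D\<^sup>2 * ?P2 - 22 * K ^ 3 * D ^ 3 * d * N) - 4 * \<gamma>\<^sup>2 * Q\<^sup>2 * N"
    using step1 step2 by linarith
  also have "4 * \<gamma> * Q * (G - D\<^sup>2 * ?P2 - 22 * K ^ 3 * D ^ 3 * d * N)
      = 4 * \<gamma> * Q * G - 4 * \<gamma> * Q * D\<^sup>2 * ?P2 - 4 * \<gamma> * Q * (22 * K ^ 3 * D ^ 3 * d * N)"
    by (simp add: algebra_simps)
  finally have "(\<Sum>n\<in>A. (L n)\<^sup>2) \<ge> 2 * Q * W + 8 * Q * D\<^sup>2 * (\<Sum>n\<in>A. P n * (f n)\<^sup>2)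
      - 1500 * K ^ 4 * d\<^sup>2 * \<epsilon> * Q * (D\<^sup>2 * N + G)
      + 4 * \<gamma> * Q * G - 4 * \<gamma> * Q * D\<^sup>2 * ?P2 - 88 * \<gamma> * K ^ 3 * d * \<epsilon> * (Q * D\<^sup>2 * N) - 4 * \<gamma>\<^sup>2 * \<epsilon> * (Q * D\<^sup>2 * N)"
    using e2 e3 by linarith
  moreover have "88 * \<gamma> * K ^ 3 * d * \<epsilon> * (Q * D\<^sup>2 * N) \<le> 88 * \<gamma> * K ^ 3 * d * \<epsilon> * (Q * D\<^sup>2 * N + Q * G)"
    using \<epsilon> \<gamma> K d1 Q0 G0 by (intro mult_left_mono) auto
  moreover have "4 * \<gamma>\<^sup>2 * \<epsilon> * (Q * D\<^sup>2 * N) \<le> 4 * \<gamma>\<^sup>2 * \<epsilon> * (Q * D\<^sup>2 * N + Q * G)"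
    using \<epsilon> Q0 G0 by (intro mult_left_mono) auto
  ultimately have "(\<Sum>n\<in>A. (L n)\<^sup>2) \<ge> 2 * Q * W + 8 * Q * D\<^sup>2 * (\<Sum>n\<in>A. P n * (f n)\<^sup>2)
      - 1500 * K ^ 4 * d\<^sup>2 * \<epsilon> * Q * (D\<^sup>2 * N + G)
      + 4 * \<gamma> * Q * G - 4 * \<gamma> * Q * D\<^sup>2 * ?P2 - 88 * \<gamma> * K ^ 3 * d * \<epsilon> * (Q * D\<^sup>2 * N + Q * G) - 4 * \<gamma>\<^sup>2 * \<epsilon> * (Q * D\<^sup>2 * N + Q * G)"
    by linarith
  also have "2 * Q * W + 8 * Q * D\<^sup>2 * (\<Sum>n\<in>A. P n * (f n)\<^sup>2)
      - 1500 * K ^ 4 * d\<^sup>2 * \<epsilon> * Q * (D\<^sup>2 * N + G)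
      + 4 * \<gamma> * Q * G - 4 * \<gamma> * Q * D\<^sup>2 * ?P2 - 88 * \<gamma> * K ^ 3 * d * \<epsilon> * (Q * D\<^sup>2 * N + Q * G) - 4 * \<gamma>\<^sup>2 * \<epsilon> * (Q * D\<^sup>2 * N + Q * G)
     = Q * (2 * W + 4 * \<gamma> * G) + Q * D\<^sup>2 * (8 * (\<Sum>n\<in>A. P n * (f n)\<^sup>2) - 4 * \<gamma> * ?P2)
       - (1500 * K ^ 4 * d\<^sup>2 + 88 * \<gamma> * K ^ 3 * d + 4 * \<gamma>\<^sup>2) * \<epsilon> * (Q * D\<^sup>2 * N + Q * G)"
    by (simp add: algebra_simps)
  also have "8 * (\<Sum>n\<in>A. P n * (f n)\<^sup>2) - 4 * \<gamma> * ?P2 = (\<Sum>n\<in>A. (8 * P n - 4 * \<gamma> * (\<Sum>j\<in>UNIV. (p j n)\<^sup>2)) * (f n)\<^sup>2)"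
    unfolding left_diff_distrib sum_subtractf mult.assoc sum_distrib_left[of _ _ A, symmetric] ..
  finally show ?thesis
    unfolding QD unfolding L_def Q_def W_def P_def \<epsilon>_def D_def d_def by simp
qed

end

section \<open>A weight with a discrete Carleman estimate\<close>

definition weight :: "real \<Rightarrow> real ^ 'd \<Rightarrow> real" where
  "weight a x = (x \<bullet> x)\<^sup>2 / 2 - a * (x \<bullet> x)"

definition weight_grad :: "real \<Rightarrow> 'd \<Rightarrow> real ^ 'd \<Rightarrow> real" where
  "weight_grad a j x = 2 * (x \<bullet> x - a) * x $ j"

definition weight_hess :: "real \<Rightarrow> 'd \<Rightarrow> 'd \<Rightarrow> real ^ 'd \<Rightarrow> real" where
  "weight_hess a j k x = 2 * (x \<bullet> x - a) * of_bool (j = k) + 4 * x $ j * x $ k"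

lemma inner_add_axis:
  fixes x :: "real ^ 'd"
  shows "(x + h *\<^sub>R axis j 1) \<bullet> (x + h *\<^sub>R axis j 1) = x \<bullet> x + 2 * h * x $ j + h\<^sup>2"
    and "(x - h *\<^sub>R axis j 1) \<bullet> (x - h *\<^sub>R axis j 1) = x \<bullet> x - 2 * h * x $ j + h\<^sup>2"
    and "(x + h *\<^sub>R axis j 1 + h *\<^sub>R axis k 1) \<bullet> (x + h *\<^sub>R axis j 1 + h *\<^sub>R axis k 1)
      = x \<bullet> x + 2 * h * (x $ j + x $ k) + 2 * h\<^sup>2 * (1 + of_bool (j = k))"
  by (auto simp: inner_simps inner_axis inner_axis' inner_axis_axis power2_eq_square algebra_simps) (simp add: axis_def)

text \<open>The weight is a quadratic polynomial in \<open>x \<bullet> x\<close>, which changes by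
  an explicit polynomial in \<open>h\<close> under a step; each error is thus an exact polynomial
  from which the required power of \<open>h\<close> factors out. The value 200 is a common bound
  that serves as \<open>K\<close> in \<open>carleman_lower_bound\<close>. The case
  \<open>j = k\<close> is carried along by \<delta>.\<close>

lemma weight_bounds:
  fixes x :: "real ^ 'd" and h :: real
  defines "e \<equiv> \<lambda>j :: 'd. h *\<^sub>R axis j (1 :: real)"
  assumes x: "norm x \<le> 3" and a: "0 \<le> a" "a \<le> 2" and h: "0 < h" "h \<le> 1"
  shows weight_mixed_difference: "\<bar>weight a x + weight a (x + e j + e k) - weight a (x + e j) - weight a (x + e k)
      - h\<^sup>2 * weight_hess a j k x\<bar> \<le> 200 * h ^ 3"
    and weight_diagonal: "\<bar>weight a (x + e j + e k) - weight a x - h * (weight_grad a j x + weight_grad a k x)\<bar> \<le> 200 * h\<^sup>2"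
    and weight_antidiagonal: "\<bar>weight a (x + e j) - weight a (x + e k) - h * (weight_grad a j x - weight_grad a k x)\<bar> \<le> 200 * h\<^sup>2"
    and weight_forward: "\<bar>weight a (x + e j) - weight a x - h * weight_grad a j x\<bar> \<le> 200 * h\<^sup>2"
    and weight_backward: "\<bar>weight a (x - e j) - weight a x + h * weight_grad a j x\<bar> \<le> 200 * h\<^sup>2"
    and weight_hess_le: "\<bar>weight_hess a j k x\<bar> \<le> 200"
    and weight_grad_le: "\<bar>weight_grad a j x\<bar> \<le> 200"
    and weight_hess_difference: "\<bar>weight_hess a j k (x + e j + e k) - weight_hess a j k x\<bar> \<le> 200 * h"
    and weight_hess_mixed_difference: "\<bar>weight_hess a j k (x + e j) + weight_hess a j k (x + e k)
      - weight_hess a j k (x + e j + e k) - weight_hess a j k x\<bar> \<le> 200 * h\<^sup>2"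
proof -
  define s X Y \<delta> where "s = x \<bullet> x" and "X = x $ j" and "Y = x $ k" and "\<delta> = (of_bool (j = k) :: real)"
  have s: "0 \<le> s" "s \<le> 9"
    using power_mono[OF x, of 2] by (auto simp: s_def power2_norm_eq_inner)
  have sa: "\<bar>s - a\<bar> \<le> 9" using s a by auto
  have X: "\<bar>X\<bar> \<le> 3" "\<bar>Y\<bar> \<le> 3"
    using component_le_norm_cart[of x j] component_le_norm_cart[of x k] x by (auto simp: X_def Y_def)
  have \<delta>: "\<delta> = 0 \<or> \<delta> = 1" "0 \<le> \<delta>" "\<delta> \<le> 1" by (auto simp: \<delta>_def)
  have h2: "h\<^sup>2 \<le> h" using h by (simp add: power2_eq_square)
  have w: "weight a x = s\<^sup>2 / 2 - a * s"
    "weight a (x + e j) = (s + 2 * h * X + h\<^sup>2)\<^sup>2 / 2 - a * (s + 2 * h * X + h\<^sup>2)"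
    "weight a (x - e j) = (s - 2 * h * X + h\<^sup>2)\<^sup>2 / 2 - a * (s - 2 * h * X + h\<^sup>2)"
    "weight a (x + e k) = (s + 2 * h * Y + h\<^sup>2)\<^sup>2 / 2 - a * (s + 2 * h * Y + h\<^sup>2)"
    "weight a (x + e j + e k) = (s + 2 * h * (X + Y) + 2 * h\<^sup>2 * (1 + \<delta>))\<^sup>2 / 2 - a * (s + 2 * h * (X + Y) + 2 * h\<^sup>2 * (1 + \<delta>))"
    unfolding weight_def e_def unfolding inner_add_axis(3) unfolding inner_add_axis(1,2) s_def X_def Y_def \<delta>_def by simp_all
  have g: "weight_grad a j x = 2 * (s - a) * X" "weight_grad a k x = 2 * (s - a) * Y"
    by (simp_all add: weight_grad_def s_def X_def Y_def)
  have H: "weight_hess a j k x = 2 * (s - a) * \<delta> + 4 * X * Y"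
    "weight_hess a j k (x + e j) = 2 * (s + 2 * h * X + h\<^sup>2 - a) * \<delta> + 4 * (X + h) * (Y + h * \<delta>)"
    "weight_hess a j k (x + e k) = 2 * (s + 2 * h * Y + h\<^sup>2 - a) * \<delta> + 4 * (X + h * \<delta>) * (Y + h)"
    "weight_hess a j k (x + e j + e k) = 2 * (s + 2 * h * (X + Y) + 2 * h\<^sup>2 * (1 + \<delta>) - a) * \<delta>
        + 4 * (X + h * (1 + \<delta>)) * (Y + h * (1 + \<delta>))"
    unfolding weight_hess_def e_def unfolding inner_add_axis(3) unfolding inner_add_axis(1,2) s_def X_def Y_def \<delta>_def
    by (auto simp: axis_def algebra_simps)
  have XY: "\<bar>X * Y\<bar> \<le> 9"
    using X mult_mono[of "\<bar>X\<bar>" 3 "\<bar>Y\<bar>" 3] by (simp add: abs_mult)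
  have XpY: "\<bar>X + Y\<bar> \<le> 6" using X by auto
  have saX: "\<bar>(s - a) * X\<bar> \<le> 27" 
    using X sa mult_mono[of "\<bar>s - a\<bar>" 9 "\<bar>X\<bar>" 3] by (simp add: abs_mult)
  have sad: "\<bar>(s - a) * \<delta>\<bar> \<le> 9"
    using \<delta>(1) sa by auto
  have sq: "(u * h)\<^sup>2 \<le> c * c * h\<^sup>2" if "\<bar>u\<bar> \<le> c" for u c
    using that by (simp add: power_mult_distrib mult_right_mono power2_eq_square[of c, symmetric] abs_le_square_iff[symmetric])
  have A: "\<bar>2 * X + h\<bar> \<le> 7" "\<bar>2 * Y + h\<bar> \<le> 7" "\<bar>h - 2 * X\<bar> \<le> 7" using X h by auto
  have T: "\<bar>2 * (X + Y) + 2 * h * (1 + \<delta>)\<bar> \<le> 16" using XpY h \<delta>(1) by auto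
  note A2 = sq[OF A(1)] sq[OF A(2)] sq[OF A(3)] sq[OF T]
  have sah: "\<bar>(s - a) * h\<^sup>2\<bar> \<le> 9 * h\<^sup>2" using sa h by (simp add: abs_mult)
  show "\<bar>weight a x + weight a (x + e j + e k) - weight a (x + e j) - weight a (x + e k)
      - h\<^sup>2 * weight_hess a j k x\<bar> \<le> 200 * h ^ 3"
  proof -
    have "weight a x + weight a (x + e j + e k) - weight a (x + e j) - weight a (x + e k)
      - h\<^sup>2 * weight_hess a j k x = h ^ 3 * (2 * (X + Y) + h + 2 * \<delta> * (2 * (X + Y) + 2 * h) + 2 * h * \<delta>\<^sup>2)"
      unfolding w H by (simp add: field_simps eval_nat_numeral)
    moreover have "\<bar>2 * (X + Y) + h + 2 * \<delta> * (2 * (X + Y) + 2 * h) + 2 * h * \<delta>\<^sup>2\<bar> \<le> 200"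
      using \<delta>(1) XpY h by auto
    ultimately show ?thesis
      using h by (simp add: abs_mult mult.commute)
  qed
  show "\<bar>weight a (x + e j + e k) - weight a x - h * (weight_grad a j x + weight_grad a k x)\<bar> \<le> 200 * h\<^sup>2"
  proof -
    have "weight a (x + e j + e k) - weight a x - h * (weight_grad a j x + weight_grad a k x)
      = 2 * (1 + \<delta>) * ((s - a) * h\<^sup>2) + ((2 * (X + Y) + 2 * h * (1 + \<delta>)) * h)\<^sup>2 / 2"
      unfolding w g by (simp add: field_simps eval_nat_numeral)
    moreover have "\<bar>2 * (1 + \<delta>) * ((s - a) * h\<^sup>2)\<bar> \<le> 36 * h\<^sup>2"
      using sah \<delta>(1) by auto
    ultimately show ?thesis
      using A2(4) zero_le_power2[of "(2 * (X + Y) + 2 * h * (1 + \<delta>)) * h"] by linarith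
  qed
  show "\<bar>weight a (x + e j) - weight a (x + e k) - h * (weight_grad a j x - weight_grad a k x)\<bar> \<le> 200 * h\<^sup>2"
  proof -
    have "weight a (x + e j) - weight a (x + e k) - h * (weight_grad a j x - weight_grad a k x)
      = ((2 * X + h) * h)\<^sup>2 / 2 - ((2 * Y + h) * h)\<^sup>2 / 2"
      unfolding w g by (simp add: field_simps eval_nat_numeral)
    then show ?thesis
      using A2(1,2) zero_le_power2[of "(2 * X + h) * h"] zero_le_power2[of "(2 * Y + h) * h"] by linarith
  qed
  show "\<bar>weight a (x + e j) - weight a x - h * weight_grad a j x\<bar> \<le> 200 * h\<^sup>2"
  proof -
    have "weight a (x + e j) - weight a x - h * weight_grad a j x = (s - a) * h\<^sup>2 + ((2 * X + h) * h)\<^sup>2 / 2"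
      unfolding w g by (simp add: field_simps eval_nat_numeral)
    then show ?thesis
      using A2(1) zero_le_power2[of "(2 * X + h) * h"] sah by linarith
  qed
  show "\<bar>weight a (x - e j) - weight a x + h * weight_grad a j x\<bar> \<le> 200 * h\<^sup>2"
  proof -
    have "weight a (x - e j) - weight a x + h * weight_grad a j x = (s - a) * h\<^sup>2 + ((h - 2 * X) * h)\<^sup>2 / 2"
      unfolding w g by (simp add: field_simps eval_nat_numeral)
    then show ?thesis
      using A2(3) zero_le_power2[of "(h - 2 * X) * h"] sah by linarith
  qed
  show "\<bar>weight_hess a j k x\<bar> \<le> 200" unfolding H mult.assoc using sad XY by linarith
  show "\<bar>weight_grad a j x\<bar> \<le> 200" unfolding g mult.assoc using saX by linarith
  show "\<bar>weight_hess a j k (x + e j + e k) - weight_hess a j k x\<bar> \<le> 200 * h"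
  proof -
    have "weight_hess a j k (x + e j + e k) - weight_hess a j k x
      = h * (2 * \<delta> * (2 * (X + Y) + 2 * h * (1 + \<delta>)) + 4 * (1 + \<delta>) * (X + Y) + 4 * h * (1 + \<delta>)\<^sup>2)"
      unfolding H by (simp add: field_simps eval_nat_numeral)
    moreover have "\<bar>2 * \<delta> * (2 * (X + Y) + 2 * h * (1 + \<delta>)) + 4 * (1 + \<delta>) * (X + Y) + 4 * h * (1 + \<delta>)\<^sup>2\<bar> \<le> 200"
      using \<delta>(1) XpY h by auto
    ultimately show ?thesis
      using h by (simp add: abs_mult mult.commute)
  qed
  show "\<bar>weight_hess a j k (x + e j) + weight_hess a j k (x + e k)
      - weight_hess a j k (x + e j + e k) - weight_hess a j k x\<bar> \<le> 200 * h\<^sup>2"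
  proof -
    have "weight_hess a j k (x + e j) + weight_hess a j k (x + e k)
      - weight_hess a j k (x + e j + e k) - weight_hess a j k x = h\<^sup>2 * (- 4 * \<delta>\<^sup>2 - 4 * (1 + \<delta>\<^sup>2))"
      unfolding H by (simp add: field_simps eval_nat_numeral)
    moreover have "\<bar>- 4 * \<delta>\<^sup>2 - 4 * (1 + \<delta>\<^sup>2)\<bar> \<le> 200"
      using \<delta>(1) by auto
    ultimately show ?thesis
      using h by (simp add: abs_mult mult.commute)
  qed
qed

text \<open>The Hessian is a multiple of the identity plus the rank-one form \<open>4 x x^T\<close>.
  The second part is nonnegative, so only the first can spoil positivity.\<close>

lemma weight_hess_quadratic_form:
  fixes x :: "real ^ 'd" and d :: "'d \<Rightarrow> real"
  shows "(\<Sum>j\<in>UNIV. \<Sum>k\<in>UNIV. weight_hess a j k x * d j * d k)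
    = 2 * (x \<bullet> x - a) * (\<Sum>j\<in>UNIV. (d j)\<^sup>2) + 4 * (\<Sum>j\<in>UNIV. x $ j * d j)\<^sup>2"
proof -
  have sq: "(\<Sum>j\<in>UNIV. x $ j * d j)\<^sup>2 = (\<Sum>j\<in>UNIV. \<Sum>k\<in>UNIV. (x $ j * d j) * (x $ k * d k))"
    by (simp only: power2_eq_square sum_product)
  have "(\<Sum>j\<in>UNIV. \<Sum>k\<in>UNIV. weight_hess a j k x * d j * d k)
    = (\<Sum>j\<in>UNIV. \<Sum>k\<in>UNIV. (if j = k then 2 * (x \<bullet> x - a) * (d j * d k) else 0) + 4 * ((x $ j * d j) * (x $ k * d k)))"
    by (intro sum.cong refl) (auto simp: weight_hess_def algebra_simps)
  also have "\<dots> = (\<Sum>j\<in>UNIV. 2 * (x \<bullet> x - a) * (d j)\<^sup>2) + 4 * (\<Sum>j\<in>UNIV. \<Sum>k\<in>UNIV. (x $ j * d j) * (x $ k * d k))"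
    unfolding sum.distrib sum_distrib_left by (simp add: power2_eq_square)
  also have "\<dots> = 2 * (x \<bullet> x - a) * (\<Sum>j\<in>UNIV. (d j)\<^sup>2) + 4 * (\<Sum>j\<in>UNIV. x $ j * d j)\<^sup>2"
    unfolding sq sum_distrib_left[of "2 * (x \<bullet> x - a)"] ..
  finally show ?thesis .
qed

lemma sum_scaled_component_square:
  fixes x :: "real ^ 'd"
  shows "(\<Sum>j\<in>UNIV. c * (x $ j)\<^sup>2) = c * (x \<bullet> x)"
  by (simp add: inner_vec_def sum_distrib_left power2_eq_square)

lemma weight_grad_square_sum:
  fixes x :: "real ^ 'd"
  shows "(\<Sum>j\<in>UNIV. (weight_grad a j x)\<^sup>2) = 4 * (x \<bullet> x - a)\<^sup>2 * (x \<bullet> x)"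
  unfolding weight_grad_def power_mult_distrib sum_scaled_component_square by simp

text \<open>The gradient is radial, hence an eigenvector of the Hessian with eigenvalue
  \<open>2 (|x|^2 - a) + 4 |x|^2\<close>.\<close>

lemma weight_hess_grad:
  fixes x :: "real ^ 'd"
  shows "(\<Sum>j\<in>UNIV. \<Sum>k\<in>UNIV. weight_hess a j k x * weight_grad a j x * weight_grad a k x)
    = 4 * (x \<bullet> x - a)\<^sup>2 * (x \<bullet> x) * (6 * (x \<bullet> x) - 2 * a)"
proof -
  have *: "(\<Sum>j\<in>UNIV. x $ j * weight_grad a j x) = 2 * (x \<bullet> x - a) * (x \<bullet> x)"
    unfolding weight_grad_def sum_scaled_component_square[symmetric]
    by (intro sum.cong refl) (simp add: power2_eq_square)
  show ?thesis
    unfolding weight_hess_quadratic_form weight_grad_square_sum *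
    by (simp add: power2_eq_square algebra_simps)
qed

section \<open>Lattice translations and the Carleman estimate on an annulus\<close>

lemma lattice_add_axis:
  fixes n :: "real ^ 'd"
  assumes "n \<in> lattice h" shows "n + h *\<^sub>R axis j 1 \<in> lattice h" "n - h *\<^sub>R axis j 1 \<in> lattice h"
proof -
  have "(\<exists>k::int. (n + h *\<^sub>R axis j 1) $ i = h * of_int k) \<and> (\<exists>k::int. (n - h *\<^sub>R axis j 1) $ i = h * of_int k)" for i
  proof -
    obtain k :: int where "n $ i = h * of_int k" using assms by (auto simp: lattice_def)
    then have "(n + h *\<^sub>R axis j 1) $ i = h * of_int (k + of_bool (i = j))"
      "(n - h *\<^sub>R axis j 1) $ i = h * of_int (k - of_bool (i = j))"
      by (auto simp: axis_def algebra_simps)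
    then show ?thesis by blast
  qed
  then show "n + h *\<^sub>R axis j 1 \<in> lattice h" "n - h *\<^sub>R axis j 1 \<in> lattice h"
    unfolding lattice_def by blast+
qed

lemma norm_add_axis_le:
  fixes n :: "real ^ 'd" assumes "0 \<le> h"
  shows "norm (n + h *\<^sub>R axis j 1) \<le> norm n + h" "norm (n - h *\<^sub>R axis j 1) \<le> norm n + h"
  using assms norm_triangle_ineq[of n "h *\<^sub>R axis j 1"] norm_triangle_ineq4[of n "h *\<^sub>R axis j 1"] by simp_all

lemma padded_support_lattice_ball:
  fixes f :: "real ^ 'd \<Rightarrow> real"
  assumes h: "0 < h" and f: "\<And>n. f n \<noteq> 0 \<Longrightarrow> n \<in> lattice h \<and> norm n + 2 * h < r"
  shows "padded_support (\<lambda>j. h *\<^sub>R axis j 1) (lattice_ball h r) f"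
proof
  note l = lattice_add_axis[of _ h] and N = norm_add_axis_le[of h]
  fix n j k assume "f n \<noteq> 0"
  note n = f[OF this]
  have h0: "0 \<le> h" using h by simp
  show "n \<in> lattice_ball h r" using n h by (auto simp: lattice_ball_def intro!: l)
  show "n + h *\<^sub>R axis j 1 \<in> lattice_ball h r" "n - h *\<^sub>R axis j 1 \<in> lattice_ball h r"
    using n h l N[OF h0, of n j] by (auto simp: lattice_ball_def intro!: l)
  show "n + h *\<^sub>R axis j 1 + h *\<^sub>R axis k 1 \<in> lattice_ball h r"
    using n h l N(1)[OF h0, of n j] N(1)[OF h0, of "n + h *\<^sub>R axis j 1" k] by (auto simp: lattice_ball_def intro!: l)
  show "n + h *\<^sub>R axis j 1 - h *\<^sub>R axis k 1 \<in> lattice_ball h r"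
    using n h l N(1)[OF h0, of n j] N(2)[OF h0, of "n + h *\<^sub>R axis j 1" k] by (auto simp: lattice_ball_def intro!: l)
  show "n - h *\<^sub>R axis j 1 - h *\<^sub>R axis k 1 \<in> lattice_ball h r"
    using n h l N(2)[OF h0, of n j] N(2)[OF h0, of "n - h *\<^sub>R axis j 1" k] by (auto simp: lattice_ball_def intro!: l)
qed (rule finite_lattice_ball[OF h])

text \<open>On this annulus both energies enter the abstract lower bound with coefficient at least
  1/1000; \<tau>0 and \<delta> are chosen so that the error consumes at most half of it. This is the
  origin of the factor 2000.\<close>

lemma carleman_estimate:
  fixes \<rho> :: real
  assumes \<rho>: "1/4 \<le> \<rho>" "\<rho> \<le> 1"
  obtains \<tau>0 \<delta> where "1 \<le> \<tau>0" and "0 < \<delta>" and "\<delta> \<le> 1/2000"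
    and "\<And>h \<tau> (f :: real ^ 'd \<Rightarrow> real). 0 < h \<Longrightarrow> \<tau>0 \<le> \<tau> \<Longrightarrow> \<tau> * h \<le> \<delta> \<Longrightarrow>
      (\<And>n. f n \<noteq> 0 \<Longrightarrow> n \<in> lattice h \<and> 9/10 * \<rho> \<le> n \<bullet> n \<and> n \<bullet> n \<le> 7/5 * \<rho>) \<Longrightarrow>
      \<tau> ^ 3 * h ^ 4 * (\<Sum>n\<in>lattice_ball h 3. (f n)\<^sup>2)
        + \<tau> * h\<^sup>2 * (\<Sum>n\<in>lattice_ball h 3. \<Sum>j\<in>UNIV. (f (n + h *\<^sub>R axis j 1) - f n)\<^sup>2)
      \<le> 2000 * (\<Sum>n\<in>lattice_ball h 3. (conj_laplacian (\<lambda>j. h *\<^sub>R axis j 1) (\<lambda>x. \<tau> * weight (8/5 * \<rho>) x) f n)\<^sup>2)"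
proof -
  \<comment> \<open>With \<open>s = n \<bullet> n\<close>, positivity of the gradient term asks for
    \<open>\<gamma> > 4 * (a - s)\<close>, the loss 4 of the centred differences included, and
    positivity of the zero-order term for \<open>\<gamma> < 12 * s - 4 * a\<close>. For
    \<open>s \<ge> 9/10 * \<rho>\<close> and \<open>a = 8/5 * \<rho>\<close> this is the window from
    \<open>2.8 * \<rho>\<close> to \<open>4.4 * \<rho>\<close>.\<close>
  define \<gamma> where "\<gamma> = 7/2 * \<rho>"
  define a where "a = 8/5 * \<rho>"
  define C where "C = 1500 * 200 ^ 4 * (real CARD('d))\<^sup>2 + 88 * \<gamma> * 200 ^ 3 * real CARD('d) + 4 * \<gamma>\<^sup>2"
  define \<tau>0 where "\<tau>0 = max 1 (4000 * C)"
  define \<delta> where "\<delta> = min (1/2000) (1 / (4000 * C))"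
  have \<gamma>0: "0 < \<gamma>" using \<rho> by (simp add: \<gamma>_def)
  have C0: "0 < C" using \<gamma>0 by (simp add: C_def add_nonneg_pos)
  show thesis
  proof (rule that[of \<tau>0 \<delta>])
    show "1 \<le> \<tau>0" "0 < \<delta>" "\<delta> \<le> 1/2000" using C0 by (simp_all add: \<tau>0_def \<delta>_def)
  next
    fix h \<tau> :: real and f :: "real ^ 'd \<Rightarrow> real"
    assume h: "0 < h" and \<tau>: "\<tau>0 \<le> \<tau>" and D: "\<tau> * h \<le> \<delta>"
      and f: "\<And>n. f n \<noteq> 0 \<Longrightarrow> n \<in> lattice h \<and> 9/10 * \<rho> \<le> n \<bullet> n \<and> n \<bullet> n \<le> 7/5 * \<rho>"
    define e :: "'d \<Rightarrow> real ^ 'd" where "e = (\<lambda>j. h *\<^sub>R axis j 1)"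
    define A :: "(real ^ 'd) set" where "A = lattice_ball h 3"
    have \<tau>1: "1 \<le> \<tau>" using \<tau> by (simp add: \<tau>0_def)
    have h1: "h \<le> 1/2000"
    proof -
      have "h \<le> \<tau> * h" using \<tau>1 h by simp
      also have "\<dots> \<le> 1/2000" using D by (simp add: \<delta>_def)
      finally show ?thesis .
    qed
    have C\<epsilon>: "C * (\<tau> * h + 1 / \<tau>) \<le> 1/2000"
    proof -
      have "\<tau> * h \<le> 1 / (4000 * C)" using D by (simp add: \<delta>_def)
      then have "C * (\<tau> * h) \<le> 1/4000" using C0 by (simp add: field_simps)
      moreover have "4000 * C \<le> \<tau>" using \<tau> by (simp add: \<tau>0_def)
      then have "C * (1 / \<tau>) \<le> 1/4000" using \<tau>1 by (simp add: field_simps)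
      ultimately show ?thesis unfolding distrib_left by linarith
    qed
    have norm_f: "norm n \<le> 6/5" if "f n \<noteq> 0" for n
    proof -
      have "(norm n)\<^sup>2 \<le> (6/5)\<^sup>2"
        unfolding power2_norm_eq_inner using f[OF that] \<rho> by (simp add: power2_eq_square)
      then show ?thesis by (rule power2_le_imp_le) simp
    qed
    interpret padded_support e A f
      unfolding e_def A_def
    proof (rule padded_support_lattice_ball[OF h])
      fix n assume "f n \<noteq> 0"
      then show "n \<in> lattice h \<and> norm n + 2 * h < 3"
        using f[of n] norm_f[of n] h1 by auto
    qed
    define N where "N = (\<Sum>n\<in>A. (f n)\<^sup>2)"
    define G where "G = (\<Sum>n\<in>A. \<Sum>j\<in>UNIV. (f (n + e j) - f n)\<^sup>2)"
    have N0: "0 \<le> N" and G0: "0 \<le> G" by (auto simp: N_def G_def sum_nonneg)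
    have A3: "norm n \<le> 3" if "n \<in> A" for n using that by (simp add: A_def lattice_ball_def)
    have a: "0 \<le> a" "a \<le> 2" using \<rho> by (simp_all add: a_def)
    have hh: "0 < h" "h \<le> 1" using h h1 by simp_all
    have D10: "10 * 200 * (\<tau> * h) \<le> 1" using D by (simp add: \<delta>_def)
    define W where "W = (\<Sum>n\<in>A. \<Sum>j\<in>UNIV. \<Sum>k\<in>UNIV. weight_hess a j k n * (f (n + e j) - f (n - e j)) * (f (n + e k) - f (n - e k)))"
    define Z where "Z = (\<Sum>n\<in>A. (8 * (\<Sum>j\<in>UNIV. \<Sum>k\<in>UNIV. weight_hess a j k n * weight_grad a j n * weight_grad a k n)
          - 4 * \<gamma> * (\<Sum>j\<in>UNIV. (weight_grad a j n)\<^sup>2)) * (f n)\<^sup>2)"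
    have main: "(\<Sum>n\<in>A. (conj_laplacian e (\<lambda>x. \<tau> * weight a x) f n)\<^sup>2)
      \<ge> \<tau> * h\<^sup>2 * (2 * W + 4 * \<gamma> * G) + \<tau> ^ 3 * h ^ 4 * Z
        - C * (\<tau> * h + 1 / \<tau>) * (\<tau> ^ 3 * h ^ 4 * N + \<tau> * h\<^sup>2 * G)"
      unfolding C_def N_def G_def W_def Z_def
      using weight_bounds[OF A3 a hh] \<tau>1 h D10 less_imp_le[OF \<gamma>0]
      by (intro carleman_lower_bound) (auto simp: e_def)
    have W: "W \<ge> - (144/25 * \<rho>) * G"
    proof -
      have "W \<ge> (\<Sum>n\<in>A. - (36/25 * \<rho>) * (\<Sum>j\<in>UNIV. (f (n + e j) - f (n - e j))\<^sup>2))"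
        unfolding W_def
      proof (rule sum_mono)
        fix n assume "n \<in> A"
        let ?d = "\<lambda>j. f (n + e j) - f (n - e j)"
        show "- (36/25 * \<rho>) * (\<Sum>j\<in>UNIV. (?d j)\<^sup>2) \<le> (\<Sum>j\<in>UNIV. \<Sum>k\<in>UNIV. weight_hess a j k n * ?d j * ?d k)"
        proof (cases "\<forall>j. ?d j = 0")
          case True
          then show ?thesis by simp
        next
          case False
          \<comment> \<open>A centred difference can be nonzero at a point one step outside the
            support of \<open>f\<close>; the passage from 9/10 to 22/25 is the slack for that
            step.\<close>
          then obtain j where "f (n + e j) \<noteq> 0 \<or> f (n - e j) \<noteq> 0" by fastforce
          then have "9/10 * \<rho> \<le> (n + e j) \<bullet> (n + e j) \<or> 9/10 * \<rho> \<le> (n - e j) \<bullet> (n - e j)"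
            using f by blast
          moreover have hj: "\<bar>2 * h * n $ j\<bar> = 2 * h * \<bar>n $ j\<bar>" using h by (simp add: abs_mult)
          ultimately have "9/10 * \<rho> \<le> n \<bullet> n + 2 * h * \<bar>n $ j\<bar> + h\<^sup>2"
            unfolding e_def inner_add_axis using hj by linarith
          moreover have "h * \<bar>n $ j\<bar> \<le> h * 3"
            using component_le_norm_cart[of n j] A3[OF \<open>n \<in> A\<close>] h by (intro mult_left_mono) auto
          moreover have "h\<^sup>2 \<le> h" using hh by (simp add: power2_eq_square)
          ultimately have "22/25 * \<rho> \<le> n \<bullet> n"
            using h1 \<rho> by linarith
          then have "- (36/25 * \<rho>) \<le> 2 * (n \<bullet> n - a)" by (simp add: a_def)
          then have "- (36/25 * \<rho>) * (\<Sum>j\<in>UNIV. (?d j)\<^sup>2) \<le> 2 * (n \<bullet> n - a) * (\<Sum>j\<in>UNIV. (?d j)\<^sup>2)"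
            by (rule mult_right_mono) (simp add: sum_nonneg)
          then show ?thesis
            unfolding weight_hess_quadratic_form by (simp add: add_increasing2)
        qed
      qed
      moreover have "(\<Sum>n\<in>A. \<Sum>j\<in>UNIV. (f (n + e j) - f (n - e j))\<^sup>2) \<le> 4 * G"
      proof -
        have "(\<Sum>n\<in>A. \<Sum>j\<in>UNIV. (f (n + e j) - f (n - e j))\<^sup>2) = (\<Sum>j\<in>UNIV. \<Sum>n\<in>A. (f (n + e j) - f (n - e j))\<^sup>2)"
          by (rule sum.swap)
        also have "\<dots> \<le> (\<Sum>j\<in>UNIV. 4 * (\<Sum>n\<in>A. (f (n + e j) - f n)\<^sup>2))"
          by (intro sum_mono sum_centered_difference_square_le)
        also have "\<dots> = 4 * G"
          unfolding G_def sum_distrib_left[symmetric] by (subst sum.swap) simp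
        finally show ?thesis .
      qed
      then have "- (36/25 * \<rho>) * (\<Sum>n\<in>A. \<Sum>j\<in>UNIV. (f (n + e j) - f (n - e j))\<^sup>2) \<ge> - (36/25 * \<rho>) * (4 * G)"
        using \<rho> by (intro mult_left_mono_neg) auto
      moreover have "- (36/25 * \<rho>) * (4 * G) = - (144/25 * \<rho>) * G" by simp
      ultimately show ?thesis
        unfolding sum_distrib_left[symmetric] by linarith
    qed
    have "0.001 * G \<le> 2 * W + 4 * \<gamma> * G"
    proof -
      have "2 * W + 4 * \<gamma> * G \<ge> 2 * (- (144/25 * \<rho>) * G) + 4 * \<gamma> * G" using W by linarith
      moreover have "2 * (- (144/25 * \<rho>) * G) + 4 * \<gamma> * G = 62/25 * \<rho> * G" by (simp add: \<gamma>_def algebra_simps)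
      moreover have "62/25 * \<rho> * G \<ge> 0.001 * G" using \<rho> G0 by (intro mult_right_mono) auto
      ultimately show ?thesis by linarith
    qed
    then have G1: "\<tau> * h\<^sup>2 * (2 * W + 4 * \<gamma> * G) \<ge> \<tau> * h\<^sup>2 * (0.001 * G)"
      using \<tau>1 h by (intro mult_left_mono) auto
    have "(\<Sum>n\<in>A. 0.001 * (f n)\<^sup>2) \<le> Z"
      unfolding Z_def
    proof (rule sum_mono)
      fix n assume "n \<in> A"
      show "0.001 * (f n)\<^sup>2 \<le> (8 * (\<Sum>j\<in>UNIV. \<Sum>k\<in>UNIV. weight_hess a j k n * weight_grad a j n * weight_grad a k n)
          - 4 * \<gamma> * (\<Sum>j\<in>UNIV. (weight_grad a j n)\<^sup>2)) * (f n)\<^sup>2"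
      proof (cases "f n = 0")
        case False
        define s where "s = n \<bullet> n"
        have s: "9/10 * \<rho> \<le> s" "s \<le> 7/5 * \<rho>" using f[OF False] by (auto simp: s_def)
        \<comment> \<open>The weight is critical on the sphere \<open>s = a\<close>. The outer bound
          \<open>7/5 * \<rho>\<close> stays at distance \<open>\<rho> / 5 \<ge> 1/20\<close> from
          it, so the gradient does not degenerate.\<close>
        have 1: "(1/20)\<^sup>2 \<le> (s - a)\<^sup>2"
          using s \<rho> by (intro abs_le_square_iff[THEN iffD1]) (auto simp: a_def)
        have 2: "1/5 \<le> s" "9/10 \<le> 8 * (6 * s - 2 * a) - 4 * \<gamma>"
          using s \<rho> by (auto simp: a_def \<gamma>_def)
        have "0.001 \<le> 4 * (1/20)\<^sup>2 * (1/5) * (9/10 :: real)" by (simp add: power2_eq_square)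
        also have "\<dots> \<le> 4 * (s - a)\<^sup>2 * s * (8 * (6 * s - 2 * a) - 4 * \<gamma>)"
          using 1 2 by (intro mult_mono) auto
        also have "\<dots> = 8 * (4 * (s - a)\<^sup>2 * s * (6 * s - 2 * a)) - 4 * \<gamma> * (4 * (s - a)\<^sup>2 * s)"
          by (simp add: algebra_simps)
        finally show ?thesis
          unfolding weight_hess_grad weight_grad_square_sum s_def[symmetric]
          by (intro mult_right_mono) auto
      qed simp
    qed
    then have "0.001 * N \<le> Z"
      by (simp only: N_def sum_distrib_left)
    then have N1: "\<tau> ^ 3 * h ^ 4 * Z \<ge> \<tau> ^ 3 * h ^ 4 * (0.001 * N)"
      using \<tau>1 h by (intro mult_left_mono) auto
    have "C * (\<tau> * h + 1 / \<tau>) * (\<tau> ^ 3 * h ^ 4 * N + \<tau> * h\<^sup>2 * G) \<le> 1/2000 * (\<tau> ^ 3 * h ^ 4 * N + \<tau> * h\<^sup>2 * G)"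
      using C\<epsilon> \<tau>1 h N0 G0 by (intro mult_right_mono) auto
    then have "\<tau> ^ 3 * h ^ 4 * N + \<tau> * h\<^sup>2 * G \<le> 2000 * (\<Sum>n\<in>A. (conj_laplacian e (\<lambda>x. \<tau> * weight a x) f n)\<^sup>2)"
      using main G1 N1 by (simp add: algebra_simps)
    then show "\<tau> ^ 3 * h ^ 4 * (\<Sum>n\<in>lattice_ball h 3. (f n)\<^sup>2)
        + \<tau> * h\<^sup>2 * (\<Sum>n\<in>lattice_ball h 3. \<Sum>j\<in>UNIV. (f (n + h *\<^sub>R axis j 1) - f n)\<^sup>2)
      \<le> 2000 * (\<Sum>n\<in>lattice_ball h 3. (conj_laplacian (\<lambda>j. h *\<^sub>R axis j 1) (\<lambda>x. \<tau> * weight (8/5 * \<rho>) x) f n)\<^sup>2)"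
      unfolding N_def G_def A_def e_def a_def .
  qed
qed

section \<open>Cutoff functions and the Caccioppoli inequality\<close>

lemma sum_le_shifted_sum:
  fixes g :: "'a::ab_group_add \<Rightarrow> real"
  assumes A: "finite A" and B: "finite B"
    and le: "\<And>n. n \<in> A \<Longrightarrow> n + v \<in> B \<Longrightarrow> F n \<le> g (n + v)"
    and 0: "\<And>n. n \<in> A \<Longrightarrow> n + v \<notin> B \<Longrightarrow> F n \<le> 0"
    and g: "\<And>n. n \<in> B \<Longrightarrow> 0 \<le> g n"
  shows "sum F A \<le> sum g B"
proof -
  let ?A = "{n \<in> A. n + v \<in> B}"
  have "sum F A \<le> (\<Sum>n\<in>A. if n + v \<in> B then g (n + v) else 0)"
    using le 0 by (intro sum_mono) auto
  also have "\<dots> = (\<Sum>n\<in>?A. g (n + v))"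
    using A by (simp add: sum.If_cases Int_def)
  also have "\<dots> = sum g ((\<lambda>n. n + v) ` ?A)"
    by (subst sum.reindex) (auto simp: inj_on_def)
  also have "\<dots> \<le> sum g B"
    using g by (intro sum_mono2 B) auto
  finally show ?thesis .
qed

lemma lattice_axis_iff:
  fixes n :: "real ^ 'd"
  shows "n + h *\<^sub>R axis j 1 \<in> lattice h \<longleftrightarrow> n \<in> lattice h" "n - h *\<^sub>R axis j 1 \<in> lattice h \<longleftrightarrow> n \<in> lattice h"
  by (metis add_diff_cancel lattice_add_axis(1,2)) (metis diff_add_cancel lattice_add_axis(1,2))

text \<open>A C^2 bound expressed by differences and uniform in the step, so that a C^1 spline with
  Lipschitz derivative qualifies and one cutoff serves every \<open>h\<close>.\<close>

definition slowly_varying :: "real \<Rightarrow> (real ^ 'd \<Rightarrow> real) \<Rightarrow> bool" where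
  "slowly_varying K \<zeta> \<longleftrightarrow> (\<forall>x. norm x \<le> 3 \<longrightarrow> \<bar>\<zeta> x\<bar> \<le> K \<and> (\<forall>h j. 0 < h \<longrightarrow> h \<le> 1 \<longrightarrow>
      \<bar>\<zeta> (x + h *\<^sub>R axis j 1) - \<zeta> x\<bar> \<le> K * h \<and> \<bar>\<zeta> (x - h *\<^sub>R axis j 1) - \<zeta> x\<bar> \<le> K * h \<and>
      \<bar>\<zeta> (x + h *\<^sub>R axis j 1) + \<zeta> (x - h *\<^sub>R axis j 1) - 2 * \<zeta> x\<bar> \<le> K * h\<^sup>2))"

lemma slowly_varyingD:
  assumes "slowly_varying K \<zeta>" "norm x \<le> 3"
  shows "\<bar>\<zeta> x\<bar> \<le> K"
    and "0 < h \<Longrightarrow> h \<le> 1 \<Longrightarrow> \<bar>\<zeta> (x + h *\<^sub>R axis j 1) - \<zeta> x\<bar> \<le> K * h"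
    and "0 < h \<Longrightarrow> h \<le> 1 \<Longrightarrow> \<bar>\<zeta> (x - h *\<^sub>R axis j 1) - \<zeta> x\<bar> \<le> K * h"
    and "0 < h \<Longrightarrow> h \<le> 1 \<Longrightarrow> \<bar>\<zeta> (x + h *\<^sub>R axis j 1) + \<zeta> (x - h *\<^sub>R axis j 1) - 2 * \<zeta> x\<bar> \<le> K * h\<^sup>2"
  using assms unfolding slowly_varying_def by simp_all

lemma slowly_varying_add:
  assumes "slowly_varying K \<zeta>" "slowly_varying L \<eta>"
  shows "slowly_varying (K + L) (\<lambda>x. \<zeta> x + \<eta> x)"
  unfolding slowly_varying_def
proof (intro allI impI conjI)
  have add: "\<bar>a' + b' - (a + b)\<bar> \<le> (s + t) * k" if "\<bar>a' - a\<bar> \<le> s * k" "\<bar>b' - b\<bar> \<le> t * k" for a' b' a b s t k :: real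
    unfolding distrib_right using that by linarith
  fix x :: "real ^ 'a" and h :: real and j :: 'a
  assume x: "norm x \<le> 3"
  note a = slowly_varyingD[OF assms(1) x] slowly_varyingD[OF assms(2) x]
  show "\<bar>\<zeta> x + \<eta> x\<bar> \<le> K + L" using a(1,5) by linarith
  assume h: "0 < h" "h \<le> 1"
  show "\<bar>\<zeta> (x + h *\<^sub>R axis j 1) + \<eta> (x + h *\<^sub>R axis j 1) - (\<zeta> x + \<eta> x)\<bar> \<le> (K + L) * h"
    by (rule add[OF a(2)[OF h] a(6)[OF h]])
  show "\<bar>\<zeta> (x - h *\<^sub>R axis j 1) + \<eta> (x - h *\<^sub>R axis j 1) - (\<zeta> x + \<eta> x)\<bar> \<le> (K + L) * h"
    by (rule add[OF a(3)[OF h] a(7)[OF h]])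
  have "\<bar>(\<zeta> (x + h *\<^sub>R axis j 1) + \<zeta> (x - h *\<^sub>R axis j 1)) + (\<eta> (x + h *\<^sub>R axis j 1) + \<eta> (x - h *\<^sub>R axis j 1))
      - (2 * \<zeta> x + 2 * \<eta> x)\<bar> \<le> (K + L) * h\<^sup>2"
    by (rule add[OF a(4)[OF h] a(8)[OF h]])
  then show "\<bar>\<zeta> (x + h *\<^sub>R axis j 1) + \<eta> (x + h *\<^sub>R axis j 1) + (\<zeta> (x - h *\<^sub>R axis j 1) + \<eta> (x - h *\<^sub>R axis j 1))
      - 2 * (\<zeta> x + \<eta> x)\<bar> \<le> (K + L) * h\<^sup>2"
    by (simp only: add.assoc add.left_commute distrib_left)
qed

lemma slowly_varying_cmult:
  assumes "slowly_varying K \<zeta>"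
  shows "slowly_varying (\<bar>c\<bar> * K) (\<lambda>x. c * \<zeta> x)"
  unfolding slowly_varying_def
proof (intro allI impI conjI)
  fix x :: "real ^ 'a" and h :: real and j :: 'a
  assume x: "norm x \<le> 3"
  note a = slowly_varyingD[OF assms x]
  show "\<bar>c * \<zeta> x\<bar> \<le> \<bar>c\<bar> * K" using a(1) by (simp add: abs_mult mult_left_mono)
  assume h: "0 < h" "h \<le> 1"
  note b = a(2-4)[OF h, THEN mult_left_mono, of "\<bar>c\<bar>", unfolded abs_mult[symmetric]]
  show "\<bar>c * \<zeta> (x + h *\<^sub>R axis j 1) - c * \<zeta> x\<bar> \<le> \<bar>c\<bar> * K * h"
    "\<bar>c * \<zeta> (x - h *\<^sub>R axis j 1) - c * \<zeta> x\<bar> \<le> \<bar>c\<bar> * K * h"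
    "\<bar>c * \<zeta> (x + h *\<^sub>R axis j 1) + c * \<zeta> (x - h *\<^sub>R axis j 1) - 2 * (c * \<zeta> x)\<bar> \<le> \<bar>c\<bar> * K * h\<^sup>2"
    using b by (simp_all add: algebra_simps)
qed

text \<open>The squared positive part has the derivative \<open>2 * max 0 t\<close>, which is
  Lipschitz with constant 2; this is its first-order Taylor bound across the kink of the
  derivative.\<close>

lemma positive_part_square_expansion:
  fixes t x :: real
  shows "\<bar>(max 0 (t + x))\<^sup>2 - (max 0 t)\<^sup>2 - 2 * max 0 t * x\<bar> \<le> x\<^sup>2"
proof -
  consider "0 \<le> t" "0 \<le> t + x" | "0 \<le> t" "t + x < 0" | "t < 0" "0 \<le> t + x" | "t < 0" "t + x < 0"
    by linarith
  then show ?thesis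
  proof cases
    case 2
    then have "t * (- x) \<le> x * x" "t * t \<le> t * (- x)" "0 \<le> t * t"
      using mult_right_mono[of t "- x" "- x"] mult_left_mono[of t "- x" t] by auto
    moreover have "0 \<le> (t + x) * (t + x)" by simp
    then have "- (t * t) - t * (x * 2) \<le> x * x" by (simp add: algebra_simps)
    ultimately have "\<bar>- (t * t) - t * (x * 2)\<bar> \<le> x * x"
      using zero_le_square[of x] zero_le_square[of t] unfolding abs_le_iff by (intro conjI) linarith+
    then show ?thesis using 2 by (simp add: max_def power2_eq_square algebra_simps)
  next
    case 3
    then have "(t + x)\<^sup>2 \<le> x\<^sup>2" by (intro power_mono) auto
    then show ?thesis using 3 by (simp add: max_def)
  qed (auto simp: max_def power2_eq_square algebra_simps)
qed

text \<open>The increments of \<open>x \<bullet> x\<close> towards two opposite neighbours are of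
  order \<open>h\<close>, but their sum is only twice the square of \<open>h\<close>. Hence the
  linear terms of the expansion nearly cancel in the second difference.\<close>

lemma slowly_varying_positive_part_square:
  assumes "\<bar>\<kappa>\<bar> \<le> 10"
  shows "slowly_varying 1000 (\<lambda>x :: real ^ 'd. (max 0 (x \<bullet> x - \<kappa>))\<^sup>2)"
  unfolding slowly_varying_def
proof (intro allI impI conjI)
  fix x :: "real ^ 'd" and h :: real and j :: 'd
  assume x: "norm x \<le> 3"
  define t where "t = x \<bullet> x - \<kappa>"
  have s: "0 \<le> x \<bullet> x" "x \<bullet> x \<le> 9"
    using power_mono[OF x, of 2] by (auto simp: power2_norm_eq_inner)
  have m: "0 \<le> max 0 t" "max 0 t \<le> 19" using s assms by (auto simp: t_def)
  then have "(max 0 t)\<^sup>2 \<le> 19\<^sup>2" by (intro power_mono) auto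
  then show "\<bar>(max 0 (x \<bullet> x - \<kappa>))\<^sup>2\<bar> \<le> 1000" by (simp add: t_def)
  assume h: "0 < h" "h \<le> 1"
  have X: "\<bar>x $ j\<bar> \<le> 3" using component_le_norm_cart[of x j] x by simp
  define a b where "a = 2 * h * x $ j + h\<^sup>2" and "b = - 2 * h * x $ j + h\<^sup>2"
  have "\<bar>2 * x $ j + h\<bar> \<le> 7" "\<bar>- 2 * x $ j + h\<bar> \<le> 7" using X h by auto
  moreover have "a = h * (2 * x $ j + h)" "b = h * (- 2 * x $ j + h)"
    by (simp_all add: a_def b_def power2_eq_square algebra_simps)
  ultimately have ab: "\<bar>a\<bar> \<le> 7 * h" "\<bar>b\<bar> \<le> 7 * h"
    using h by (simp_all add: abs_mult mult.commute)
  have h2: "h\<^sup>2 \<le> h" using h by (simp add: power2_eq_square)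
  have ab2: "a\<^sup>2 \<le> 49 * h\<^sup>2" "b\<^sup>2 \<le> 49 * h\<^sup>2"
    using power_mono[OF ab(1), of 2] power_mono[OF ab(2), of 2] by (simp_all add: power_mult_distrib)
  have ma: "\<bar>2 * max 0 t * a\<bar> \<le> 266 * h" "\<bar>2 * max 0 t * b\<bar> \<le> 266 * h"
    using m ab mult_mono[of "max 0 t" 19 "\<bar>a\<bar>" "7 * h"] mult_mono[of "max 0 t" 19 "\<bar>b\<bar>" "7 * h"]
    by (simp_all add: abs_mult mult.commute)
  have mab: "\<bar>2 * max 0 t * a + 2 * max 0 t * b\<bar> \<le> 76 * h\<^sup>2"
  proof -
    have "2 * max 0 t * a + 2 * max 0 t * b = 4 * max 0 t * h\<^sup>2" by (simp add: a_def b_def algebra_simps)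
    then show ?thesis using m mult_right_mono[of "max 0 t" 19 "h\<^sup>2"] by (simp add: abs_mult)
  qed
  have e: "(x + h *\<^sub>R axis j 1) \<bullet> (x + h *\<^sub>R axis j 1) - \<kappa> = t + a"
    "(x - h *\<^sub>R axis j 1) \<bullet> (x - h *\<^sub>R axis j 1) - \<kappa> = t + b"
    unfolding inner_add_axis t_def a_def b_def by simp_all
  define m where "m = max 0 t"
  define p where "p z = (max 0 (z :: real))\<^sup>2" for z
  have E': "\<bar>p (t + a) - p t - 2 * m * a\<bar> \<le> a\<^sup>2" "\<bar>p (t + b) - p t - 2 * m * b\<bar> \<le> b\<^sup>2"
    unfolding p_def m_def by (rule positive_part_square_expansion)+
  show "\<bar>(max 0 ((x + h *\<^sub>R axis j 1) \<bullet> (x + h *\<^sub>R axis j 1) - \<kappa>))\<^sup>2 - (max 0 (x \<bullet> x - \<kappa>))\<^sup>2\<bar> \<le> 1000 * h"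
    unfolding e t_def[symmetric] p_def[symmetric] using E'(1) ma(1)[folded m_def] ab2(1) h2 by linarith
  show "\<bar>(max 0 ((x - h *\<^sub>R axis j 1) \<bullet> (x - h *\<^sub>R axis j 1) - \<kappa>))\<^sup>2 - (max 0 (x \<bullet> x - \<kappa>))\<^sup>2\<bar> \<le> 1000 * h"
    unfolding e t_def[symmetric] p_def[symmetric] using E'(2) ma(2)[folded m_def] ab2(2) h2 by linarith
  show "\<bar>(max 0 ((x + h *\<^sub>R axis j 1) \<bullet> (x + h *\<^sub>R axis j 1) - \<kappa>))\<^sup>2
        + (max 0 ((x - h *\<^sub>R axis j 1) \<bullet> (x - h *\<^sub>R axis j 1) - \<kappa>))\<^sup>2 - 2 * (max 0 (x \<bullet> x - \<kappa>))\<^sup>2\<bar> \<le> 1000 * h\<^sup>2"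
    unfolding e t_def[symmetric] p_def[symmetric] using E' mab[folded m_def] ab2 zero_le_power2[of h] by linarith
qed

text \<open>A quadratic spline in \<open>x \<bullet> x\<close>: its first and second differences are \<open>O(h)\<close> and \<open>O(h\<^sup>2)\<close>.\<close>

lemma cutoff_exists:
  fixes \<alpha> \<alpha>' \<beta> \<beta>' :: real
  assumes "- 10 \<le> \<alpha>" "\<alpha> < \<alpha>'" "\<alpha>' \<le> \<beta>" "\<beta> < \<beta>'" "\<beta>' \<le> 10"
  obtains \<zeta> :: "real ^ 'd \<Rightarrow> real" and K where "slowly_varying K \<zeta>"
    and "\<And>x. \<alpha>' \<le> x \<bullet> x \<Longrightarrow> x \<bullet> x \<le> \<beta> \<Longrightarrow> \<zeta> x = 1"
    and "\<And>x. x \<bullet> x \<le> \<alpha> \<or> \<beta>' \<le> x \<bullet> x \<Longrightarrow> \<zeta> x = 0"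
proof -
  define P where "P \<kappa> x = (max 0 (x \<bullet> x - \<kappa>))\<^sup>2" for \<kappa> and x :: "real ^ 'd"
  \<comment> \<open>A second difference, in the knot, of truncated squares. Beyond \<open>b\<close>
    the quadratic and linear parts cancel and a constant is left, which the prefactor normalises to
    1.\<close>
  define step where "step a b x = 2 / (b - a)\<^sup>2 * (P a x + - 2 * P ((a + b) / 2) x + P b x)" for a b and x :: "real ^ 'd"
  have step_slow: "\<exists>K. slowly_varying K (step a b)" if "- 10 \<le> a" "a < b" "b \<le> 10" for a b
  proof -
    have "slowly_varying 1000 (P a)" "slowly_varying 1000 (P ((a + b) / 2))" "slowly_varying 1000 (P b)"
      unfolding P_def[abs_def] using that by (auto intro!: slowly_varying_positive_part_square)
    note slowly_varying_cmult[OF slowly_varying_add[OF slowly_varying_add[OF this(1) slowly_varying_cmult[OF this(2)]] this(3)]]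
    then show ?thesis
      unfolding step_def[abs_def] by blast
  qed
  have step0: "step a b x = 0" if "x \<bullet> x \<le> a" "a < b" for a b x
    using that by (simp add: step_def P_def max_def)
  have step1: "step a b x = 1" if "b \<le> x \<bullet> x" "a < b" for a b x
  proof -
    have "P a x + - 2 * P ((a + b) / 2) x + P b x = (b - a)\<^sup>2 / 2"
      using that by (simp add: P_def max_def field_simps power2_eq_square)
    then show ?thesis using that by (simp add: step_def)
  qed
  obtain K L where "slowly_varying K (step \<alpha> \<alpha>')" "slowly_varying L (step \<beta> \<beta>')"
    using step_slow[of \<alpha> \<alpha>'] step_slow[of \<beta> \<beta>'] assms by auto
  then have "slowly_varying (K + \<bar>- 1\<bar> * L) (\<lambda>x. step \<alpha> \<alpha>' x + - 1 * step \<beta> \<beta>' x)"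
    by (intro slowly_varying_add slowly_varying_cmult)
  then show thesis
    by (rule that) (use assms step0 step1 in auto)
qed

section \<open>The Caccioppoli inequality\<close>

context padded_support begin

lemma sum_by_parts:
  "(\<Sum>n\<in>A. (f (n + e j) - f n) * (u (n + e j) - u n)) = - (\<Sum>n\<in>A. f n * (u (n + e j) + u (n - e j) - 2 * u n))"
proof -
  let ?F = "\<lambda>n. f n * (u n - u (n - e j))"
  have "(\<Sum>n\<in>A. ?F (n + e j)) = (\<Sum>n\<in>A. ?F n)"
    by (rule sum_shift) (auto intro: finite_A padding)
  then have "(\<Sum>n\<in>A. (f (n + e j) - f n) * (u (n + e j) - u n)) = (\<Sum>n\<in>A. ?F n) - (\<Sum>n\<in>A. f n * (u (n + e j) - u n))"
    by (simp add: left_diff_distrib sum_subtractf)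
  also have "\<dots> = - (\<Sum>n\<in>A. f n * (u (n + e j) + u (n - e j) - 2 * u n))"
    unfolding sum_subtractf[symmetric] sum_negf[symmetric]
    by (intro sum.cong refl) (simp add: algebra_simps)
  finally show ?thesis .
qed

end

text \<open>The lower-order terms only enter through their size. Solutions are set to \<open>0\<close> off the lattice so that finite sums
  over lattice points can be translated freely.\<close>

definition almost_solution :: "real \<Rightarrow> real \<Rightarrow> real \<Rightarrow> (real ^ 'd \<Rightarrow> real) \<Rightarrow> bool" where
  "almost_solution M h r u \<longleftrightarrow> (\<forall>n. n \<notin> lattice h \<longrightarrow> u n = 0) \<and>
     (\<forall>n\<in>lattice_ball h r. \<bar>disc_laplacian h u n\<bar> \<le>
        M * h * (\<Sum>j\<in>UNIV. \<bar>u (n + h *\<^sub>R axis j 1) - u n\<bar>) + M * h\<^sup>2 * \<bar>u n\<bar>)"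

lemma norm_less_of_inner_less:
  fixes x :: "real ^ 'd"
  assumes "x \<bullet> x < r\<^sup>2" "0 \<le> r" shows "norm x < r"
  using assms by (metis power2_norm_eq_inner power_less_imp_less_base)

lemma inner_le_of_norm_le:
  fixes x :: "real ^ 'd"
  assumes "norm x \<le> r" shows "x \<bullet> x \<le> r\<^sup>2"
  using power_mono[OF assms, of 2] by (simp add: power2_norm_eq_inner)

text \<open>The classical argument: the difference inequality is tested with \<zeta> squared times
  \<open>u\<close>, where \<zeta> is 1 on the smaller ball and one step beyond. Each difference of
  \<zeta> gives a factor \<open>h\<close>, whence the square of \<open>h\<close> on the
  right.\<close>

lemma caccioppoli:
  fixes R R' M :: real
  assumes R: "0 < R" "R < R'" "R' \<le> 2" and M: "0 \<le> M"
  obtains C where "0 \<le> C" and "\<And>h (u :: real ^ 'd \<Rightarrow> real). 0 < h \<Longrightarrow> h \<le> (R' - R) / 4 \<Longrightarrow> almost_solution M h R' u \<Longrightarrow>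
      (\<Sum>n\<in>lattice_ball h R. \<Sum>j\<in>UNIV. (u (n + h *\<^sub>R axis j 1) - u n)\<^sup>2)
        \<le> C * h\<^sup>2 * (\<Sum>n\<in>lattice_ball h R'. (u n)\<^sup>2)"
proof -
  define \<delta> where "\<delta> = (R' - R) / 4"
  have \<delta>: "0 < \<delta>" "R + 4 * \<delta> = R'" "\<delta> \<le> 1/2" using R by (simp_all add: \<delta>_def field_simps)
  have "(R + 3 * \<delta>)\<^sup>2 \<le> 4" using R \<delta> power_mono[of "R + 3 * \<delta>" 2 2] by simp
  moreover have "(R + 2 * \<delta>)\<^sup>2 < (R + 3 * \<delta>)\<^sup>2" using R \<delta> by (intro power_strict_mono) auto
  \<comment> \<open>Negative inner thresholds switch off the inner transition of the cutoff, since
    \<open>x \<bullet> x\<close> is never negative: the plateau is a full ball.\<close>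
  ultimately have ab: "- 10 \<le> (- 2 :: real)" "- 2 < (- 1 :: real)" "- 1 \<le> (R + 2 * \<delta>)\<^sup>2"
    "(R + 2 * \<delta>)\<^sup>2 < (R + 3 * \<delta>)\<^sup>2" "(R + 3 * \<delta>)\<^sup>2 \<le> 10"
    using zero_le_power2[of "R + 2 * \<delta>"] by linarith+
  obtain \<zeta> :: "real ^ 'd \<Rightarrow> real" and K where slow: "slowly_varying K \<zeta>"
    and one: "\<And>x. - 1 \<le> x \<bullet> x \<Longrightarrow> x \<bullet> x \<le> (R + 2 * \<delta>)\<^sup>2 \<Longrightarrow> \<zeta> x = 1"
    and zero: "\<And>x. x \<bullet> x \<le> - 2 \<or> (R + 3 * \<delta>)\<^sup>2 \<le> x \<bullet> x \<Longrightarrow> \<zeta> x = 0"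
    by (rule cutoff_exists[OF ab]) (rule that)
  define d where "d = real CARD('d)"
  define C where "C = K\<^sup>2 * (3 * d + 2 * d * M\<^sup>2 + 2 * M)"
  have C0: "0 \<le> C" using M by (simp add: C_def d_def)
  have zeta0: "\<zeta> x = 0" if "R + 3 * \<delta> \<le> norm x" for x
    using that R \<delta> power_mono[OF that, of 2] by (intro zero) (simp add: power2_norm_eq_inner)
  have zeta1: "\<zeta> x = 1" if "norm x \<le> R + 2 * \<delta>" for x
    using inner_le_of_norm_le[OF that] inner_ge_zero[of x] by (intro one) linarith+
  show thesis
  proof (rule that[OF C0])
    fix h and u :: "real ^ 'd \<Rightarrow> real"
    assume h: "0 < h" "h \<le> (R' - R) / 4" and sol: "almost_solution M h R' u"
    have h\<delta>: "h \<le> \<delta>" "h \<le> 1" using h \<delta> by (simp_all add: \<delta>_def)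
    define e :: "'d \<Rightarrow> real ^ 'd" where "e = (\<lambda>j. h *\<^sub>R axis j 1)"
    define A :: "(real ^ 'd) set" where "A = lattice_ball h 3"
    define B :: "(real ^ 'd) set" where "B = lattice_ball h R'"
    define P where "P = (\<Sum>n\<in>B. (u n)\<^sup>2)"
    define f where "f n = \<zeta> n * u n" for n
    define v where "v n = \<zeta> n * f n" for n
    define c where "c j n = \<zeta> (n + e j) - \<zeta> n" for j n
    have off: "u n = 0" if "n \<notin> lattice h" for n using sol that by (auto simp: almost_solution_def)
    have finA: "finite A" and finB: "finite B" using h by (simp_all add: A_def B_def finite_lattice_ball)
    have A3: "norm n \<le> 3" if "n \<in> A" for n using that by (simp add: A_def lattice_ball_def)
    have normE: "norm (n + e j) \<le> norm n + h" "norm n \<le> norm (n + e j) + h" for n j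
      using norm_add_axis_le[of h n j] norm_add_axis_le(2)[of h "n + e j" j] h by (simp_all add: e_def)
    have BA: "n \<in> B" if "n \<in> lattice h" "\<zeta> n \<noteq> 0" for n
    proof -
      have "norm n < R + 3 * \<delta>" using zeta0[of n] that by force
      then show ?thesis using that \<delta> by (simp add: B_def lattice_ball_def)
    qed
    have cB: "n \<in> B \<and> n + e j \<in> B" if "n \<in> lattice h" "c j n \<noteq> 0" for n j
    proof -
      have "\<zeta> n \<noteq> 0 \<or> \<zeta> (n + e j) \<noteq> 0" using that by (auto simp: c_def)
      then have "norm n < R + 3 * \<delta> \<or> norm (n + e j) < R + 3 * \<delta>" using zeta0 by force
      then have "norm n < R' \<and> norm (n + e j) < R'" using normE[of n j] h\<delta> \<delta> by auto
      then show ?thesis using that by (auto simp: B_def lattice_ball_def e_def lattice_axis_iff)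
    qed
    have c: "(c j n)\<^sup>2 \<le> K\<^sup>2 * h\<^sup>2" if "n \<in> A" for j n
    proof -
      have "\<bar>c j n\<bar> \<le> K * h" using slowly_varyingD(2)[OF slow A3[OF that] h(1) h\<delta>(2)] by (simp add: c_def e_def)
      then show ?thesis using power_mono[of "\<bar>c j n\<bar>" "K * h" 2] by (simp add: power_mult_distrib)
    qed
    interpret padded_support e A v
      unfolding e_def A_def
    proof (rule padded_support_lattice_ball[OF h(1)])
      fix n assume "v n \<noteq> 0"
      then have "\<zeta> n \<noteq> 0" "n \<in> lattice h" using off by (auto simp: v_def f_def)
      then show "n \<in> lattice h \<and> norm n + 2 * h < 3"
        using zeta0[of n] h\<delta> \<delta> R by force
    qed
    define G where "G = (\<Sum>n\<in>A. \<Sum>j\<in>UNIV. (f (n + e j) - f n)\<^sup>2)"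
    have G_eq: "G = - (\<Sum>n\<in>A. v n * disc_laplacian h u n) + (\<Sum>n\<in>A. \<Sum>j\<in>UNIV. (c j n)\<^sup>2 * (u n * u (n + e j)))"
    proof -
      \<comment> \<open>An exact discrete product rule: the cross terms of the continuous
        computation are absorbed in the mixed product of \<open>u\<close> at the two ends of the
        edge.\<close>
      have "(f (n + e j) - f n)\<^sup>2 = (v (n + e j) - v n) * (u (n + e j) - u n) + (c j n)\<^sup>2 * (u n * u (n + e j))" for n j
        by (simp add: f_def v_def c_def power2_eq_square algebra_simps)
      then have "G = (\<Sum>n\<in>A. \<Sum>j\<in>UNIV. (v (n + e j) - v n) * (u (n + e j) - u n)) + (\<Sum>n\<in>A. \<Sum>j\<in>UNIV. (c j n)\<^sup>2 * (u n * u (n + e j)))"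
        by (simp only: G_def sum.distrib)
      also have "(\<Sum>n\<in>A. \<Sum>j\<in>UNIV. (v (n + e j) - v n) * (u (n + e j) - u n)) = - (\<Sum>n\<in>A. v n * disc_laplacian h u n)"
      proof -
        have "(\<Sum>n\<in>A. \<Sum>j\<in>UNIV. (v (n + e j) - v n) * (u (n + e j) - u n)) = (\<Sum>j\<in>UNIV. - (\<Sum>n\<in>A. v n * (u (n + e j) + u (n - e j) - 2 * u n)))"
          by (subst sum.swap) (simp only: sum_by_parts)
        also have "\<dots> = - (\<Sum>n\<in>A. v n * disc_laplacian h u n)"
          unfolding disc_laplacian_eq sum_distrib_left e_def sum_negf by (subst sum.swap) simp
        finally show ?thesis .
      qed
      finally show ?thesis .
    qed
    \<comment> \<open>The first-order term is split so that the gradient of \<open>f\<close> returns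
      with coefficient 1/2 and can be absorbed into \<open>G\<close>.\<close>
    have lap: "- (v n * disc_laplacian h u n) \<le> (\<Sum>j\<in>UNIV. (f (n + e j) - f n)\<^sup>2 / 2 + (c j n)\<^sup>2 * (u (n + e j))\<^sup>2 / 2) + (d * M\<^sup>2 + M) * h\<^sup>2 * (f n)\<^sup>2"
      if n: "n \<in> A" for n
    proof (cases "\<zeta> n = 0")
      case True
      then show ?thesis by (simp add: v_def f_def sum_nonneg)
    next
      case False
      then have "n \<in> B" using BA n by (auto simp: A_def lattice_ball_def)
      then have L: "\<bar>disc_laplacian h u n\<bar> \<le> M * h * (\<Sum>j\<in>UNIV. \<bar>u (n + e j) - u n\<bar>) + M * h\<^sup>2 * \<bar>u n\<bar>"
        using sol by (auto simp: almost_solution_def B_def e_def)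
      have "- (v n * disc_laplacian h u n) \<le> \<bar>v n\<bar> * \<bar>disc_laplacian h u n\<bar>"
        by (metis abs_ge_minus_self abs_mult)
      also have "\<dots> \<le> \<bar>v n\<bar> * (M * h * (\<Sum>j\<in>UNIV. \<bar>u (n + e j) - u n\<bar>) + M * h\<^sup>2 * \<bar>u n\<bar>)"
        by (intro mult_left_mono L) auto
      also have "\<dots> = (\<Sum>j\<in>UNIV. M * h * \<bar>f n\<bar> * \<bar>\<zeta> n * (u (n + e j) - u n)\<bar>) + M * h\<^sup>2 * (f n)\<^sup>2"
        by (simp add: v_def f_def sum_distrib_left abs_mult distrib_left mult_ac power2_eq_square)
      also have "\<dots> \<le> (\<Sum>j\<in>UNIV. (f (n + e j) - f n)\<^sup>2 / 2 + (c j n)\<^sup>2 * (u (n + e j))\<^sup>2 / 2 + M\<^sup>2 * h\<^sup>2 * (f n)\<^sup>2) + M * h\<^sup>2 * (f n)\<^sup>2"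
      proof (intro add_right_mono sum_mono)
        fix j
        have "\<zeta> n * (u (n + e j) - u n) = (f (n + e j) - f n) - c j n * u (n + e j)"
          by (simp add: f_def c_def algebra_simps)
        then have "M * h * \<bar>f n\<bar> * \<bar>\<zeta> n * (u (n + e j) - u n)\<bar> \<le> M * h * \<bar>f n\<bar> * (\<bar>f (n + e j) - f n\<bar> + \<bar>c j n * u (n + e j)\<bar>)"
          using M h by (intro mult_left_mono) (auto simp: abs_triangle_ineq4)
        also have "\<dots> = \<bar>M * h * f n\<bar> * \<bar>f (n + e j) - f n\<bar> + \<bar>M * h * f n\<bar> * \<bar>c j n * u (n + e j)\<bar>"
          using M h by (simp add: abs_mult algebra_simps)
        also have "\<dots> \<le> ((M * h * f n)\<^sup>2 / 2 + (f (n + e j) - f n)\<^sup>2 / 2) + ((M * h * f n)\<^sup>2 / 2 + (c j n * u (n + e j))\<^sup>2 / 2)"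
          by (intro add_mono abs_mult_le_half_squares)
        also have "\<dots> = (f (n + e j) - f n)\<^sup>2 / 2 + (c j n)\<^sup>2 * (u (n + e j))\<^sup>2 / 2 + M\<^sup>2 * h\<^sup>2 * (f n)\<^sup>2"
          by (simp add: power_mult_distrib)
        finally show "M * h * \<bar>f n\<bar> * \<bar>\<zeta> n * (u (n + e j) - u n)\<bar> \<le> \<dots>" .
      qed
      also have "\<dots> = (\<Sum>j\<in>UNIV. (f (n + e j) - f n)\<^sup>2 / 2 + (c j n)\<^sup>2 * (u (n + e j))\<^sup>2 / 2) + (d * M\<^sup>2 + M) * h\<^sup>2 * (f n)\<^sup>2"
        by (simp add: sum.distrib d_def algebra_simps)
      finally show ?thesis .
    qed
    have cross: "(c j n)\<^sup>2 * (u n * u (n + e j)) \<le> (c j n)\<^sup>2 * (u n)\<^sup>2 / 2 + (c j n)\<^sup>2 * (u (n + e j))\<^sup>2 / 2" for j n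
    proof -
      have "u n * u (n + e j) \<le> (u n)\<^sup>2 / 2 + (u (n + e j))\<^sup>2 / 2"
        using abs_mult_le_half_squares[of "u n" "u (n + e j)"] abs_ge_self[of "u n * u (n + e j)"]
        unfolding abs_mult by linarith
      from mult_left_mono[OF this, of "(c j n)\<^sup>2"] show ?thesis by (simp add: algebra_simps)
    qed
    have S1: "(\<Sum>n\<in>A. (c j n)\<^sup>2 * (u (n + e j))\<^sup>2) \<le> K\<^sup>2 * h\<^sup>2 * P" for j
      unfolding P_def sum_distrib_left
    proof (rule sum_le_shifted_sum[OF finA finB])
      fix n assume n: "n \<in> A"
      show "(c j n)\<^sup>2 * (u (n + e j))\<^sup>2 \<le> K\<^sup>2 * h\<^sup>2 * (u (n + e j))\<^sup>2"
        using c[OF n] by (intro mult_right_mono) auto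
      show "(c j n)\<^sup>2 * (u (n + e j))\<^sup>2 \<le> 0" if "n + e j \<notin> B"
      proof -
        have "c j n = 0" using cB[of n j] that n by (auto simp: A_def lattice_ball_def)
        then show ?thesis by simp
      qed
    qed simp
    have S2: "(\<Sum>n\<in>A. (c j n)\<^sup>2 * (u n)\<^sup>2) \<le> K\<^sup>2 * h\<^sup>2 * P" for j
      unfolding P_def sum_distrib_left
    proof (rule sum_le_shifted_sum[OF finA finB, of 0])
      fix n assume n: "n \<in> A"
      show "(c j n)\<^sup>2 * (u n)\<^sup>2 \<le> K\<^sup>2 * h\<^sup>2 * (u (n + 0))\<^sup>2"
        unfolding add_0_right using c[OF n] by (intro mult_right_mono) auto
      show "(c j n)\<^sup>2 * (u n)\<^sup>2 \<le> 0" if "n + 0 \<notin> B"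
      proof -
        have "c j n = 0" using cB[of n j] that n by (auto simp: A_def lattice_ball_def)
        then show ?thesis by simp
      qed
    qed simp
    have S1': "(\<Sum>n\<in>A. \<Sum>j\<in>UNIV. (c j n)\<^sup>2 * (u (n + e j))\<^sup>2) \<le> d * (K\<^sup>2 * h\<^sup>2 * P)"
      by (subst sum.swap, unfold d_def, rule sum_bounded_above, rule S1)
    have S2': "(\<Sum>n\<in>A. \<Sum>j\<in>UNIV. (c j n)\<^sup>2 * (u n)\<^sup>2) \<le> d * (K\<^sup>2 * h\<^sup>2 * P)"
      by (subst sum.swap, unfold d_def, rule sum_bounded_above, rule S2)
    have S3: "(\<Sum>n\<in>A. (f n)\<^sup>2) \<le> K\<^sup>2 * P"
      unfolding P_def sum_distrib_left
    proof (rule sum_le_shifted_sum[OF finA finB, of 0])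
      fix n assume n: "n \<in> A"
      have "\<bar>\<zeta> n\<bar> \<le> K" by (rule slowly_varyingD(1)[OF slow A3[OF n]])
      then have "(\<zeta> n)\<^sup>2 \<le> K\<^sup>2" using power_mono[of "\<bar>\<zeta> n\<bar>" K 2] by simp
      then show "(f n)\<^sup>2 \<le> K\<^sup>2 * (u (n + 0))\<^sup>2"
        unfolding f_def power_mult_distrib add_0_right by (intro mult_right_mono) auto
      show "(f n)\<^sup>2 \<le> 0" if "n + 0 \<notin> B"
      proof -
        have "\<zeta> n = 0" using BA[of n] that n by (auto simp: A_def lattice_ball_def)
        then show ?thesis by (simp add: f_def)
      qed
    qed simp
    have "G \<le> (\<Sum>n\<in>A. (\<Sum>j\<in>UNIV. (f (n + e j) - f n)\<^sup>2 / 2 + (c j n)\<^sup>2 * (u (n + e j))\<^sup>2 / 2) + (d * M\<^sup>2 + M) * h\<^sup>2 * (f n)\<^sup>2)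
        + (\<Sum>n\<in>A. \<Sum>j\<in>UNIV. (c j n)\<^sup>2 * (u n)\<^sup>2 / 2 + (c j n)\<^sup>2 * (u (n + e j))\<^sup>2 / 2)"
      unfolding G_eq sum_negf[symmetric] by (intro add_mono sum_mono lap cross)
    also have "\<dots> = G / 2 + (d * M\<^sup>2 + M) * h\<^sup>2 * (\<Sum>n\<in>A. (f n)\<^sup>2)
        + (\<Sum>n\<in>A. \<Sum>j\<in>UNIV. (c j n)\<^sup>2 * (u (n + e j))\<^sup>2) + (\<Sum>n\<in>A. \<Sum>j\<in>UNIV. (c j n)\<^sup>2 * (u n)\<^sup>2) / 2"
      unfolding sum.distrib sum_divide_distrib[symmetric] sum_distrib_left[symmetric] G_def[symmetric] by simp
    also have "\<dots> \<le> G / 2 + (d * M\<^sup>2 + M) * h\<^sup>2 * (K\<^sup>2 * P) + d * (K\<^sup>2 * h\<^sup>2 * P) + d * (K\<^sup>2 * h\<^sup>2 * P) / 2"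
      using M by (intro add_mono mult_left_mono divide_right_mono S1' S2' S3 order_refl) (auto simp: d_def)
    finally have "G \<le> C * h\<^sup>2 * P"
      by (simp add: C_def d_def algebra_simps)
    moreover have "(\<Sum>n\<in>lattice_ball h R. \<Sum>j\<in>UNIV. (u (n + e j) - u n)\<^sup>2) \<le> G"
    proof -
      have "(\<Sum>n\<in>lattice_ball h R. \<Sum>j\<in>UNIV. (u (n + e j) - u n)\<^sup>2) = (\<Sum>n\<in>lattice_ball h R. \<Sum>j\<in>UNIV. (f (n + e j) - f n)\<^sup>2)"
      proof (intro sum.cong refl)
        fix n :: "real ^ 'd" and j assume "n \<in> lattice_ball h R"
        then have "norm n < R" by (simp add: lattice_ball_def)
        then have "norm n \<le> R + 2 * \<delta>" "norm (n + e j) \<le> R + 2 * \<delta>" using normE[of n j] h\<delta> \<delta> by auto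
        then show "(u (n + e j) - u n)\<^sup>2 = (f (n + e j) - f n)\<^sup>2" by (simp add: f_def zeta1)
      qed
      also have "\<dots> \<le> G"
        unfolding G_def using R by (intro sum_mono2 finA) (auto simp: A_def lattice_ball_def sum_nonneg)
      finally show ?thesis .
    qed
    ultimately show "(\<Sum>n\<in>lattice_ball h R. \<Sum>j\<in>UNIV. (u (n + h *\<^sub>R axis j 1) - u n)\<^sup>2)
        \<le> C * h\<^sup>2 * (\<Sum>n\<in>lattice_ball h R'. (u n)\<^sup>2)"
      unfolding e_def P_def B_def by linarith
  qed
qed

section \<open>The Carleman estimate applied to a truncated solution\<close>

text \<open>Each term of the commutator contains two powers of \<open>h\<close>, or one power and a
  difference of \<open>u\<close>; \<open>grad\<close> turns the latter into another power. The
  squares therefore sum to \<open>h ^ 4\<close> times a mass, the same power as in the Carleman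
  estimate. The factors 3 and \<open>d\<close> come from squaring sums of three and of
  \<open>d\<close> terms.\<close>

lemma sum_cutoff_commutator_square_le:
  fixes u E :: "real ^ 'd \<Rightarrow> real" and h R R' C K M :: real
  defines "e \<equiv> \<lambda>j :: 'd. h *\<^sub>R axis j (1 :: real)" and "d \<equiv> real CARD('d)"
  assumes h: "0 < h" and R: "R \<le> R'" and K: "0 \<le> K" and M: "0 \<le> M" and Z: "finite Z"
    and nbh: "\<And>n j. n \<in> Z \<Longrightarrow> n \<in> lattice_ball h R \<and> n - e j \<in> lattice_ball h R \<and> n + e j \<in> lattice_ball h R"
    and grad: "(\<Sum>n\<in>lattice_ball h R. \<Sum>j\<in>UNIV. (u (n + e j) - u n)\<^sup>2) \<le> C * h\<^sup>2 * (\<Sum>n\<in>lattice_ball h R'. (u n)\<^sup>2)"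
    and E: "\<And>n. n \<in> Z \<Longrightarrow> \<bar>E n\<bar> \<le> (\<Sum>j\<in>UNIV. K * h * \<bar>u (n + e j) - u (n - e j)\<bar> + K * h\<^sup>2 * \<bar>u (n - e j)\<bar> + M * K * h\<^sup>2 * \<bar>u (n + e j)\<bar>)"
  shows "(\<Sum>n\<in>Z. (E n)\<^sup>2) \<le> 3 * d * K\<^sup>2 * (1 + M\<^sup>2) * (4 * C + 2 * d) * h ^ 4 * (\<Sum>n\<in>lattice_ball h R'. (u n)\<^sup>2)"
proof -
  define S where "S = (\<Sum>n\<in>lattice_ball h R'. (u n)\<^sup>2)"
  define L where "L = 3 * K\<^sup>2 * (1 + M\<^sup>2)"
  have d0: "0 \<le> d" and L0: "0 \<le> L" by (auto simp: d_def L_def)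
  have fin: "finite (lattice_ball h R :: (real ^ 'd) set)" "finite (lattice_ball h R' :: (real ^ 'd) set)"
    using h by (simp_all add: finite_lattice_ball)
  have sub: "lattice_ball h R \<subseteq> (lattice_ball h R' :: (real ^ 'd) set)"
    using R by (auto simp: lattice_ball_def)
  let ?T = "\<lambda>j n. h\<^sup>2 * (2 * (u (n + e j) - u n)\<^sup>2 + 2 * (u n - u (n - e j))\<^sup>2) + h ^ 4 * ((u (n - e j))\<^sup>2 + (u (n + e j))\<^sup>2)"
  have sq3: "(x + y + z)\<^sup>2 \<le> 3 * x\<^sup>2 + 3 * y\<^sup>2 + 3 * z\<^sup>2" for x y z :: real
    using zero_le_power2[of "x - y"] zero_le_power2[of "y - z"] zero_le_power2[of "x - z"]
    by (simp add: power2_eq_square algebra_simps)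
  have sq2: "(x + y)\<^sup>2 \<le> 2 * x\<^sup>2 + 2 * y\<^sup>2" for x y :: real
    using zero_le_power2[of "x - y"] by (simp add: power2_eq_square algebra_simps)
  have pt: "(E n)\<^sup>2 \<le> d * (\<Sum>j\<in>UNIV. L * ?T j n)" if n: "n \<in> Z" for n
  proof -
    let ?x = "\<lambda>j. K * h * \<bar>u (n + e j) - u (n - e j)\<bar> + K * h\<^sup>2 * \<bar>u (n - e j)\<bar> + M * K * h\<^sup>2 * \<bar>u (n + e j)\<bar>"
    have "(E n)\<^sup>2 \<le> (\<Sum>j\<in>UNIV. ?x j)\<^sup>2"
      using power_mono[OF E[OF n], of 2] by simp
    also have "\<dots> \<le> (\<Sum>j\<in>UNIV. (?x j)\<^sup>2) * card (UNIV :: 'd set)"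
      by (rule sum_squared_le_sum_of_squares)
    also have "\<dots> = d * (\<Sum>j\<in>UNIV. (?x j)\<^sup>2)" by (simp add: d_def)
    also have "\<dots> \<le> d * (\<Sum>j\<in>UNIV. L * ?T j n)"
    proof (intro mult_left_mono sum_mono d0)
      fix j
      have "(?x j)\<^sup>2 \<le> 3 * (K * h * \<bar>u (n + e j) - u (n - e j)\<bar>)\<^sup>2 + 3 * (K * h\<^sup>2 * \<bar>u (n - e j)\<bar>)\<^sup>2 + 3 * (M * K * h\<^sup>2 * \<bar>u (n + e j)\<bar>)\<^sup>2"
        by (rule sq3)
      also have "\<dots> = 3 * K\<^sup>2 * (h\<^sup>2 * (u (n + e j) - u (n - e j))\<^sup>2 + h ^ 4 * (u (n - e j))\<^sup>2 + M\<^sup>2 * (h ^ 4 * (u (n + e j))\<^sup>2))"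
        by (simp add: power_mult_distrib algebra_simps flip: power_mult)
      also have "\<dots> \<le> 3 * K\<^sup>2 * ((1 + M\<^sup>2) * ?T j n)"
      proof (rule mult_left_mono)
        have "(u (n + e j) - u (n - e j))\<^sup>2 \<le> 2 * (u (n + e j) - u n)\<^sup>2 + 2 * (u n - u (n - e j))\<^sup>2"
          using sq2[of "u (n + e j) - u n" "u n - u (n - e j)"] by simp
        then have "h\<^sup>2 * (u (n + e j) - u (n - e j))\<^sup>2 \<le> h\<^sup>2 * (2 * (u (n + e j) - u n)\<^sup>2 + 2 * (u n - u (n - e j))\<^sup>2)"
          by (rule mult_left_mono) simp
        then have "h\<^sup>2 * (u (n + e j) - u (n - e j))\<^sup>2 + h ^ 4 * (u (n - e j))\<^sup>2 \<le> ?T j n"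
          unfolding distrib_left[of "h ^ 4"] add.assoc[symmetric] by (rule add_increasing2[OF _ add_right_mono, rotated]) simp
        moreover have "M\<^sup>2 * (h ^ 4 * (u (n + e j))\<^sup>2) \<le> M\<^sup>2 * ?T j n"
          by (rule mult_left_mono) (simp_all add: distrib_left)
        ultimately show "h\<^sup>2 * (u (n + e j) - u (n - e j))\<^sup>2 + h ^ 4 * (u (n - e j))\<^sup>2 + M\<^sup>2 * (h ^ 4 * (u (n + e j))\<^sup>2) \<le> (1 + M\<^sup>2) * ?T j n"
          unfolding distrib_right[of 1] mult_1 by (rule add_mono)
      qed simp
      finally show "(?x j)\<^sup>2 \<le> L * ?T j n" by (simp add: L_def)
    qed
    finally show ?thesis .
  qed
  have g1: "(\<Sum>n\<in>Z. \<Sum>j\<in>UNIV. (u (n + e j) - u n)\<^sup>2) \<le> C * h\<^sup>2 * S"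
    using grad sum_mono2[OF fin(1), of Z "\<lambda>n. \<Sum>j\<in>UNIV. (u (n + e j) - u n)\<^sup>2"] nbh
    by (force simp: S_def sum_nonneg)
  have g2: "(\<Sum>n\<in>Z. \<Sum>j\<in>UNIV. (u n - u (n - e j))\<^sup>2) \<le> C * h\<^sup>2 * S"
  proof -
    have "(\<Sum>n\<in>Z. (u n - u (n - e j))\<^sup>2) \<le> (\<Sum>n\<in>lattice_ball h R. (u (n + e j) - u n)\<^sup>2)" for j
      by (rule sum_le_shifted_sum[OF Z fin(1), of "- e j"]) (use nbh in auto)
    then have "(\<Sum>j\<in>UNIV. \<Sum>n\<in>Z. (u n - u (n - e j))\<^sup>2) \<le> (\<Sum>j\<in>UNIV. \<Sum>n\<in>lattice_ball h R. (u (n + e j) - u n)\<^sup>2)"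
      by (rule sum_mono)
    then show ?thesis
      using grad unfolding S_def sum.swap[of _ Z UNIV] sum.swap[of _ "lattice_ball h R" UNIV] by linarith
  qed
  have z1: "(\<Sum>n\<in>Z. \<Sum>j\<in>UNIV. (u (n - e j))\<^sup>2) \<le> d * S"
  proof -
    have "(\<Sum>n\<in>Z. (u (n - e j))\<^sup>2) \<le> S" for j
      unfolding S_def by (rule sum_le_shifted_sum[OF Z fin(2), of "- e j"]) (use nbh sub in auto)
    then show ?thesis
      unfolding d_def by (subst sum.swap) (rule sum_bounded_above)
  qed
  have z2: "(\<Sum>n\<in>Z. \<Sum>j\<in>UNIV. (u (n + e j))\<^sup>2) \<le> d * S"
  proof -
    have "(\<Sum>n\<in>Z. (u (n + e j))\<^sup>2) \<le> S" for j
      unfolding S_def by (rule sum_le_shifted_sum[OF Z fin(2), of "e j"]) (use nbh sub in auto)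
    then show ?thesis
      unfolding d_def by (subst sum.swap) (rule sum_bounded_above)
  qed
  have "(\<Sum>n\<in>Z. (E n)\<^sup>2) \<le> (\<Sum>n\<in>Z. d * (\<Sum>j\<in>UNIV. L * ?T j n))"
    by (intro sum_mono pt)
  also have "\<dots> = d * L * (h\<^sup>2 * (2 * (\<Sum>n\<in>Z. \<Sum>j\<in>UNIV. (u (n + e j) - u n)\<^sup>2) + 2 * (\<Sum>n\<in>Z. \<Sum>j\<in>UNIV. (u n - u (n - e j))\<^sup>2))
      + h ^ 4 * ((\<Sum>n\<in>Z. \<Sum>j\<in>UNIV. (u (n - e j))\<^sup>2) + (\<Sum>n\<in>Z. \<Sum>j\<in>UNIV. (u (n + e j))\<^sup>2)))"
    unfolding sum_distrib_left[symmetric] sum.distrib by simp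
  also have "\<dots> \<le> d * L * (h\<^sup>2 * (2 * (C * h\<^sup>2 * S) + 2 * (C * h\<^sup>2 * S)) + h ^ 4 * (d * S + d * S))"
    using d0 L0 by (intro mult_left_mono add_mono g1 g2 z1 z2) auto
  also have "\<dots> = 3 * d * K\<^sup>2 * (1 + M\<^sup>2) * (4 * C + 2 * d) * h ^ 4 * S"
  proof -
    have "h ^ 4 = h\<^sup>2 * h\<^sup>2" by simp
    then show ?thesis unfolding L_def by (simp add: algebra_simps)
  qed
  finally show ?thesis unfolding S_def .
qed

lemma weight_antimono:
  assumes "x \<bullet> x \<le> s" "s \<le> a" shows "s\<^sup>2 / 2 - a * s \<le> weight a x"
proof -
  have "0 \<le> (s - x \<bullet> x) * (2 * a - s - x \<bullet> x)" using assms by (intro mult_nonneg_nonneg) auto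
  then show ?thesis by (simp add: weight_def power2_eq_square algebra_simps)
qed

lemma weight_le_of_inner_ge:
  assumes "s \<le> x \<bullet> x" "x \<bullet> x \<le> a" shows "weight a x \<le> s\<^sup>2 / 2 - a * s"
proof -
  have "0 \<le> (x \<bullet> x - s) * (2 * a - s - x \<bullet> x)" using assms by (intro mult_nonneg_nonneg) auto
  then show ?thesis by (simp add: weight_def power2_eq_square algebra_simps)
qed

lemma abs_exp_minus_one_le:
  fixes x :: real assumes "\<bar>x\<bar> \<le> 1" shows "\<bar>exp x - 1\<bar> \<le> 2 * \<bar>x\<bar>"
proof (cases "0 \<le> x")
  case True
  then have "exp x \<le> 1 + x + x\<^sup>2" "x\<^sup>2 \<le> x" "0 \<le> exp x - 1"
    using assms exp_bound[of x] by (auto simp: power2_eq_square mult_left_le)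
  then show ?thesis using True by simp
next
  case False
  then have "1 + x \<le> exp x" "exp x \<le> 1" using exp_ge_add_one_self[of x] by auto
  then show ?thesis using False by linarith
qed

text \<open>Converts exponentially weighted differences of the truncated solution \<open>w\<close>
  into differences of \<open>f\<close>, the function in the Carleman estimate; \<theta> is the
  change of the exponent along the edge. The constants are 18 = 2 * 9, with 3 as a bound for
  \<open>exp 1\<close>, and 8 = 2 * 4.\<close>

lemma conjugated_difference_square_le:
  fixes \<theta> a b t :: real
  assumes \<theta>: "\<bar>\<theta>\<bar> \<le> t" and t: "t \<le> 1"
  shows "(exp (- \<theta>) * a - b)\<^sup>2 \<le> 18 * (a - b)\<^sup>2 + 8 * t\<^sup>2 * b\<^sup>2"
proof -
  have "exp (- \<theta>) \<le> exp 1" using \<theta> t by simp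
  then have e: "exp (- \<theta>) \<le> 3" using exp_le by linarith
  have "(exp (- \<theta>) * (a - b))\<^sup>2 \<le> 9 * (a - b)\<^sup>2"
    unfolding power_mult_distrib using power_mono[OF e, of 2] by (intro mult_right_mono) auto
  moreover have "\<bar>exp (- \<theta>) - 1\<bar> \<le> 2 * t"
    using abs_exp_minus_one_le[of "- \<theta>"] \<theta> t by simp
  then have "((exp (- \<theta>) - 1) * b)\<^sup>2 \<le> (2 * t)\<^sup>2 * b\<^sup>2"
    unfolding power_mult_distrib[of _ b] using power_mono[of "\<bar>exp (- \<theta>) - 1\<bar>" "2 * t" 2]
    by (intro mult_right_mono) auto
  moreover have "(exp (- \<theta>) * a - b)\<^sup>2 \<le> 2 * (exp (- \<theta>) * (a - b))\<^sup>2 + 2 * ((exp (- \<theta>) - 1) * b)\<^sup>2"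
    using zero_le_power2[of "exp (- \<theta>) * (a - b) - (exp (- \<theta>) - 1) * b"]
    by (simp add: power2_eq_square algebra_simps)
  ultimately show ?thesis by (simp add: power_mult_distrib)
qed

lemma conj_laplacian_exp:
  "conj_laplacian (\<lambda>j. h *\<^sub>R axis j 1) \<psi> (\<lambda>x. exp (\<psi> x) * w x) n = exp (\<psi> n) * disc_laplacian h w n"
  unfolding conj_laplacian_def disc_laplacian_eq sum_distrib_left
  by (intro sum.cong refl) (simp add: mult_exp_exp[symmetric] exp_diff field_simps)

text \<open>The cutoff has two transition zones: one inside the ball of radius \<open>r\<close>,
  where the weight is larger than at \<open>11/10 * r\<close>, and one outside, where it is smaller.
  The gaps, doubled because of the squares, are the growth rate \<open>p\<close> of the known mass
  and the decay rate \<open>q\<close> of the unknown one.\<close>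

lemma carleman_annulus_estimate:
  fixes r M :: real
  assumes r: "1/2 \<le> r" "r \<le> 1" and M: "0 \<le> M"
  obtains C \<tau>1 \<delta> p q where "1 \<le> C" and "1 \<le> \<tau>1" and "0 < \<delta>" and "0 < p" and "0 < q"
    and "\<And>h \<tau> (u :: real ^ 'd \<Rightarrow> real). 0 < h \<Longrightarrow> \<tau>1 \<le> \<tau> \<Longrightarrow> \<tau> * h \<le> \<delta> \<Longrightarrow> almost_solution M h 2 u \<Longrightarrow>
      (\<Sum>n\<in>lattice_ball h (11/10 * r). (u n)\<^sup>2)
        \<le> C * (exp (p * \<tau>) * (\<Sum>n\<in>lattice_ball h r. (u n)\<^sup>2) + exp (- q * \<tau>) * (\<Sum>n\<in>lattice_ball h 2. (u n)\<^sup>2))"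
proof -
  define \<rho> where "\<rho> = r\<^sup>2"
  define a where "a = 8/5 * \<rho>"
  have \<rho>: "1/4 \<le> \<rho>" "\<rho> \<le> 1"
    using power_mono[of "1/2" r 2] power_mono[of r 1 2] r by (simp_all add: \<rho>_def power2_eq_square)
  define \<phi> where "\<phi> s = s\<^sup>2 / 2 - a * s" for s
  have \<phi>_mono: "\<phi> t < \<phi> s" if "s < t" "t \<le> a" for s t
  proof -
    have "0 < (t - s) * (2 * a - s - t)" using that by (intro mult_pos_pos) auto
    then show ?thesis by (simp add: \<phi>_def power2_eq_square algebra_simps)
  qed
  \<comment> \<open>As the weight decreases, its maximum on each error zone is at the inner edge,
    91/100 and 129/100, and its minimum on the region to be estimated is at the outer edge, 121/100,
    the square of 11/10.\<close>
  define \<phi>in \<phi>mid \<phi>out where "\<phi>in = \<phi> (91/100 * \<rho>)" and "\<phi>mid = \<phi> (121/100 * \<rho>)" and "\<phi>out = \<phi> (129/100 * \<rho>)"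
  have pq: "0 < 2 * (\<phi>in - \<phi>mid)" "0 < 2 * (\<phi>mid - \<phi>out)"
    using \<phi>_mono[of "91/100 * \<rho>" "121/100 * \<rho>"] \<phi>_mono[of "121/100 * \<rho>" "129/100 * \<rho>"] \<rho>
    by (simp_all add: \<phi>in_def \<phi>mid_def \<phi>out_def a_def)
  \<comment> \<open>The support lies in the range from 9/10 to 7/5 of the Carleman estimate, and the
    plateau contains the range from 1 to 121/100 that corresponds to radii between \<open>r\<close>
    and \<open>11/10 * r\<close>.\<close>
  have ab: "- 10 \<le> 92/100 * \<rho>" "92/100 * \<rho> < 95/100 * \<rho>" "95/100 * \<rho> \<le> 130/100 * \<rho>" "130/100 * \<rho> < 138/100 * \<rho>" "138/100 * \<rho> \<le> 10"
    using \<rho> by auto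
  obtain \<zeta> :: "real ^ 'd \<Rightarrow> real" and K where slow: "slowly_varying K \<zeta>"
    and one: "\<And>x. 95/100 * \<rho> \<le> x \<bullet> x \<Longrightarrow> x \<bullet> x \<le> 130/100 * \<rho> \<Longrightarrow> \<zeta> x = 1"
    and zero: "\<And>x. x \<bullet> x \<le> 92/100 * \<rho> \<or> 138/100 * \<rho> \<le> x \<bullet> x \<Longrightarrow> \<zeta> x = 0"
    by (rule cutoff_exists[OF ab]) (rule that)
  have K: "0 \<le> K" using slowly_varyingD(1)[OF slow, of 0] by simp
  \<comment> \<open>The squares 0.9801 and 1.44 leave room for the inner and the outer zone together
    with one neighbouring step, 0.97 and 1.40.\<close>
  have r1: "0 < 99/100 * r" "99/100 * r < r" "r \<le> 2" and r2: "0 < 12/10 * r" "12/10 * r < 2" "(2 :: real) \<le> 2"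
    using r by auto
  obtain C1 where C1: "0 \<le> C1" and cacc1: "\<And>h (u :: real ^ 'd \<Rightarrow> real). 0 < h \<Longrightarrow> h \<le> (r - 99/100 * r) / 4 \<Longrightarrow> almost_solution M h r u \<Longrightarrow>
      (\<Sum>n\<in>lattice_ball h (99/100 * r). \<Sum>j\<in>UNIV. (u (n + h *\<^sub>R axis j 1) - u n)\<^sup>2) \<le> C1 * h\<^sup>2 * (\<Sum>n\<in>lattice_ball h r. (u n)\<^sup>2)"
    by (rule caccioppoli[OF r1 M]) (rule that)
  obtain C2 where C2: "0 \<le> C2" and cacc2: "\<And>h (u :: real ^ 'd \<Rightarrow> real). 0 < h \<Longrightarrow> h \<le> (2 - 12/10 * r) / 4 \<Longrightarrow> almost_solution M h 2 u \<Longrightarrow>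
      (\<Sum>n\<in>lattice_ball h (12/10 * r). \<Sum>j\<in>UNIV. (u (n + h *\<^sub>R axis j 1) - u n)\<^sup>2) \<le> C2 * h\<^sup>2 * (\<Sum>n\<in>lattice_ball h 2. (u n)\<^sup>2)"
    by (rule caccioppoli[OF r2 M]) (rule that)
  obtain \<tau>0 \<delta>0 where \<tau>0: "1 \<le> \<tau>0" and \<delta>0: "0 < \<delta>0" "\<delta>0 \<le> 1/2000"
    and carl: "\<And>h \<tau> (f :: real ^ 'd \<Rightarrow> real). 0 < h \<Longrightarrow> \<tau>0 \<le> \<tau> \<Longrightarrow> \<tau> * h \<le> \<delta>0 \<Longrightarrow>
      (\<And>n. f n \<noteq> 0 \<Longrightarrow> n \<in> lattice h \<and> 9/10 * \<rho> \<le> n \<bullet> n \<and> n \<bullet> n \<le> 7/5 * \<rho>) \<Longrightarrow>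
      \<tau> ^ 3 * h ^ 4 * (\<Sum>n\<in>lattice_ball h 3. (f n)\<^sup>2)
        + \<tau> * h\<^sup>2 * (\<Sum>n\<in>lattice_ball h 3. \<Sum>j\<in>UNIV. (f (n + h *\<^sub>R axis j 1) - f n)\<^sup>2)
      \<le> 2000 * (\<Sum>n\<in>lattice_ball h 3. (conj_laplacian (\<lambda>j. h *\<^sub>R axis j 1) (\<lambda>x. \<tau> * weight (8/5 * \<rho>) x) f n)\<^sup>2)"
    by (rule carleman_estimate[OF \<rho>]) (rule that, assumption, assumption, assumption, blast)
  define d where "d = real CARD('d)"
  have d0: "0 \<le> d" by (simp add: d_def)
  define L where "L = 3 * d * K\<^sup>2 * (1 + M\<^sup>2)"
  have L0: "0 \<le> L" using d0 by (simp add: L_def)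
  \<comment> \<open>The threshold beyond which \<tau> absorbs the lower-order terms: 108000 = 2000 *
    3 * 18 for the gradient, 12000 = 2 * 2000 * 3 so that at most half of the mass term is used, and
    1280000 = 8 * 400 * 400 from conjugating the differences.\<close>
  define \<Lambda> where "\<Lambda> = 12000 * (1280000 * M\<^sup>2 * d\<^sup>2 + M\<^sup>2) + 108000 * M\<^sup>2 * d"
  define \<tau>1 where "\<tau>1 = max \<tau>0 \<Lambda>"
  \<comment> \<open>As \<open>1 \<le> \<tau>\<close>, this bounds \<open>h\<close> too: one step
    changes \<open>x \<bullet> x\<close> by at most \<open>\<rho> / 100\<close>, the Caccioppoli
    step restriction holds, and \<open>400 * (\<tau> * h) \<le> 1\<close>.\<close>
  define \<delta> where "\<delta> = min \<delta>0 (1/10000)"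
  define C where "C = 1 + 12000 * L * (4 * C1 + 4 * C2 + 4 * d)"
  have C: "1 \<le> C" using L0 C1 C2 d0 by (simp add: C_def)
  have \<tau>1: "1 \<le> \<tau>1" using \<tau>0 by (simp add: \<tau>1_def)
  have \<delta>: "0 < \<delta>" using \<delta>0 by (simp add: \<delta>_def)
  show thesis
  proof (rule that[OF C \<tau>1 \<delta> pq])
    fix h \<tau> :: real and u :: "real ^ 'd \<Rightarrow> real"
    assume h: "0 < h" and \<tau>: "\<tau>1 \<le> \<tau>" and D: "\<tau> * h \<le> \<delta>" and sol: "almost_solution M h 2 u"
    have \<tau>': "1 \<le> \<tau>" "\<tau>0 \<le> \<tau>" "\<Lambda> \<le> \<tau>" using \<tau> \<tau>0 by (simp_all add: \<tau>1_def)
    have h1: "h \<le> 1/10000"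
    proof -
      have "h \<le> \<tau> * h" using \<tau>' h by simp
      also have "\<dots> \<le> 1/10000" using D by (simp add: \<delta>_def)
      finally show ?thesis .
    qed
    have h1': "h \<le> 1" using h1 by simp
    define e :: "'d \<Rightarrow> real ^ 'd" where "e = (\<lambda>j. h *\<^sub>R axis j 1)"
    define A :: "(real ^ 'd) set" where "A = lattice_ball h 3"
    define S where "S R = (\<Sum>n\<in>lattice_ball h R. (u n)\<^sup>2)" for R
    have S0: "0 \<le> S R" for R by (simp add: S_def sum_nonneg)
    have finA: "finite A" using h by (simp add: A_def finite_lattice_ball)
    have off: "u n = 0" if "n \<notin> lattice h" for n using sol that by (auto simp: almost_solution_def)
    have A3: "norm n \<le> 3" if "n \<in> A" for n using that by (simp add: A_def lattice_ball_def)
    have inner_e: "\<bar>(n + e j) \<bullet> (n + e j) - n \<bullet> n\<bar> \<le> \<rho> / 100" "\<bar>(n - e j) \<bullet> (n - e j) - n \<bullet> n\<bar> \<le> \<rho> / 100" if "n \<in> A" for n j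
    proof -
      have nj: "\<bar>n $ j\<bar> \<le> 3" using component_le_norm_cart[of n j] A3[OF that] by linarith
      have "\<bar>2 * h * n $ j\<bar> = 2 * h * \<bar>n $ j\<bar>" using h by (simp add: abs_mult)
      moreover have "h * \<bar>n $ j\<bar> \<le> h * 3" using nj h by (intro mult_left_mono) auto
      moreover have "h\<^sup>2 \<le> h" using h h1 by (simp add: power2_eq_square)
      moreover have "0 \<le> h\<^sup>2" by simp
      ultimately show "\<bar>(n + e j) \<bullet> (n + e j) - n \<bullet> n\<bar> \<le> \<rho> / 100" "\<bar>(n - e j) \<bullet> (n - e j) - n \<bullet> n\<bar> \<le> \<rho> / 100"
        unfolding e_def inner_add_axis using h1 \<rho> by linarith+
    qed
    define w where "w n = \<zeta> n * u n" for n
    define f where "f n = exp (\<tau> * weight a n) * w n" for n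
    define N where "N = (\<Sum>n\<in>A. (f n)\<^sup>2)"
    define G where "G = (\<Sum>n\<in>A. \<Sum>j\<in>UNIV. (f (n + e j) - f n)\<^sup>2)"
    have N0: "0 \<le> N" and G0: "0 \<le> G" by (auto simp: N_def G_def sum_nonneg)
    have supp: "n \<in> lattice h \<and> 92/100 * \<rho> < n \<bullet> n \<and> n \<bullet> n < 138/100 * \<rho>" if "w n \<noteq> 0" for n
    proof -
      have "\<zeta> n \<noteq> 0" "u n \<noteq> 0" using that by (auto simp: w_def)
      then show ?thesis using zero[of n] off[of n] by force
    qed
    \<comment> \<open>The transition zones widened by one lattice step, so that outside them \<zeta>
      agrees at a point and all its neighbours.\<close>
    define Zin where "Zin = {n \<in> A. 91/100 * \<rho> \<le> n \<bullet> n \<and> n \<bullet> n \<le> 96/100 * \<rho>}"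
    define Zout where "Zout = {n \<in> A. 129/100 * \<rho> \<le> n \<bullet> n \<and> n \<bullet> n \<le> 139/100 * \<rho>}"
    have flat: "\<zeta> (n + e j) = \<zeta> n" "\<zeta> (n - e j) = \<zeta> n" if nA: "n \<in> A" and nZ: "n \<notin> Zin \<union> Zout" for n j
    proof -
      note i = inner_e[OF nA, of j]
      consider "n \<bullet> n < 91/100 * \<rho>" | "96/100 * \<rho> < n \<bullet> n" "n \<bullet> n < 129/100 * \<rho>" | "139/100 * \<rho> < n \<bullet> n"
        using nA nZ by (auto simp: Zin_def Zout_def)
      then have "\<zeta> (n + e j) = \<zeta> n \<and> \<zeta> (n - e j) = \<zeta> n"
      proof cases
        case 1
        then have "\<zeta> n = 0" "\<zeta> (n + e j) = 0" "\<zeta> (n - e j) = 0" by (intro zero; use i \<rho> in linarith)+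
        then show ?thesis by simp
      next
        case 2
        then have "\<zeta> n = 1" "\<zeta> (n + e j) = 1" "\<zeta> (n - e j) = 1" by (intro one; use i \<rho> in linarith)+
        then show ?thesis by simp
      next
        case 3
        then have "\<zeta> n = 0" "\<zeta> (n + e j) = 0" "\<zeta> (n - e j) = 0" by (intro zero; use i \<rho> in linarith)+
        then show ?thesis by simp
      qed
      then show "\<zeta> (n + e j) = \<zeta> n" "\<zeta> (n - e j) = \<zeta> n" by auto
    qed
    define E where "E n = (if n \<in> Zin \<union> Zout then \<Sum>j\<in>UNIV. K * h * \<bar>u (n + e j) - u (n - e j)\<bar> + K * h\<^sup>2 * \<bar>u (n - e j)\<bar> + M * K * h\<^sup>2 * \<bar>u (n + e j)\<bar> else 0)" for n
    have lap: "\<bar>disc_laplacian h w n\<bar> \<le> M * h * (\<Sum>j\<in>UNIV. \<bar>w (n + e j) - w n\<bar>) + M * h\<^sup>2 * \<bar>w n\<bar> + E n" if n: "n \<in> A" for n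
    proof -
      \<comment> \<open>The commutator with \<zeta>, arranged so that a first difference of \<zeta>
        always meets a difference of \<open>u\<close>, and plain values of \<open>u\<close> meet a
        second difference of \<zeta>.\<close>
      define I where "I j = (\<zeta> (n + e j) - \<zeta> n) * (u (n + e j) - u (n - e j)) + (\<zeta> (n + e j) + \<zeta> (n - e j) - 2 * \<zeta> n) * u (n - e j)" for j
      have eq: "disc_laplacian h w n = \<zeta> n * disc_laplacian h u n + (\<Sum>j\<in>UNIV. I j)"
        unfolding disc_laplacian_eq sum_distrib_left sum.distrib[symmetric]
        by (intro sum.cong refl) (simp add: w_def I_def e_def algebra_simps)
      have u: "\<bar>\<zeta> n * disc_laplacian h u n\<bar> \<le> M * h * (\<Sum>j\<in>UNIV. \<bar>w (n + e j) - w n\<bar>) + M * h\<^sup>2 * \<bar>w n\<bar>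
          + (\<Sum>j\<in>UNIV. M * h * (\<bar>\<zeta> (n + e j) - \<zeta> n\<bar> * \<bar>u (n + e j)\<bar>))"
      proof (cases "\<zeta> n = 0")
        case True
        then show ?thesis using M h by (simp add: sum_nonneg)
      next
        case False
        then have "n \<bullet> n < 2\<^sup>2" using zero[of n] \<rho> by force
        then have "norm n < 2" by (rule norm_less_of_inner_less) simp
        then have "n \<in> lattice_ball h 2" using n by (auto simp: A_def lattice_ball_def)
        then have "\<bar>disc_laplacian h u n\<bar> \<le> M * h * (\<Sum>j\<in>UNIV. \<bar>u (n + e j) - u n\<bar>) + M * h\<^sup>2 * \<bar>u n\<bar>"
          using sol by (auto simp: almost_solution_def e_def)
        then have "\<bar>\<zeta> n * disc_laplacian h u n\<bar> \<le> \<bar>\<zeta> n\<bar> * (M * h * (\<Sum>j\<in>UNIV. \<bar>u (n + e j) - u n\<bar>) + M * h\<^sup>2 * \<bar>u n\<bar>)"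
          unfolding abs_mult by (intro mult_left_mono) auto
        also have "\<dots> = (\<Sum>j\<in>UNIV. M * h * \<bar>\<zeta> n * (u (n + e j) - u n)\<bar>) + M * h\<^sup>2 * \<bar>w n\<bar>"
          by (simp add: w_def sum_distrib_left abs_mult distrib_left mult_ac)
        also have "\<dots> \<le> (\<Sum>j\<in>UNIV. M * h * (\<bar>w (n + e j) - w n\<bar> + \<bar>\<zeta> (n + e j) - \<zeta> n\<bar> * \<bar>u (n + e j)\<bar>)) + M * h\<^sup>2 * \<bar>w n\<bar>"
        proof (intro add_right_mono sum_mono mult_left_mono)
          fix j
          have "\<zeta> n * (u (n + e j) - u n) = (w (n + e j) - w n) - (\<zeta> (n + e j) - \<zeta> n) * u (n + e j)"
            by (simp add: w_def algebra_simps)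
          then show "\<bar>\<zeta> n * (u (n + e j) - u n)\<bar> \<le> \<bar>w (n + e j) - w n\<bar> + \<bar>\<zeta> (n + e j) - \<zeta> n\<bar> * \<bar>u (n + e j)\<bar>"
            using abs_triangle_ineq4[of "w (n + e j) - w n" "(\<zeta> (n + e j) - \<zeta> n) * u (n + e j)"] by (simp add: abs_mult)
        qed (use M h in auto)
        also have "\<dots> = M * h * (\<Sum>j\<in>UNIV. \<bar>w (n + e j) - w n\<bar>) + M * h\<^sup>2 * \<bar>w n\<bar>
          + (\<Sum>j\<in>UNIV. M * h * (\<bar>\<zeta> (n + e j) - \<zeta> n\<bar> * \<bar>u (n + e j)\<bar>))"
          by (simp add: distrib_left sum.distrib sum_distrib_left)
        finally show ?thesis .
      qed
      have rest: "(\<Sum>j\<in>UNIV. M * h * (\<bar>\<zeta> (n + e j) - \<zeta> n\<bar> * \<bar>u (n + e j)\<bar>)) + \<bar>\<Sum>j\<in>UNIV. I j\<bar> \<le> E n"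
      proof (cases "n \<in> Zin \<union> Zout")
        case False
        then show ?thesis using flat[OF n False] by (simp add: I_def E_def)
      next
        case True
        have "(\<Sum>j\<in>UNIV. M * h * (\<bar>\<zeta> (n + e j) - \<zeta> n\<bar> * \<bar>u (n + e j)\<bar>)) + \<bar>\<Sum>j\<in>UNIV. I j\<bar>
            \<le> (\<Sum>j\<in>UNIV. M * h * (\<bar>\<zeta> (n + e j) - \<zeta> n\<bar> * \<bar>u (n + e j)\<bar>)) + (\<Sum>j\<in>UNIV. \<bar>I j\<bar>)"
          by (intro add_left_mono sum_abs)
        also have "\<dots> = (\<Sum>j\<in>UNIV. M * h * (\<bar>\<zeta> (n + e j) - \<zeta> n\<bar> * \<bar>u (n + e j)\<bar>) + \<bar>I j\<bar>)"
          by (simp add: sum.distrib)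
        also have "\<dots> \<le> (\<Sum>j\<in>UNIV. K * h * \<bar>u (n + e j) - u (n - e j)\<bar> + K * h\<^sup>2 * \<bar>u (n - e j)\<bar> + M * K * h\<^sup>2 * \<bar>u (n + e j)\<bar>)"
        proof (rule sum_mono)
          fix j
          note sv = slowly_varyingD(2,4)[OF slow A3[OF n] h h1', of j, folded e_def]
          have 1: "\<bar>\<zeta> (n + e j) - \<zeta> n\<bar> \<le> K * h" and 2: "\<bar>\<zeta> (n + e j) + \<zeta> (n - e j) - 2 * \<zeta> n\<bar> \<le> K * h\<^sup>2"
            using sv by (simp_all add: e_def)
          have "\<bar>I j\<bar> \<le> \<bar>\<zeta> (n + e j) - \<zeta> n\<bar> * \<bar>u (n + e j) - u (n - e j)\<bar> + \<bar>\<zeta> (n + e j) + \<zeta> (n - e j) - 2 * \<zeta> n\<bar> * \<bar>u (n - e j)\<bar>"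
            unfolding I_def abs_mult[symmetric] by (rule abs_triangle_ineq)
          also have "\<dots> \<le> K * h * \<bar>u (n + e j) - u (n - e j)\<bar> + K * h\<^sup>2 * \<bar>u (n - e j)\<bar>"
            using 1 2 by (intro add_mono mult_right_mono) auto
          finally have "\<bar>I j\<bar> \<le> K * h * \<bar>u (n + e j) - u (n - e j)\<bar> + K * h\<^sup>2 * \<bar>u (n - e j)\<bar>" .
          moreover have "M * h * (\<bar>\<zeta> (n + e j) - \<zeta> n\<bar> * \<bar>u (n + e j)\<bar>) \<le> M * h * ((K * h) * \<bar>u (n + e j)\<bar>)"
            using 1 M h by (intro mult_left_mono mult_right_mono) auto
          moreover have "M * h * ((K * h) * \<bar>u (n + e j)\<bar>) = M * K * h\<^sup>2 * \<bar>u (n + e j)\<bar>"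
            by (simp add: power2_eq_square)
          ultimately show "M * h * (\<bar>\<zeta> (n + e j) - \<zeta> n\<bar> * \<bar>u (n + e j)\<bar>) + \<bar>I j\<bar>
            \<le> K * h * \<bar>u (n + e j) - u (n - e j)\<bar> + K * h\<^sup>2 * \<bar>u (n - e j)\<bar> + M * K * h\<^sup>2 * \<bar>u (n + e j)\<bar>"
            by linarith
        qed
        finally show ?thesis using True by (simp add: E_def)
      qed
      show ?thesis
        unfolding eq using u rest abs_triangle_ineq[of "\<zeta> n * disc_laplacian h u n" "\<Sum>j\<in>UNIV. I j"] by linarith
    qed
    have square: "(exp (\<tau> * weight a n) * disc_laplacian h w n)\<^sup>2
       \<le> 3 * (M\<^sup>2 * h\<^sup>2 * d * (\<Sum>j\<in>UNIV. 18 * (f (n + e j) - f n)\<^sup>2 + 1280000 * (\<tau> * h)\<^sup>2 * (f n)\<^sup>2))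
         + 3 * (M\<^sup>2 * h ^ 4 * (f n)\<^sup>2) + 3 * (exp (2 * \<tau> * weight a n) * (E n)\<^sup>2)" if n: "n \<in> A" for n
    proof -
      define \<psi> where "\<psi> = exp (\<tau> * weight a n)"
      have \<psi>: "0 < \<psi>" "\<psi>\<^sup>2 = exp (2 * \<tau> * weight a n)"
        by (simp_all add: \<psi>_def power2_eq_square mult_exp_exp)
      have g: "(\<psi> * (w (n + e j) - w n))\<^sup>2 \<le> 18 * (f (n + e j) - f n)\<^sup>2 + 1280000 * (\<tau> * h)\<^sup>2 * (f n)\<^sup>2" for j
      proof -
        define \<theta> where "\<theta> = \<tau> * weight a (n + e j) - \<tau> * weight a n"
        have a02: "0 \<le> a" "a \<le> 2" using \<rho> by (simp_all add: a_def)
        have "\<bar>weight a (n + e j) - weight a n\<bar> \<le> 400 * h"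
        proof -
          have "\<bar>weight a (n + e j) - weight a n - h * weight_grad a j n\<bar> \<le> 200 * h\<^sup>2"
            unfolding e_def by (rule weight_forward[OF A3[OF n] a02 h h1'])
          moreover have "\<bar>h * weight_grad a j n\<bar> \<le> h * 200"
            unfolding abs_mult using weight_grad_le[OF A3[OF n] a02 h h1', of j] h by (simp add: mult_left_mono)
          moreover have "h\<^sup>2 \<le> h" using h h1' by (simp add: power2_eq_square)
          ultimately show ?thesis by linarith
        qed
        then have "\<tau> * \<bar>weight a (n + e j) - weight a n\<bar> \<le> \<tau> * (400 * h)"
          using \<tau>' by (intro mult_left_mono) auto
        then have \<theta>: "\<bar>\<theta>\<bar> \<le> 400 * (\<tau> * h)"
          using \<tau>' by (simp add: \<theta>_def right_diff_distrib[symmetric] abs_mult)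
        have t1: "400 * (\<tau> * h) \<le> 1" using D by (simp add: \<delta>_def)
        have "\<psi> * (w (n + e j) - w n) = exp (- \<theta>) * f (n + e j) - f n"
          by (simp add: \<psi>_def f_def \<theta>_def exp_diff right_diff_distrib)
        then show ?thesis
          using conjugated_difference_square_le[OF \<theta> t1, of "f (n + e j)" "f n"] by (simp add: power_mult_distrib)
      qed
      have sq3: "(x + y + z)\<^sup>2 \<le> 3 * x\<^sup>2 + 3 * y\<^sup>2 + 3 * z\<^sup>2" for x y z :: real
        using zero_le_power2[of "x - y"] zero_le_power2[of "y - z"] zero_le_power2[of "x - z"]
        by (simp add: power2_eq_square algebra_simps)
      have "\<bar>\<psi> * disc_laplacian h w n\<bar> \<le> \<psi> * (M * h * (\<Sum>j\<in>UNIV. \<bar>w (n + e j) - w n\<bar>) + M * h\<^sup>2 * \<bar>w n\<bar> + E n)"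
        unfolding abs_mult using lap[OF n] \<psi> by (simp add: mult_left_mono)
      also have "\<dots> = M * h * (\<Sum>j\<in>UNIV. \<bar>\<psi> * (w (n + e j) - w n)\<bar>) + M * h\<^sup>2 * \<bar>f n\<bar> + \<psi> * E n"
      proof -
        have "(\<Sum>j\<in>UNIV. \<bar>\<psi> * (w (n + e j) - w n)\<bar>) = \<psi> * (\<Sum>j\<in>UNIV. \<bar>w (n + e j) - w n\<bar>)"
          unfolding sum_distrib_left abs_mult using \<psi>(1) by simp
        moreover have "\<bar>f n\<bar> = \<psi> * \<bar>w n\<bar>"
          unfolding f_def \<psi>_def[symmetric] abs_mult using \<psi>(1) by simp
        ultimately show ?thesis by (simp add: distrib_left mult_ac)
      qed
      finally have "\<bar>\<psi> * disc_laplacian h w n\<bar>\<^sup>2 \<le> (M * h * (\<Sum>j\<in>UNIV. \<bar>\<psi> * (w (n + e j) - w n)\<bar>) + M * h\<^sup>2 * \<bar>f n\<bar> + \<psi> * E n)\<^sup>2"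
        by (rule power_mono) simp
      also have "\<dots> \<le> 3 * (M * h * (\<Sum>j\<in>UNIV. \<bar>\<psi> * (w (n + e j) - w n)\<bar>))\<^sup>2 + 3 * (M * h\<^sup>2 * \<bar>f n\<bar>)\<^sup>2 + 3 * (\<psi> * E n)\<^sup>2"
        by (rule sq3)
      also have "\<dots> \<le> 3 * (M\<^sup>2 * h\<^sup>2 * (d * (\<Sum>j\<in>UNIV. 18 * (f (n + e j) - f n)\<^sup>2 + 1280000 * (\<tau> * h)\<^sup>2 * (f n)\<^sup>2)))
         + 3 * (M\<^sup>2 * h ^ 4 * (f n)\<^sup>2) + 3 * (exp (2 * \<tau> * weight a n) * (E n)\<^sup>2)"
      proof (intro add_mono mult_left_mono)
        have "(\<Sum>j\<in>UNIV. \<bar>\<psi> * (w (n + e j) - w n)\<bar>)\<^sup>2 \<le> (\<Sum>j\<in>UNIV. \<bar>\<psi> * (w (n + e j) - w n)\<bar>\<^sup>2) * card (UNIV :: 'd set)"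
          by (rule sum_squared_le_sum_of_squares)
        also have "\<dots> = d * (\<Sum>j\<in>UNIV. (\<psi> * (w (n + e j) - w n))\<^sup>2)" by (simp add: d_def)
        also have "\<dots> \<le> d * (\<Sum>j\<in>UNIV. 18 * (f (n + e j) - f n)\<^sup>2 + 1280000 * (\<tau> * h)\<^sup>2 * (f n)\<^sup>2)"
          by (intro mult_left_mono sum_mono g d0)
        finally show "(M * h * (\<Sum>j\<in>UNIV. \<bar>\<psi> * (w (n + e j) - w n)\<bar>))\<^sup>2
            \<le> M\<^sup>2 * h\<^sup>2 * (d * (\<Sum>j\<in>UNIV. 18 * (f (n + e j) - f n)\<^sup>2 + 1280000 * (\<tau> * h)\<^sup>2 * (f n)\<^sup>2))"
          unfolding power_mult_distrib[of "M * h"] power_mult_distrib[of M h] by (rule mult_left_mono) simp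
        show "(M * h\<^sup>2 * \<bar>f n\<bar>)\<^sup>2 \<le> M\<^sup>2 * h ^ 4 * (f n)\<^sup>2" by (simp add: power_mult_distrib flip: power_mult)
        show "(\<psi> * E n)\<^sup>2 \<le> exp (2 * \<tau> * weight a n) * (E n)\<^sup>2" by (simp add: power_mult_distrib \<psi>(2))
      qed auto
      finally show ?thesis by (simp add: \<psi>_def mult.assoc)
    qed
    have L_eq: "conj_laplacian e (\<lambda>x. \<tau> * weight a x) f n = exp (\<tau> * weight a n) * disc_laplacian h w n" for n
      unfolding f_def[abs_def] e_def by (rule conj_laplacian_exp)
    have carl': "\<tau> ^ 3 * h ^ 4 * N + \<tau> * h\<^sup>2 * G \<le> 2000 * (\<Sum>n\<in>A. (exp (\<tau> * weight a n) * disc_laplacian h w n)\<^sup>2)"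
    proof -
      have D0: "\<tau> * h \<le> \<delta>0" using D by (simp add: \<delta>_def)
      have sf: "n \<in> lattice h \<and> 9/10 * \<rho> \<le> n \<bullet> n \<and> n \<bullet> n \<le> 7/5 * \<rho>" if "f n \<noteq> 0" for n
        using supp[of n] that \<rho> by (auto simp: f_def)
      show ?thesis
        unfolding L_eq[symmetric] N_def G_def A_def unfolding e_def a_def
        by (rule carl[OF h \<tau>'(2) D0 sf])
    qed
    have E2: "(\<Sum>n\<in>A. exp (2 * \<tau> * weight a n) * (E n)\<^sup>2)
      \<le> exp (2 * \<tau> * \<phi>in) * (L * (4 * C1 + 2 * d) * h ^ 4 * S r) + exp (2 * \<tau> * \<phi>out) * (L * (4 * C2 + 2 * d) * h ^ 4 * S 2)"
    proof -
      have lat: "n \<in> lattice h \<and> n + e j \<in> lattice h \<and> n - e j \<in> lattice h" if "n \<in> A" for n j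
        using that by (auto simp: A_def lattice_ball_def e_def lattice_axis_iff)
      have sol_r: "almost_solution M h r u" using sol r by (auto simp: almost_solution_def lattice_ball_def)
      have "(99/100 * r)\<^sup>2 = 9801/10000 * \<rho>" "(12/10 * r)\<^sup>2 = 144/100 * \<rho>" by (simp_all add: \<rho>_def power_mult_distrib power2_eq_square)
      note rr = this
      have in_ball: "x \<in> lattice_ball h R" if "x \<in> lattice h" "x \<bullet> x < R\<^sup>2" "0 \<le> R" for x :: "real ^ 'd" and R
        using norm_less_of_inner_less[OF that(2,3)] that(1) by (simp add: lattice_ball_def)
      have zin: "(\<Sum>n\<in>Zin. (E n)\<^sup>2) \<le> L * (4 * C1 + 2 * d) * h ^ 4 * S r"
        unfolding S_def L_def d_def
      proof (rule sum_cutoff_commutator_square_le[OF h _ K M])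
        show "99/100 * r \<le> r" using r by simp
        show "finite Zin" using finA by (simp add: Zin_def)
        show "(\<Sum>n\<in>lattice_ball h (99/100 * r). \<Sum>j\<in>UNIV. (u (n + h *\<^sub>R axis j 1) - u n)\<^sup>2) \<le> C1 * h\<^sup>2 * (\<Sum>n\<in>lattice_ball h r. (u n)\<^sup>2)"
          using h1 r by (intro cacc1 h sol_r) auto
        fix n assume n: "n \<in> Zin"
        then have nA: "n \<in> A" and ns: "n \<bullet> n \<le> 96/100 * \<rho>" by (auto simp: Zin_def)
        show "\<bar>E n\<bar> \<le> (\<Sum>j\<in>UNIV. K * h * \<bar>u (n + h *\<^sub>R axis j 1) - u (n - h *\<^sub>R axis j 1)\<bar> + K * h\<^sup>2 * \<bar>u (n - h *\<^sub>R axis j 1)\<bar> + M * K * h\<^sup>2 * \<bar>u (n + h *\<^sub>R axis j 1)\<bar>)"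
          using n K M h by (simp add: E_def e_def sum_nonneg)
        fix j
        have "n \<bullet> n < (99/100 * r)\<^sup>2" "(n - h *\<^sub>R axis j 1) \<bullet> (n - h *\<^sub>R axis j 1) < (99/100 * r)\<^sup>2"
          "(n + h *\<^sub>R axis j 1) \<bullet> (n + h *\<^sub>R axis j 1) < (99/100 * r)\<^sup>2"
          unfolding rr using inner_e[OF nA, of j, unfolded e_def] ns \<rho> by linarith+
        then show "n \<in> lattice_ball h (99/100 * r) \<and> n - h *\<^sub>R axis j 1 \<in> lattice_ball h (99/100 * r) \<and> n + h *\<^sub>R axis j 1 \<in> lattice_ball h (99/100 * r)"
          using lat[OF nA, of j] r unfolding e_def by (intro conjI in_ball) auto
      qed
      have zout: "(\<Sum>n\<in>Zout. (E n)\<^sup>2) \<le> L * (4 * C2 + 2 * d) * h ^ 4 * S 2"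
        unfolding S_def L_def d_def
      proof (rule sum_cutoff_commutator_square_le[OF h _ K M])
        show "12/10 * r \<le> 2" using r by simp
        show "finite Zout" using finA by (simp add: Zout_def)
        show "(\<Sum>n\<in>lattice_ball h (12/10 * r). \<Sum>j\<in>UNIV. (u (n + h *\<^sub>R axis j 1) - u n)\<^sup>2) \<le> C2 * h\<^sup>2 * (\<Sum>n\<in>lattice_ball h 2. (u n)\<^sup>2)"
          using h1 r by (intro cacc2 h sol) auto
        fix n assume n: "n \<in> Zout"
        then have nA: "n \<in> A" and ns: "n \<bullet> n \<le> 139/100 * \<rho>" by (auto simp: Zout_def)
        show "\<bar>E n\<bar> \<le> (\<Sum>j\<in>UNIV. K * h * \<bar>u (n + h *\<^sub>R axis j 1) - u (n - h *\<^sub>R axis j 1)\<bar> + K * h\<^sup>2 * \<bar>u (n - h *\<^sub>R axis j 1)\<bar> + M * K * h\<^sup>2 * \<bar>u (n + h *\<^sub>R axis j 1)\<bar>)"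
          using n K M h by (simp add: E_def e_def sum_nonneg)
        fix j
        have "n \<bullet> n < (12/10 * r)\<^sup>2" "(n - h *\<^sub>R axis j 1) \<bullet> (n - h *\<^sub>R axis j 1) < (12/10 * r)\<^sup>2"
          "(n + h *\<^sub>R axis j 1) \<bullet> (n + h *\<^sub>R axis j 1) < (12/10 * r)\<^sup>2"
          unfolding rr using inner_e[OF nA, of j, unfolded e_def] ns \<rho> by linarith+
        then show "n \<in> lattice_ball h (12/10 * r) \<and> n - h *\<^sub>R axis j 1 \<in> lattice_ball h (12/10 * r) \<and> n + h *\<^sub>R axis j 1 \<in> lattice_ball h (12/10 * r)"
          using lat[OF nA, of j] r unfolding e_def by (intro conjI in_ball) auto
      qed
      have disj: "Zin \<inter> Zout = {}" using \<rho> by (auto simp: Zin_def Zout_def)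
      have "(\<Sum>n\<in>A. exp (2 * \<tau> * weight a n) * (E n)\<^sup>2) = (\<Sum>n\<in>Zin \<union> Zout. exp (2 * \<tau> * weight a n) * (E n)\<^sup>2)"
        by (rule sum.mono_neutral_right[OF finA]) (auto simp: E_def Zin_def Zout_def)
      also have "\<dots> = (\<Sum>n\<in>Zin. exp (2 * \<tau> * weight a n) * (E n)\<^sup>2) + (\<Sum>n\<in>Zout. exp (2 * \<tau> * weight a n) * (E n)\<^sup>2)"
        using finA disj by (intro sum.union_disjoint) (auto simp: Zin_def Zout_def)
      also have "\<dots> \<le> (\<Sum>n\<in>Zin. exp (2 * \<tau> * \<phi>in) * (E n)\<^sup>2) + (\<Sum>n\<in>Zout. exp (2 * \<tau> * \<phi>out) * (E n)\<^sup>2)"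
      proof (intro add_mono sum_mono mult_right_mono)
        fix n assume "n \<in> Zin"
        then have "weight a n \<le> \<phi>in"
          unfolding \<phi>in_def \<phi>_def using \<rho> by (intro weight_le_of_inner_ge) (auto simp: Zin_def a_def)
        then show "exp (2 * \<tau> * weight a n) \<le> exp (2 * \<tau> * \<phi>in)" using \<tau>' by simp
      next
        fix n assume "n \<in> Zout"
        then have "weight a n \<le> \<phi>out"
          unfolding \<phi>out_def \<phi>_def using \<rho> by (intro weight_le_of_inner_ge) (auto simp: Zout_def a_def)
        then show "exp (2 * \<tau> * weight a n) \<le> exp (2 * \<tau> * \<phi>out)" using \<tau>' by simp
      qed auto
      also have "\<dots> \<le> exp (2 * \<tau> * \<phi>in) * (L * (4 * C1 + 2 * d) * h ^ 4 * S r) + exp (2 * \<tau> * \<phi>out) * (L * (4 * C2 + 2 * d) * h ^ 4 * S 2)"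
        unfolding sum_distrib_left[symmetric] by (intro add_mono mult_left_mono zin zout) auto
      finally show ?thesis .
    qed
    define T where "T = exp (2 * \<tau> * \<phi>in) * (L * (4 * C1 + 2 * d) * S r) + exp (2 * \<tau> * \<phi>out) * (L * (4 * C2 + 2 * d) * S 2)"
    have NT: "N \<le> 12000 * T"
    proof -
      have "(\<Sum>n\<in>A. (exp (\<tau> * weight a n) * disc_laplacian h w n)\<^sup>2)
        \<le> (\<Sum>n\<in>A. 3 * (M\<^sup>2 * h\<^sup>2 * d * (\<Sum>j\<in>UNIV. 18 * (f (n + e j) - f n)\<^sup>2 + 1280000 * (\<tau> * h)\<^sup>2 * (f n)\<^sup>2))
         + 3 * (M\<^sup>2 * h ^ 4 * (f n)\<^sup>2) + 3 * (exp (2 * \<tau> * weight a n) * (E n)\<^sup>2))"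
        by (intro sum_mono square)
      also have "\<dots> = 3 * (M\<^sup>2 * h\<^sup>2 * d * (18 * G + d * (1280000 * (\<tau> * h)\<^sup>2 * N))) + 3 * (M\<^sup>2 * h ^ 4 * N) + 3 * (\<Sum>n\<in>A. exp (2 * \<tau> * weight a n) * (E n)\<^sup>2)"
        unfolding sum.distrib sum_distrib_left[symmetric] G_def N_def by (simp add: d_def sum_distrib_left mult_ac)
      also have "\<dots> \<le> 3 * (M\<^sup>2 * h\<^sup>2 * d * (18 * G + d * (1280000 * (\<tau> * h)\<^sup>2 * N))) + 3 * (M\<^sup>2 * h ^ 4 * N) + 3 * (h ^ 4 * T)"
        using E2 by (simp add: T_def algebra_simps)
      finally have sum_sq: "(\<Sum>n\<in>A. (exp (\<tau> * weight a n) * disc_laplacian h w n)\<^sup>2)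
        \<le> 3 * (M\<^sup>2 * h\<^sup>2 * d * (18 * G + d * (1280000 * (\<tau> * h)\<^sup>2 * N))) + 3 * (M\<^sup>2 * h ^ 4 * N) + 3 * (h ^ 4 * T)" .
      have main: "\<tau> ^ 3 * h ^ 4 * N + \<tau> * h\<^sup>2 * G \<le>
          2000 * (3 * (M\<^sup>2 * h\<^sup>2 * d * (18 * G + d * (1280000 * (\<tau> * h)\<^sup>2 * N))) + 3 * (M\<^sup>2 * h ^ 4 * N) + 3 * (h ^ 4 * T))"
        by (rule order_trans[OF carl' mult_left_mono[OF sum_sq]]) simp
      have md: "0 \<le> M\<^sup>2 * d" "0 \<le> M\<^sup>2 * d\<^sup>2" "0 \<le> M\<^sup>2" using d0 by auto
      have Gb: "108000 * M\<^sup>2 * d * (h\<^sup>2 * G) \<le> \<tau> * (h\<^sup>2 * G)"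
      proof (rule mult_right_mono)
        have "108000 * M\<^sup>2 * d \<le> \<Lambda>" using md by (simp add: \<Lambda>_def)
        then show "108000 * M\<^sup>2 * d \<le> \<tau>" using \<tau>'(3) by (rule order_trans)
      qed (use G0 in simp)
      \<comment> \<open>Conjugating the first-order term costs two powers of \<tau>, one less than
        the Carleman estimate provides.\<close>
      have Nb: "12000 * (1280000 * M\<^sup>2 * d\<^sup>2 * \<tau>\<^sup>2 + M\<^sup>2) * (h ^ 4 * N) \<le> \<tau> ^ 3 * (h ^ 4 * N)"
      proof (rule mult_right_mono)
        have "1 \<le> \<tau>\<^sup>2" using \<tau>' by simp
        then have "M\<^sup>2 \<le> M\<^sup>2 * \<tau>\<^sup>2" by (simp add: mult_le_cancel_left1)
        then have "12000 * (1280000 * M\<^sup>2 * d\<^sup>2 * \<tau>\<^sup>2 + M\<^sup>2) \<le> 12000 * (1280000 * M\<^sup>2 * d\<^sup>2 + M\<^sup>2) * \<tau>\<^sup>2"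
          by (simp add: algebra_simps)
        also have "\<dots> \<le> \<tau> * \<tau>\<^sup>2"
        proof (rule mult_right_mono)
          have "12000 * (1280000 * M\<^sup>2 * d\<^sup>2 + M\<^sup>2) \<le> \<Lambda>" using d0 by (simp add: \<Lambda>_def)
          then show "12000 * (1280000 * M\<^sup>2 * d\<^sup>2 + M\<^sup>2) \<le> \<tau>" using \<tau>'(3) by (rule order_trans)
        qed simp
        finally show "12000 * (1280000 * M\<^sup>2 * d\<^sup>2 * \<tau>\<^sup>2 + M\<^sup>2) \<le> \<tau> ^ 3" by (simp add: power3_eq_cube power2_eq_square)
      qed (use N0 in simp)
      define x where "x = 1280000 * M\<^sup>2 * d\<^sup>2 * \<tau>\<^sup>2 + M\<^sup>2"
      have comb: "a \<le> 2 * t" if "a + b \<le> g + y + t" "g \<le> b" "2 * y \<le> a" for a b g y t :: real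
        using that by linarith
      have "2000 * (3 * (M\<^sup>2 * h\<^sup>2 * d * (18 * G + d * (1280000 * (\<tau> * h)\<^sup>2 * N))) + 3 * (M\<^sup>2 * h ^ 4 * N) + 3 * (h ^ 4 * T))
        = 108000 * M\<^sup>2 * d * (h\<^sup>2 * G) + 6000 * x * (h ^ 4 * N) + 6000 * (h ^ 4 * T)"
      proof -
        have "h ^ 4 = h\<^sup>2 * h\<^sup>2" by simp
        then show ?thesis unfolding x_def by (simp add: power_mult_distrib power2_eq_square algebra_simps)
      qed
      with main have "\<tau> ^ 3 * (h ^ 4 * N) + \<tau> * (h\<^sup>2 * G) \<le> 108000 * M\<^sup>2 * d * (h\<^sup>2 * G) + 6000 * x * (h ^ 4 * N) + 6000 * (h ^ 4 * T)"
        by (simp only: mult.assoc)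
      then have "\<tau> ^ 3 * (h ^ 4 * N) \<le> 2 * (6000 * (h ^ 4 * T))"
      proof (rule comb[OF _ Gb])
        show "2 * (6000 * x * (h ^ 4 * N)) \<le> \<tau> ^ 3 * (h ^ 4 * N)"
          using Nb unfolding x_def[symmetric] by linarith
      qed
      moreover have "1 * (h ^ 4 * N) \<le> \<tau> ^ 3 * (h ^ 4 * N)"
        using \<tau>' N0 by (intro mult_right_mono) auto
      ultimately have "h ^ 4 * N \<le> h ^ 4 * (12000 * T)" by linarith
      then show ?thesis using h by (simp add: mult_le_cancel_left_pos)
    qed
    \<comment> \<open>Only the shell between the two radii is seen by \<open>f\<close>; the ball of
      radius \<open>r\<close> is added back at the end at the cost of one copy of its mass, the
      summand 1 in \<open>C\<close>.\<close>
    have lower: "exp (2 * \<tau> * \<phi>mid) * (S (11/10 * r) - S r) \<le> N"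
    proof -
      let ?B = "lattice_ball h (11/10 * r) :: (real ^ 'd) set" and ?B' = "lattice_ball h r :: (real ^ 'd) set"
      have fB: "finite ?B" using h by (rule finite_lattice_ball)
      have sub: "?B' \<subseteq> ?B" using r by (auto simp: lattice_ball_def)
      have "S (11/10 * r) - S r = (\<Sum>n\<in>?B - ?B'. (u n)\<^sup>2)"
        unfolding S_def sum_diff[OF fB sub] ..
      then have "exp (2 * \<tau> * \<phi>mid) * (S (11/10 * r) - S r) = (\<Sum>n\<in>?B - ?B'. exp (2 * \<tau> * \<phi>mid) * (u n)\<^sup>2)"
        by (simp add: sum_distrib_left)
      also have "\<dots> \<le> (\<Sum>n\<in>?B - ?B'. (f n)\<^sup>2)"
      proof (rule sum_mono)
        fix n assume n: "n \<in> ?B - ?B'"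
        then have "norm n \<le> 11/10 * r" "r \<le> norm n" by (auto simp: lattice_ball_def)
        then have s: "n \<bullet> n \<le> 121/100 * \<rho>" "\<rho> \<le> n \<bullet> n"
          using inner_le_of_norm_le[of n "11/10 * r"] power_mono[of r "norm n" 2] r
          by (simp_all add: \<rho>_def power_mult_distrib power2_norm_eq_inner) (simp_all add: power2_eq_square)
        then have "\<zeta> n = 1" using \<rho> by (intro one) auto
        then have "(f n)\<^sup>2 = exp (2 * \<tau> * weight a n) * (u n)\<^sup>2"
          by (simp add: f_def w_def power_mult_distrib power2_eq_square mult_exp_exp)
        moreover have "\<phi>mid \<le> weight a n"
          unfolding \<phi>mid_def \<phi>_def using s \<rho> by (intro weight_antimono) (auto simp: a_def)
        then have "exp (2 * \<tau> * \<phi>mid) \<le> exp (2 * \<tau> * weight a n)" using \<tau>' by simp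
        ultimately show "exp (2 * \<tau> * \<phi>mid) * (u n)\<^sup>2 \<le> (f n)\<^sup>2" by (simp add: mult_right_mono)
      qed
      also have "\<dots> \<le> N"
        unfolding N_def using r by (intro sum_mono2 finA) (auto simp: A_def lattice_ball_def)
      finally show ?thesis .
    qed
    define p q where "p = 2 * (\<phi>in - \<phi>mid)" and "q = 2 * (\<phi>mid - \<phi>out)"
    have "exp (- (2 * \<tau> * \<phi>mid)) * (exp (2 * \<tau> * \<phi>mid) * (S (11/10 * r) - S r)) \<le> exp (- (2 * \<tau> * \<phi>mid)) * (12000 * T)"
      using lower NT by (intro mult_left_mono) auto
    also have "exp (- (2 * \<tau> * \<phi>mid)) * (exp (2 * \<tau> * \<phi>mid) * (S (11/10 * r) - S r)) = S (11/10 * r) - S r"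
      unfolding mult.assoc[symmetric] mult_exp_exp by simp
    also have "exp (- (2 * \<tau> * \<phi>mid)) * (12000 * T) = 12000 * L * ((4 * C1 + 2 * d) * (exp (p * \<tau>) * S r) + (4 * C2 + 2 * d) * (exp (- q * \<tau>) * S 2))"
    proof -
      have "exp (- (2 * \<tau> * \<phi>mid)) * exp (2 * \<tau> * \<phi>in) = exp (p * \<tau>)" "exp (- (2 * \<tau> * \<phi>mid)) * exp (2 * \<tau> * \<phi>out) = exp (- q * \<tau>)"
        unfolding mult_exp_exp p_def q_def by (simp_all add: algebra_simps)
      note * = this[symmetric]
      show ?thesis unfolding T_def * by (simp add: ac_simps distrib_left)
    qed
    finally have up: "S (11/10 * r) \<le> S r + 12000 * L * ((4 * C1 + 2 * d) * (exp (p * \<tau>) * S r) + (4 * C2 + 2 * d) * (exp (- q * \<tau>) * S 2))"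
      by simp
    have "1 \<le> exp (p * \<tau>)" using pq \<tau>' by (simp add: p_def)
    then have 1: "S r \<le> exp (p * \<tau>) * S r" using S0[of r] by (simp add: mult_le_cancel_right1)
    have X: "0 \<le> exp (p * \<tau>) * S r" "0 \<le> exp (- q * \<tau>) * S 2" using S0 by simp_all
    have "12000 * L * ((4 * C1 + 2 * d) * (exp (p * \<tau>) * S r) + (4 * C2 + 2 * d) * (exp (- q * \<tau>) * S 2))
      \<le> 12000 * L * ((4 * C1 + 4 * C2 + 4 * d) * (exp (p * \<tau>) * S r) + (4 * C1 + 4 * C2 + 4 * d) * (exp (- q * \<tau>) * S 2))"
      using L0 C1 C2 d0 X by (intro mult_left_mono add_mono mult_right_mono) auto
    with up 1 X(2) have "S (11/10 * r) \<le> C * (exp (p * \<tau>) * S r + exp (- q * \<tau>) * S 2)"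
      unfolding C_def by (simp add: algebra_simps)
    then show "(\<Sum>n\<in>lattice_ball h (11/10 * r). (u n)\<^sup>2)
        \<le> C * (exp (2 * (\<phi>in - \<phi>mid) * \<tau>) * (\<Sum>n\<in>lattice_ball h r. (u n)\<^sup>2) + exp (- (2 * (\<phi>mid - \<phi>out)) * \<tau>) * (\<Sum>n\<in>lattice_ball h 2. (u n)\<^sup>2))"
      unfolding S_def p_def q_def .
  qed
qed

section \<open>Optimisation and chaining\<close>

definition mass :: "real \<Rightarrow> (real ^ 'd \<Rightarrow> real) \<Rightarrow> real \<Rightarrow> real" where
  "mass h u r = (\<Sum>n\<in>lattice_ball h r. (u n)\<^sup>2)"

lemma mass_nonneg: "0 \<le> mass h u r"
  by (simp add: mass_def sum_nonneg)

lemma mass_mono: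
  assumes "0 < h" "r \<le> s" shows "mass h u r \<le> mass h u s"
  unfolding mass_def using assms by (intro sum_mono2 finite_lattice_ball) (auto simp: lattice_ball_def)

text \<open>The \<open>itself\<close> argument fixes the dimension, which otherwise occurs only in
  the type of the bound \<open>u\<close>. All constants are quantified before \<open>h\<close> and
  \<open>u\<close>, and the estimate concerns squared norms.\<close>

definition propagates :: "'d::finite itself \<Rightarrow> real \<Rightarrow> real \<Rightarrow> real \<Rightarrow> bool" where
  "propagates _ M r s \<longleftrightarrow> (\<exists>\<alpha> c h0 C. 0 < \<alpha> \<and> \<alpha> < 1 \<and> 0 < c \<and> 0 < h0 \<and> 1 \<le> C \<and>
     (\<forall>h (u :: real ^ 'd \<Rightarrow> real). 0 < h \<longrightarrow> h < h0 \<longrightarrow> almost_solution M h 2 u \<longrightarrow>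
        mass h u s \<le> C * (mass h u r powr \<alpha> * mass h u 2 powr (1 - \<alpha>) + exp (- c / h) * mass h u 2)))"

text \<open>The optimal \<tau> makes both exponentials equal, and then each is the geometric mean
  with exponent \<alpha>. If the optimum exceeds \<open>T\<close>, then \<open>A\<close> is so small
  that at \<open>T\<close> the second term dominates and gives the remainder. If it is below
  \<tau>1, then \<open>B\<close> is bounded by a constant times the geometric mean and
  \<open>S \<le> B\<close> suffices.\<close>

lemma interpolate_exponential_bounds:
  fixes A B S C p q \<tau>1 T :: real
  assumes A: "0 \<le> A" "A \<le> B" and S: "S \<le> B" and C: "1 \<le> C" and pq: "0 < p" "0 < q" and T: "\<tau>1 \<le> T"
    and le: "\<And>\<tau>. \<tau>1 \<le> \<tau> \<Longrightarrow> \<tau> \<le> T \<Longrightarrow> S \<le> C * (exp (p * \<tau>) * A + exp (- q * \<tau>) * B)"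
  defines "\<alpha> \<equiv> q / (p + q)"
  shows "S \<le> (2 * C + exp (q * \<tau>1)) * (A powr \<alpha> * B powr (1 - \<alpha>) + exp (- q * T) * B)"
proof -
  have \<alpha>: "0 < \<alpha>" "\<alpha> < 1" using pq by (simp_all add: \<alpha>_def)
  have pos: "0 \<le> A powr \<alpha> * B powr (1 - \<alpha>)" "0 \<le> exp (- q * T) * B" using A by auto
  have big: "S \<le> (2 * C + exp (q * \<tau>1)) * (A powr \<alpha> * B powr (1 - \<alpha>) + exp (- q * T) * B)"
    if "S \<le> c * x" "c \<le> 2 * C + exp (q * \<tau>1)" "x \<le> A powr \<alpha> * B powr (1 - \<alpha>) + exp (- q * T) * B" "0 \<le> x" for c x
  proof -
    have "c * x \<le> (2 * C + exp (q * \<tau>1)) * x" using that by (intro mult_right_mono) auto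
    also have "\<dots> \<le> (2 * C + exp (q * \<tau>1)) * (A powr \<alpha> * B powr (1 - \<alpha>) + exp (- q * T) * B)"
      using that C by (intro mult_left_mono) (auto intro: add_nonneg_nonneg)
    finally show ?thesis using that by linarith
  qed
  have e: "0 \<le> exp (q * \<tau>1)" by simp
  show ?thesis
  proof (cases "A = 0")
    case True
    then have "S \<le> C * (exp (- q * T) * B)" using le[OF T order_refl] by simp
    then show ?thesis by (rule big) (use C pos e in linarith)+
  next
    case False
    then have AB: "0 < A" "0 < B" using A by auto
    define a b where "a = ln A" and "b = ln B"
    have ab: "A = exp a" "B = exp b" "a \<le> b" using AB A by (simp_all add: a_def b_def)
    have ip: "A powr \<alpha> * B powr (1 - \<alpha>) = exp (\<alpha> * a + (1 - \<alpha>) * b)"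
      using AB by (simp add: powr_def exp_add a_def b_def)
    \<comment> \<open>The solution of \<open>exp (p * t) * A = exp (- q * t) * B\<close>; the case
      \<open>A = 0\<close>, where it would be infinite, has been treated by taking
      \<open>T\<close>.\<close>
    define t where "t = (b - a) / (p + q)"
    have t: "(p + q) * t = b - a" using pq by (simp add: t_def)
    have \<alpha>t: "\<alpha> * (p + q) = q" using pq by (simp add: \<alpha>_def)
    have i1: "\<alpha> * a + (1 - \<alpha>) * b = b - q * t"
    proof -
      have "\<alpha> * a + (1 - \<alpha>) * b = b - \<alpha> * (b - a)" by (simp add: algebra_simps)
      also have "\<alpha> * (b - a) = q * t" unfolding t[symmetric] using \<alpha>t by (simp add: mult.assoc[symmetric])
      finally show ?thesis .
    qed
    consider "T \<le> t" | "t \<le> \<tau>1" | "\<tau>1 \<le> t" "t \<le> T" by linarith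
    then show ?thesis
    proof cases
      case 1
      have "(p + q) * T \<le> (p + q) * t" using 1 pq by (intro mult_left_mono) auto
      then have "p * T + a \<le> - q * T + b" unfolding t by (simp add: algebra_simps)
      then have "exp (p * T) * A \<le> exp (- q * T) * B" unfolding ab mult_exp_exp by simp
      then have "C * (exp (p * T) * A + exp (- q * T) * B) \<le> C * (exp (- q * T) * B + exp (- q * T) * B)"
        using C by (intro mult_left_mono add_right_mono) auto
      with le[OF T order_refl] have "S \<le> C * (exp (- q * T) * B + exp (- q * T) * B)"
        by (rule order_trans)
      then have "S \<le> (2 * C) * (exp (- q * T) * B)" by (simp add: mult_ac)
      then show ?thesis by (rule big) (use pos e in linarith)+
    next
      case 2
      have "q * t \<le> q * \<tau>1" using 2 pq by (intro mult_left_mono) auto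
      then have "B \<le> exp (q * \<tau>1) * (A powr \<alpha> * B powr (1 - \<alpha>))"
        unfolding ip i1 unfolding ab mult_exp_exp by simp
      then have "S \<le> exp (q * \<tau>1) * (A powr \<alpha> * B powr (1 - \<alpha>))" using S by linarith
      then show ?thesis by (rule big) (use pos C in linarith)+
    next
      case 3
      have "p * t + a = b - q * t" using t by (simp add: algebra_simps)
      then have "exp (p * t) * A = A powr \<alpha> * B powr (1 - \<alpha>)" "exp (- q * t) * B = A powr \<alpha> * B powr (1 - \<alpha>)"
        unfolding ip i1 unfolding ab mult_exp_exp by simp_all
      then have "S \<le> (2 * C) * (A powr \<alpha> * B powr (1 - \<alpha>))" using le[OF 3] by simp
      then show ?thesis by (rule big) (use pos e in linarith)+
    qed
  qed
qed

text \<open>The largest admissible parameter is \<open>\<delta> / h\<close>; inserted in the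
  decaying exponential it gives the rate \<open>q * \<delta>\<close>. The bound
  \<open>\<delta> / \<tau>1\<close> on \<open>h\<close> makes the range of parameters
  nonempty.\<close>

lemma propagates_step:
  assumes r: "1/2 \<le> r" "r \<le> 1" and M: "0 \<le> M"
  shows "propagates TYPE('d::finite) M r (11/10 * r)"
proof -
  obtain C \<tau>1 \<delta> p q where C: "1 \<le> C" and \<tau>1: "1 \<le> \<tau>1" and \<delta>: "0 < \<delta>" and pq: "0 < p" "0 < q"
    and est: "\<And>h \<tau> (u :: real ^ 'd \<Rightarrow> real). 0 < h \<Longrightarrow> \<tau>1 \<le> \<tau> \<Longrightarrow> \<tau> * h \<le> \<delta> \<Longrightarrow> almost_solution M h 2 u \<Longrightarrow>
      (\<Sum>n\<in>lattice_ball h (11/10 * r). (u n)\<^sup>2)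
        \<le> C * (exp (p * \<tau>) * (\<Sum>n\<in>lattice_ball h r. (u n)\<^sup>2) + exp (- q * \<tau>) * (\<Sum>n\<in>lattice_ball h 2. (u n)\<^sup>2))"
    by (rule carleman_annulus_estimate[OF r M]) (rule that)
  let ?\<alpha> = "q / (p + q)" and ?C = "2 * C + exp (q * \<tau>1)"
  have "mass h u (11/10 * r) \<le> ?C * (mass h u r powr ?\<alpha> * mass h u 2 powr (1 - ?\<alpha>) + exp (- (q * \<delta>) / h) * mass h u 2)"
    if h: "0 < h" "h < \<delta> / \<tau>1" and sol: "almost_solution M h 2 u" for h and u :: "real ^ 'd \<Rightarrow> real"
  proof -
    have T: "\<tau>1 \<le> \<delta> / h" using h \<tau>1 by (simp add: field_simps)
    have "mass h u (11/10 * r) \<le> ?C * (mass h u r powr ?\<alpha> * mass h u 2 powr (1 - ?\<alpha>) + exp (- q * (\<delta> / h)) * mass h u 2)"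
    proof (rule interpolate_exponential_bounds[OF mass_nonneg _ _ C pq T])
      show "mass h u r \<le> mass h u 2" "mass h u (11/10 * r) \<le> mass h u 2" using h r by (auto intro!: mass_mono)
      fix \<tau> assume "\<tau>1 \<le> \<tau>" "\<tau> \<le> \<delta> / h"
      then show "mass h u (11/10 * r) \<le> C * (exp (p * \<tau>) * mass h u r + exp (- q * \<tau>) * mass h u 2)"
        unfolding mass_def using h by (intro est sol) (auto simp: field_simps)
    qed
    then show ?thesis by simp
  qed
  moreover have "0 < ?\<alpha>" "?\<alpha> < 1" "0 < q * \<delta>" "0 < \<delta> / \<tau>1" using pq \<delta> \<tau>1 by auto
  moreover have "1 \<le> ?C" using C by (simp add: add_increasing2)
  ultimately show ?thesis
    unfolding propagates_def by blast
qed

text \<open>After division by \<open>x + y\<close> both fractions lie between 0 and 1, where an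
  exponent at most 1 does not decrease them, and they add up to 1.\<close>

lemma powr_add_le:
  fixes x y a :: real
  assumes "0 \<le> x" "0 \<le> y" "0 < a" "a \<le> 1"
  shows "(x + y) powr a \<le> x powr a + y powr a"
proof (cases "x + y = 0")
  case True
  then show ?thesis using assms by simp
next
  case False
  define s where "s = x + y"
  have s: "0 < s" using assms False by (simp add: s_def)
  have *: "z / s \<le> (z / s) powr a" if "0 \<le> z" "z \<le> s" for z
    using that s assms powr_mono'[of a 1 "z / s"] by (simp add: powr_mono')
  have "1 = x / s + y / s" using s by (simp add: s_def add_divide_distrib[symmetric])
  also have "\<dots> \<le> (x / s) powr a + (y / s) powr a"
    using assms by (intro add_mono *) (auto simp: s_def)
  also have "\<dots> = (x powr a + y powr a) / s powr a"
    using assms s by (simp add: powr_divide add_divide_distrib)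
  finally show ?thesis using s by (simp add: s_def field_simps)
qed

text \<open>The first estimate is raised to the power \<beta> and inserted into the second. The
  exponents multiply, and the remainder decays at the smaller of the rates
  \<open>c * \<beta>\<close> and \<open>c'\<close>.\<close>

lemma propagates_trans:
  assumes "propagates TYPE('d::finite) M r s" "propagates TYPE('d) M s t"
  shows "propagates TYPE('d) M r t"
proof -
  obtain \<alpha> c h0 C where a: "0 < \<alpha>" "\<alpha> < 1" "0 < c" "0 < h0" "1 \<le> C"
    and 1: "\<And>h (u :: real ^ 'd \<Rightarrow> real). 0 < h \<Longrightarrow> h < h0 \<Longrightarrow> almost_solution M h 2 u \<Longrightarrow>
        mass h u s \<le> C * (mass h u r powr \<alpha> * mass h u 2 powr (1 - \<alpha>) + exp (- c / h) * mass h u 2)"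
    using assms(1) unfolding propagates_def by blast
  obtain \<beta> c' h0' C' where b: "0 < \<beta>" "\<beta> < 1" "0 < c'" "0 < h0'" "1 \<le> C'"
    and 2: "\<And>h (u :: real ^ 'd \<Rightarrow> real). 0 < h \<Longrightarrow> h < h0' \<Longrightarrow> almost_solution M h 2 u \<Longrightarrow>
        mass h u t \<le> C' * (mass h u s powr \<beta> * mass h u 2 powr (1 - \<beta>) + exp (- c' / h) * mass h u 2)"
    using assms(2) unfolding propagates_def by blast
  define k where "k = min (c * \<beta>) c'"
  have k: "0 < k" "k \<le> c * \<beta>" "k \<le> c'" using a b by (simp_all add: k_def)
  have "mass h u t \<le> (2 * C * C') * (mass h u r powr (\<alpha> * \<beta>) * mass h u 2 powr (1 - \<alpha> * \<beta>) + exp (- k / h) * mass h u 2)"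
    if h: "0 < h" "h < min h0 h0'" and sol: "almost_solution M h 2 u" for h and u :: "real ^ 'd \<Rightarrow> real"
  proof -
    define A B where "A = mass h u r" and "B = mass h u 2"
    have AB: "0 \<le> A" "0 \<le> B" by (simp_all add: A_def B_def mass_nonneg)
    have ek: "exp (- c * \<beta> / h) \<le> exp (- k / h)" "exp (- c' / h) \<le> exp (- k / h)"
      using k h by (simp_all add: divide_right_mono)
    have "mass h u s powr \<beta> \<le> (C * (A powr \<alpha> * B powr (1 - \<alpha>) + exp (- c / h) * B)) powr \<beta>"
      using 1[of h u] h sol b mass_nonneg by (intro powr_mono2) (auto simp: A_def B_def)
    also have "\<dots> = C powr \<beta> * (A powr \<alpha> * B powr (1 - \<alpha>) + exp (- c / h) * B) powr \<beta>"
      using a AB by (intro powr_mult) 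
    also have "\<dots> \<le> C powr 1 * ((A powr \<alpha> * B powr (1 - \<alpha>)) powr \<beta> + (exp (- c / h) * B) powr \<beta>)"
      using a b AB by (intro mult_mono powr_mono powr_add_le) auto
    also have "\<dots> = C * (A powr (\<alpha> * \<beta>) * B powr ((1 - \<alpha>) * \<beta>) + exp (- c * \<beta> / h) * B powr \<beta>)"
      using a AB by (simp add: powr_mult powr_powr exp_powr_real)
    finally have "mass h u s powr \<beta> * B powr (1 - \<beta>)
        \<le> C * (A powr (\<alpha> * \<beta>) * B powr ((1 - \<alpha>) * \<beta>) + exp (- c * \<beta> / h) * B powr \<beta>) * B powr (1 - \<beta>)"
      by (rule mult_right_mono) simp
    also have "\<dots> = C * (A powr (\<alpha> * \<beta>) * (B powr ((1 - \<alpha>) * \<beta>) * B powr (1 - \<beta>)) + exp (- c * \<beta> / h) * (B powr \<beta> * B powr (1 - \<beta>)))"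
      by (simp add: algebra_simps)
    also have "\<dots> = C * (A powr (\<alpha> * \<beta>) * B powr (1 - \<alpha> * \<beta>) + exp (- c * \<beta> / h) * B)"
      unfolding powr_add[symmetric] using AB by (simp add: algebra_simps)
    finally have X: "mass h u s powr \<beta> * B powr (1 - \<beta>) \<le> C * (A powr (\<alpha> * \<beta>) * B powr (1 - \<alpha> * \<beta>) + exp (- c * \<beta> / h) * B)" .
    let ?I = "A powr (\<alpha> * \<beta>) * B powr (1 - \<alpha> * \<beta>)" and ?e = "exp (- k / h) * B"
    have I: "0 \<le> ?I" "0 \<le> ?e" using AB by auto
    have "mass h u t \<le> C' * (mass h u s powr \<beta> * B powr (1 - \<beta>) + exp (- c' / h) * B)"
      using 2[of h u] h sol by (simp add: B_def)
    also have "\<dots> \<le> C' * (C * (?I + ?e) + 1 * ?e)"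
    proof (intro mult_left_mono add_mono)
      have "C * (?I + exp (- c * \<beta> / h) * B) \<le> C * (?I + ?e)"
        using a ek(1) AB by (intro mult_left_mono add_left_mono mult_right_mono) auto
      with X show "mass h u s powr \<beta> * B powr (1 - \<beta>) \<le> C * (?I + ?e)" by (rule order_trans)
      show "exp (- c' / h) * B \<le> 1 * ?e" using ek(2) AB by (simp add: mult_right_mono)
    qed (use b in simp)
    also have "\<dots> \<le> C' * (C * (?I + ?e) + C * (?I + ?e))"
      using a b I by (intro mult_left_mono add_left_mono mult_mono) auto
    finally show ?thesis by (simp add: A_def B_def algebra_simps)
  qed
  moreover have "0 < \<alpha> * \<beta>" "\<alpha> * \<beta> < 1" "0 < min h0 h0'" "1 \<le> 2 * C * C'"
    using a b mult_strict_mono[of \<alpha> 1 \<beta> 1] mult_mono[of 1 C 1 C'] by auto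
  ultimately show ?thesis
    unfolding propagates_def using k(1) by blast
qed

lemma propagates_antimono:
  assumes "propagates TYPE('d::finite) M r s" "s' \<le> s"
  shows "propagates TYPE('d) M r s'"
proof -
  obtain \<alpha> c h0 C where a: "0 < \<alpha>" "\<alpha> < 1" "0 < c" "0 < h0" "1 \<le> C"
    and est: "\<And>h (u :: real ^ 'd \<Rightarrow> real). 0 < h \<Longrightarrow> h < h0 \<Longrightarrow> almost_solution M h 2 u \<Longrightarrow>
        mass h u s \<le> C * (mass h u r powr \<alpha> * mass h u 2 powr (1 - \<alpha>) + exp (- c / h) * mass h u 2)"
    using assms(1) unfolding propagates_def by blast
  have "mass h u s' \<le> C * (mass h u r powr \<alpha> * mass h u 2 powr (1 - \<alpha>) + exp (- c / h) * mass h u 2)"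
    if "0 < h" "h < h0" "almost_solution M h 2 u" for h and u :: "real ^ 'd \<Rightarrow> real"
    using est[OF that] mass_mono[OF that(1) assms(2), of u] by linarith
  with a show ?thesis
    unfolding propagates_def by blast
qed

lemma propagates_half_one:
  assumes M: "0 \<le> M"
  shows "propagates TYPE('d::finite) M (1/2) 1"
proof -
  have *: "propagates TYPE('d) M (1/2) (1/2 * (11/10) ^ Suc k)" if "k \<le> 7" for k
    using that
  proof (induction k)
    case 0
    then show ?case using propagates_step[of "1/2" M, OF _ _ M] by simp
  next
    case (Suc k)
    have "(11/10 :: real) ^ Suc k \<le> (11/10) ^ 7" using Suc.prems by (intro power_increasing) auto
    \<comment> \<open>The radius before each of the eight steps is thus at most 1, as
      \<open>propagates_step\<close> demands, while the eighth power of 11/10 exceeds 2 and the last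
      step passes radius 1.\<close>
    also have "(11/10 :: real) ^ 7 \<le> 2" by (simp add: eval_nat_numeral)
    finally have "propagates TYPE('d) M (1/2 * (11/10) ^ Suc k) (11/10 * (1/2 * (11/10) ^ Suc k))"
      using one_le_power[of "11/10 :: real" "Suc k"] by (intro propagates_step M) auto
    moreover have "11/10 * (1/2 * (11/10) ^ Suc k) = 1/2 * (11/10 :: real) ^ Suc (Suc k)" by simp
    ultimately show ?case using Suc by (simp add: propagates_trans)
  qed
  have ge: "1 \<le> 1/2 * (11/10 :: real) ^ 8" by (simp add: eval_nat_numeral)
  show ?thesis
    using propagates_antimono[OF *[of 7], of 1] ge by simp
qed

section \<open>Return to the magnetic operator and to norms\<close>

lemma sqrt_powr: "0 \<le> x \<Longrightarrow> sqrt (x powr a) = sqrt x powr a"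
  by (simp add: powr_half_sqrt[symmetric] powr_powr mult.commute)

text \<open>The equation is multiplied by the square of \<open>h\<close>, and each component of
  \<open>B\<close> is bounded by its norm. Setting \<open>u\<close> to 0 off the lattice leaves the
  equation intact because neighbours of lattice points are lattice points.\<close>

lemma almost_solution_of_magnetic_schroedinger:
  fixes u :: "real ^ 'd \<Rightarrow> real"
  assumes h: "0 < h" and B: "\<And>n. n \<in> lattice h \<Longrightarrow> norm (B n) \<le> M" and V: "\<And>n. n \<in> lattice h \<Longrightarrow> \<bar>V n\<bar> \<le> M"
    and P: "\<And>n. n \<in> lattice_ball h r \<Longrightarrow> magnetic_schroedinger h B V u n = 0"
  shows "almost_solution M h r (\<lambda>n. if n \<in> lattice h then u n else 0)"
  unfolding almost_solution_def
proof (intro conjI allI impI ballI)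
  fix n :: "real ^ 'd" assume n: "n \<in> lattice_ball h r"
  then have nl: "n \<in> lattice h" by (simp add: lattice_ball_def)
  let ?D = "\<lambda>j. u (n + h *\<^sub>R axis j 1) - u n"
  have "h\<^sup>2 * magnetic_schroedinger h B V u n = disc_laplacian h u n + h * (\<Sum>j\<in>UNIV. B n $ j * ?D j) + h\<^sup>2 * (V n * u n)"
    using h unfolding magnetic_schroedinger_def fwd_diff_def
    by (simp add: distrib_left power2_eq_square field_simps)
  then have "disc_laplacian h u n = - (h * (\<Sum>j\<in>UNIV. B n $ j * ?D j)) - h\<^sup>2 * (V n * u n)"
    using P[OF n] by simp
  then have "\<bar>disc_laplacian h u n\<bar> \<le> h * \<bar>\<Sum>j\<in>UNIV. B n $ j * ?D j\<bar> + h\<^sup>2 * (\<bar>V n\<bar> * \<bar>u n\<bar>)"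
    using abs_triangle_ineq4[of "- (h * (\<Sum>j\<in>UNIV. B n $ j * ?D j))" "h\<^sup>2 * (V n * u n)"] h by (simp add: abs_mult)
  also have "\<dots> \<le> h * (\<Sum>j\<in>UNIV. M * \<bar>?D j\<bar>) + h\<^sup>2 * (M * \<bar>u n\<bar>)"
  proof (intro add_mono mult_left_mono)
    have "\<bar>\<Sum>j\<in>UNIV. B n $ j * ?D j\<bar> \<le> (\<Sum>j\<in>UNIV. \<bar>B n $ j * ?D j\<bar>)" by (rule sum_abs)
    also have "\<dots> \<le> (\<Sum>j\<in>UNIV. M * \<bar>?D j\<bar>)"
      unfolding abs_mult using component_le_norm_cart[of "B n"] B[OF nl]
      by (intro sum_mono mult_right_mono) (auto intro: order_trans)
    finally show "\<bar>\<Sum>j\<in>UNIV. B n $ j * ?D j\<bar> \<le> (\<Sum>j\<in>UNIV. M * \<bar>?D j\<bar>)" .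
  qed (use h V[OF nl] in \<open>auto intro: mult_right_mono\<close>)
  finally show "\<bar>disc_laplacian h (\<lambda>n. if n \<in> lattice h then u n else 0) n\<bar>
      \<le> M * h * (\<Sum>j\<in>UNIV. \<bar>(if n + h *\<^sub>R axis j 1 \<in> lattice h then u (n + h *\<^sub>R axis j 1) else 0) - (if n \<in> lattice h then u n else 0)\<bar>)
        + M * h\<^sup>2 * \<bar>if n \<in> lattice h then u n else 0\<bar>"
    using nl by (simp add: disc_laplacian_eq lattice_axis_iff sum_distrib_left mult_ac)
qed simp

theorem theorem2:
  fixes B :: "real \<Rightarrow> real ^ 'd \<Rightarrow> real ^ 'd"
    and V :: "real \<Rightarrow> real ^ 'd \<Rightarrow> real"
    and M :: real
  assumes "\<And>h n. 0 < h \<Longrightarrow> h < 1 \<Longrightarrow> n \<in> lattice h \<Longrightarrow> norm (B h n) \<le> M"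
    and "\<And>h n. 0 < h \<Longrightarrow> h < 1 \<Longrightarrow> n \<in> lattice h \<Longrightarrow> \<bar>V h n\<bar> \<le> M"
  shows "\<exists>\<alpha> c0 h0 C :: real. 0 < \<alpha> \<and> \<alpha> < 1 \<and> 0 < c0 \<and> 0 < h0 \<and> h0 < 1 \<and> 1 < C \<and>
    (\<forall>h u. 0 < h \<longrightarrow> h < h0 \<longrightarrow>
      (\<forall>n\<in>lattice_ball h 4. magnetic_schroedinger h (B h) (V h) u n = 0) \<longrightarrow>
      L2_set u (lattice_ball h 1)
        \<le> C * (L2_set u (lattice_ball h (1/2)) powr \<alpha> * L2_set u (lattice_ball h 2) powr (1 - \<alpha>)
               + exp (- c0 * inverse h) * L2_set u (lattice_ball h 2)))"
proof -
  \<comment> \<open>A single lattice point at which the bound on \<open>V\<close> can be evaluated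
    shows that \<open>M\<close> is nonnegative.\<close>
  have "(0 :: real ^ 'd) \<in> lattice (1/2)" by (auto simp: lattice_def intro: exI[of _ 0])
  then have M: "0 \<le> M" using assms(2)[of "1/2" 0] by simp
  obtain \<alpha> c h0 C where a: "0 < \<alpha>" "\<alpha> < 1" "0 < c" "0 < h0" "1 \<le> C"
    and est: "\<And>h (u :: real ^ 'd \<Rightarrow> real). 0 < h \<Longrightarrow> h < h0 \<Longrightarrow> almost_solution M h 2 u \<Longrightarrow>
        mass h u 1 \<le> C * (mass h u (1/2) powr \<alpha> * mass h u 2 powr (1 - \<alpha>) + exp (- c / h) * mass h u 2)"
    using propagates_half_one[OF M, where 'd = 'd] unfolding propagates_def by blast
  have "L2_set u (lattice_ball h 1)
        \<le> (2 * C) * (L2_set u (lattice_ball h (1/2)) powr \<alpha> * L2_set u (lattice_ball h 2) powr (1 - \<alpha>)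
               + exp (- (c / 2) * inverse h) * L2_set u (lattice_ball h 2))"
    if h: "0 < h" "h < min h0 (1/2)" and P: "\<forall>n\<in>lattice_ball h 4. magnetic_schroedinger h (B h) (V h) u n = 0" for h u
  proof -
    define v where "v n = (if n \<in> lattice h then u n else 0)" for n
    have "almost_solution M h 4 v"
      unfolding v_def[abs_def] using h P assms by (intro almost_solution_of_magnetic_schroedinger[of h "B h" M "V h"]) auto
    then have "almost_solution M h 2 v" by (auto simp: almost_solution_def lattice_ball_def)
    then have m: "mass h v 1 \<le> C * (mass h v (1/2) powr \<alpha> * mass h v 2 powr (1 - \<alpha>) + exp (- c / h) * mass h v 2)"
      using est[of h v] h by simp
    have L2: "L2_set u (lattice_ball h r) = sqrt (mass h v r)" for r
      unfolding L2_set_def mass_def v_def by (intro arg_cong[where f = sqrt] sum.cong) (auto simp: lattice_ball_def)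
    \<comment> \<open>Passing from masses to norms takes a square root: \<alpha> is unchanged and
      the rate \<open>c\<close> is halved. Doubling \<open>C\<close> makes the final constant
      strictly larger than 1.\<close>
    have C': "sqrt C \<le> 2 * C" using a real_sqrt_le_mono[of C "C\<^sup>2"] by (simp add: power2_eq_square)
    have "sqrt (mass h v 1) \<le> sqrt C * sqrt (mass h v (1/2) powr \<alpha> * mass h v 2 powr (1 - \<alpha>) + exp (- c / h) * mass h v 2)"
      using real_sqrt_le_mono[OF m] by (simp add: real_sqrt_mult)
    also have "\<dots> \<le> (2 * C) * (sqrt (mass h v (1/2) powr \<alpha> * mass h v 2 powr (1 - \<alpha>)) + sqrt (exp (- c / h) * mass h v 2))"
      using C' a mass_nonneg[of h v] by (intro mult_mono sqrt_add_le_add_sqrt add_nonneg_nonneg) auto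
    also have "sqrt (mass h v (1/2) powr \<alpha> * mass h v 2 powr (1 - \<alpha>)) = sqrt (mass h v (1/2)) powr \<alpha> * sqrt (mass h v 2) powr (1 - \<alpha>)"
      by (simp add: real_sqrt_mult sqrt_powr mass_nonneg)
    also have "sqrt (exp (- c / h) * mass h v 2) = exp (- (c / 2) * inverse h) * sqrt (mass h v 2)"
    proof -
      have "exp (- c / h) = (exp (- (c / 2) * inverse h))\<^sup>2"
        by (simp add: power2_eq_square mult_exp_exp field_simps)
      then show ?thesis by (simp add: real_sqrt_mult)
    qed
    finally show ?thesis unfolding L2 .
  qed
  then have "\<forall>h u. 0 < h \<longrightarrow> h < min h0 (1/2) \<longrightarrow>
      (\<forall>n\<in>lattice_ball h 4. magnetic_schroedinger h (B h) (V h) u n = 0) \<longrightarrow>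
      L2_set u (lattice_ball h 1)
        \<le> (2 * C) * (L2_set u (lattice_ball h (1/2)) powr \<alpha> * L2_set u (lattice_ball h 2) powr (1 - \<alpha>)
               + exp (- (c / 2) * inverse h) * L2_set u (lattice_ball h 2))"
    by blast
  moreover have "0 < c / 2" "0 < min h0 (1/2)" "min h0 (1/2) < 1" "1 < 2 * C" using a by auto
  ultimately show ?thesis
    using a(1,2) by (intro exI conjI)
qed

end
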